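(* Let $\gamma:\mathcal{E}\to\mathrm{Set}$ be a Grothendieck topos and let $U\xrightarrow{\zeta}\gamma^*I$, $\{U_i\}_{i\in I}$, be a cover. Suppose that, for each $(i,j)\in N_1$ and each $(\ell,t,r)\in T_2$, one of the following holds. (1) $\mathcal{C}$ is a set of objects as in the $0$-span construction, such that the families of all maps $\{W\to P_{ij}\}_{W\in\mathcal{C}}$ and $\{W\to P_{\ell tr}\}_{W\in\mathcal{C}}$ are epimorphic; or (2) $\mathcal{C}_{sp}$ and $\mathcal{C}$ are as in the $1$-span construction, such that the families of all maps $\{W\xrightarrow{(u,v)}P_{ij}\}_{(u,v)\in\mathcal{C}_{sp}}$ and $\{W\to P_{\ell tr}\}_{W\in\mathcal{C}}$ are epimorphic. Then the corresponding span refinement $H_\bullet\xrightarrow{h_\bullet}U_\bullet$ is a hypercover.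
   Context: $\gamma^*:\mathrm{Set}\to\mathcal{E}$ is the inverse image functor. A family $U\xrightarrow{\zeta}\gamma^*I$ is the same as $\{U_i\}_{i\in I}$ with $U=\sum_iU_i$; all components of families are assumed non-empty. It is a cover if $U\to1$ is an epimorphism. A simplicial family $H_\bullet\to\gamma^*(S_\bullet)$ is a morphism of simplicial objects, with $H_\bullet$ simplicial in $\mathcal{E}$ and $S_\bullet$ a simplicial set; $(H_n)_w$ denotes the component over $w\in S_n$. The Čech simplicial family $U_\bullet\to\gamma^*N_\bullet$ has $N_n=\{(i_0,\dots,i_n)\in I^{n+1}\mid U_{i_0}\times\cdots\times U_{i_n}\neq\emptyset\}$ and $U_n=U^{n+1}=\sum_{N_n}U_{i_0}\times\cdots\times U_{i_n}$, with projections as faces and diagonals as degeneracies. Spans. A $1$-span over the objects $U_i$ is a diagram $U_i\xleftarrow{u}V\xrightarrow{v}U_j$ with vertex $V$; its dual is $U_j\xleftarrow{v}V\xrightarrow{u}U_i$. An $n$-span is the commutative diagram obtained by placing a generic $n$-simplex at the top, drawing an arrow to each of its $n+1$ ordered faces, and repeating this until the $n+1$ vertices are reached at the bottom level. So a $2$-span over $(U_i,U_j,U_k)$ consists of an object $W$ with maps $x:W\to X$, $y:W\to Y$, $z:W\to Z$ and $1$-spans $U_i\xleftarrow{u_a}X\xrightarrow{v_a}U_j$, $U_i\xleftarrow{u_b}Y\xrightarrow{v_b}U_k$, $U_j\xleftarrow{u_c}Z\xrightarrow{v_c}U_k$ such that the composites agree, giving $f:W\to U_i$, $h:W\to U_j$,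 $g:W\to U_k$. $0$-span construction. $\mathcal{C}$ is a set of non-empty objects closed under isomorphism with $U_i\in\mathcal{C}$ for all $i$. $S_0=N_0=I$. $S_1$ is the set of all $1$-spans $\ell=(U_i\xleftarrow{u}V\xrightarrow{v}U_j)$ with $V\in\mathcal{C}$; $\partial_0(\ell)=j$, $\partial_1(\ell)=i$, $\sigma_0(i)=(U_i\xleftarrow{id}U_i\xrightarrow{id}U_i)$. $S_2$ is the set of all $2$-spans $w$ over the objects $U_i$ with $X,Y,Z,W\in\mathcal{C}$; $\partial_2(w)$, $\partial_1(w)$, $\partial_0(w)$ are the $1$-spans with vertices $X$, $Y$, $Z$ respectively. For $\ell=(U_i\xleftarrow{u}V\xrightarrow{v}U_j)$, the degeneracies are the $2$-spans with $W=X=Y=Z=V$ and $x=y=z=id_V$, where $\sigma_0(\ell)$, over $(U_i,U_i,U_j)$, has $1$-spans $X:(u,u)$, $Y:(u,v)$, $Z:(u,v)$, and $\sigma_1(\ell)$, over $(U_i,U_j,U_j)$, has $1$-spans $X:(u,v)$, $Y:(u,v)$, $Z:(v,v)$. The simplicial object is given by the coproducts of the top vertices: $(H_0)_i=U_i$, $(H_1)_\ell=V$, $(H_2)_w=W$, with $(s_0)_i=id_{U_i}$, $(d_0)_\ell=v$, $(d_1)_\ell=u$, $(s_0)_\ell=(s_1)_\ell=id_V$, $(d_0)_w=z$, $(d_1)_w=y$, $(d_2)_w=x$. The morphism $h_\bullet:H_\bullet\to U_\bullet$ is $id$ in degree $0$, and is induced by $(u,v):V\to U_i\times U_j$ and $(f,h,g):W\to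 U_i\times U_j\times U_k$ in degrees $1$ and $2$. Higher terms are obtained by the same procedure from $n$-spans. $1$-span construction. $\mathcal{C}_{sp}$ is a set of non-empty $1$-spans over the objects $U_i$, closed under isomorphisms and under the dual span, containing $(U_i\xleftarrow{id}U_i\xrightarrow{id}U_i)$ for all $i$, and such that $(U_i\xleftarrow{u}V\xrightarrow{u}U_i)$ and $(U_j\xleftarrow{v}V\xrightarrow{v}U_j)$ are in $\mathcal{C}_{sp}$ for all $(U_i\xleftarrow{u}V\xrightarrow{v}U_j)\in\mathcal{C}_{sp}$; $\mathcal{C}$ is the set of vertices of the spans in $\mathcal{C}_{sp}$. One takes $S_0=I$, $S_1=\mathcal{C}_{sp}$, and $S_2$ as before but requiring that the three $1$-spans with vertices $X,Y,Z$ be in $\mathcal{C}_{sp}$; the simplicial structure, $H_\bullet$ and $h_\bullet$ are defined as before. Notation. $P_{ij}=U_i\times U_j$. For $\ell,t,r\in S_1$ with $\partial_1(t)=\partial_1(\ell)=i$, $\partial_0(\ell)=\partial_1(r)=j$, $\partial_0(t)=\partial_0(r)=k$, $P_{\ell tr}$ is the limit of the diagram formed by the three $1$-spans $(H_0)_i\leftarrow(H_1)_\ell\to(H_0)_j$, $(H_0)_i\leftarrow(H_1)_t\to(H_0)_k$, $(H_0)_j\leftarrow(H_1)_r\to(H_0)_k$; $T_2$ is the set of such triples with $P_{\ell tr}\neq\emptyset$. One has $(\mathrm{cosk}_0H_\bullet)_1=\sum_{(i,j)\in N_1}P_{ij}$ and $(\mathrm{cosk}_1H_\bullet)_2=\sum_{(\ell,t,r)\in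 T_2}P_{\ell tr}$. Hypercover (in the sense of Artin–Mazur): the refinement $H_\bullet\to U_\bullet$ is a hypercover if the maps $H_k\to(\mathrm{cosk}_{k-1}H_\bullet)_k$ are epimorphic, for all $k\geq1$.
   Formalization: The stated hypotheses give epimorphy only for k = 1, 2 (degree 3 can fail, e.g. in Set×Set); for the full hypercover condition it is additionally assumed that maps from objects of C cover every non-empty component of (cosk_{k-1}H)_k for all k ≥ 3. *)

theory Defs
  imports "HOL-Library.FuncSet"
begin

unbundle cardinal_syntax

section \<open>Categories\<close>

record ('o, 'a) category =
  Ob :: "'o set"
  Ar :: "'a set"
  Dom :: "'a \<Rightarrow> 'o"
  Cod :: "'a \<Rightarrow> 'o"
  Id :: "'o \<Rightarrow> 'a"
  Comp :: "'a \<Rightarrow> 'a \<Rightarrow> 'a" (infixr "\<cdot>\<index>" 70)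

definition hom :: "('o, 'a) category \<Rightarrow> 'o \<Rightarrow> 'o \<Rightarrow> 'a set" where
  "hom E A B = {f \<in> Ar E. Dom E f = A \<and> Cod E f = B}"

definition is_category :: "('o, 'a) category \<Rightarrow> bool" where
  "is_category E \<longleftrightarrow>
     (\<forall>f\<in>Ar E. Dom E f \<in> Ob E \<and> Cod E f \<in> Ob E) \<and>
     (\<forall>A\<in>Ob E. Id E A \<in> hom E A A) \<and>
     (\<forall>A B C f g. f \<in> hom E A B \<longrightarrow> g \<in> hom E B C \<longrightarrow> g \<cdot>\<^bsub>E\<^esub> f \<in> hom E A C) \<and>
     (\<forall>A B f. f \<in> hom E A B \<longrightarrow> f \<cdot>\<^bsub>E\<^esub> Id E A = f \<and> Id E B \<cdot>\<^bsub>E\<^esub> f = f) \<and>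
     (\<forall>A B C D f g k. f \<in> hom E A B \<longrightarrow> g \<in> hom E B C \<longrightarrow> k \<in> hom E C D \<longrightarrow>
        k \<cdot>\<^bsub>E\<^esub> (g \<cdot>\<^bsub>E\<^esub> f) = (k \<cdot>\<^bsub>E\<^esub> g) \<cdot>\<^bsub>E\<^esub> f)"

definition is_iso :: "('o, 'a) category \<Rightarrow> 'o \<Rightarrow> 'o \<Rightarrow> 'a \<Rightarrow> bool" where
  "is_iso E A B f \<longleftrightarrow> f \<in> hom E A B \<and>
     (\<exists>g\<in>hom E B A. g \<cdot>\<^bsub>E\<^esub> f = Id E A \<and> f \<cdot>\<^bsub>E\<^esub> g = Id E B)"

definition is_terminal :: "('o, 'a) category \<Rightarrow> 'o \<Rightarrow> bool" where
  "is_terminal E T \<longleftrightarrow> T \<in> Ob E \<and> (\<forall>A\<in>Ob E. \<exists>!f. f \<in> hom E A T)"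

definition is_initial :: "('o, 'a) category \<Rightarrow> 'o \<Rightarrow> bool" where
  "is_initial E Z \<longleftrightarrow> Z \<in> Ob E \<and> (\<forall>A\<in>Ob E. \<exists>!f. f \<in> hom E Z A)"

definition nonempty_ob :: "('o, 'a) category \<Rightarrow> 'o \<Rightarrow> bool" where
  "nonempty_ob E A \<longleftrightarrow> A \<in> Ob E \<and> \<not> is_initial E A"

text \<open>A set \<open>F\<close> of arrows with codomain \<open>P\<close> as a family; a single arrow \<open>f\<close> is epimorphic
  when \<open>{f}\<close> is.\<close>

definition epimorphic :: "('o, 'a) category \<Rightarrow> 'o \<Rightarrow> 'a set \<Rightarrow> bool" where
  "epimorphic E P F \<longleftrightarrow>
     (\<forall>Q. \<forall>g\<in>hom E P Q. \<forall>h\<in>hom E P Q. (\<forall>f\<in>F. g \<cdot>\<^bsub>E\<^esub> f = h \<cdot>\<^bsub>E\<^esub> f) \<longrightarrow> g = h)"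

definition maps_into :: "('o, 'a) category \<Rightarrow> 'o set \<Rightarrow> 'o \<Rightarrow> 'a set" where
  "maps_into E C P = (\<Union>W\<in>C. hom E W P)"

definition is_coproduct ::
  "('o, 'a) category \<Rightarrow> 'x set \<Rightarrow> ('x \<Rightarrow> 'o) \<Rightarrow> 'o \<Rightarrow> ('x \<Rightarrow> 'a) \<Rightarrow> bool" where
  "is_coproduct E X D S inc \<longleftrightarrow>
     S \<in> Ob E \<and> (\<forall>x\<in>X. inc x \<in> hom E (D x) S) \<and>
     (\<forall>Q\<in>Ob E. \<forall>q. (\<forall>x\<in>X. q x \<in> hom E (D x) Q) \<longrightarrow>
        (\<exists>!f. f \<in> hom E S Q \<and> (\<forall>x\<in>X. f \<cdot>\<^bsub>E\<^esub> inc x = q x)))"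

text \<open>Limits are presented by objects \<open>D x\<close>, \<open>x \<in> X\<close>, and a set \<open>R\<close> of relations: a relation
  \<open>(x, a, y, b)\<close> stands for a pair of arrows \<open>a : D x \<rightarrow> B\<close> and \<open>b : D y \<rightarrow> B\<close> of the diagram.
  The leg of a cone at \<open>B\<close> is the common value of the two composites, and is left implicit.\<close>

definition is_cone ::
  "('o, 'a) category \<Rightarrow> 'x set \<Rightarrow> ('x \<Rightarrow> 'o) \<Rightarrow> ('x \<times> 'a \<times> 'x \<times> 'a) set \<Rightarrow> 'o \<Rightarrow> ('x \<Rightarrow> 'a) \<Rightarrow> bool"
  where
  "is_cone E X D R P p \<longleftrightarrow>
     P \<in> Ob E \<and> (\<forall>x\<in>X. p x \<in> hom E P (D x)) \<and>
     (\<forall>(x, a, y, b)\<in>R. a \<cdot>\<^bsub>E\<^esub> p x = b \<cdot>\<^bsub>E\<^esub> p y)"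

definition is_limit ::
  "('o, 'a) category \<Rightarrow> 'x set \<Rightarrow> ('x \<Rightarrow> 'o) \<Rightarrow> ('x \<times> 'a \<times> 'x \<times> 'a) set \<Rightarrow> 'o \<Rightarrow> ('x \<Rightarrow> 'a) \<Rightarrow> bool"
  where
  "is_limit E X D R P p \<longleftrightarrow>
     is_cone E X D R P p \<and>
     (\<forall>Q q. is_cone E X D R Q q \<longrightarrow>
        (\<exists>!f. f \<in> hom E Q P \<and> (\<forall>x\<in>X. p x \<cdot>\<^bsub>E\<^esub> f = q x)))"

definition is_equivalence ::
  "('o, 'a) category \<Rightarrow> ('p, 'b) category \<Rightarrow> ('o \<Rightarrow> 'p) \<Rightarrow> ('a \<Rightarrow> 'b) \<Rightarrow> bool" where
  "is_equivalence E F \<Phi> \<phi> \<longleftrightarrow>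
     (\<forall>A\<in>Ob E. \<Phi> A \<in> Ob F \<and> \<phi> (Id E A) = Id F (\<Phi> A)) \<and>
     (\<forall>A B C f g. f \<in> hom E A B \<longrightarrow> g \<in> hom E B C \<longrightarrow> \<phi> (g \<cdot>\<^bsub>E\<^esub> f) = \<phi> g \<cdot>\<^bsub>F\<^esub> \<phi> f) \<and>
     (\<forall>A\<in>Ob E. \<forall>B\<in>Ob E. bij_betw \<phi> (hom E A B) (hom F (\<Phi> A) (\<Phi> B))) \<and>
     (\<forall>Y\<in>Ob F. \<exists>A\<in>Ob E. \<exists>f. is_iso F (\<Phi> A) Y f)"


section \<open>Grothendieck toposes\<close>

text \<open>The category Set is represented by a type \<open>'u\<close> in the role of a Grothendieck universe: the
  small sets are those of cardinality less than that of \<open>'u\<close>.  The closure conditions make that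
  cardinal a regular strong limit (and force it to be infinite).\<close>

definition small :: "'u itself \<Rightarrow> 'x set \<Rightarrow> bool" where
  "small TYPE('u) A \<longleftrightarrow> |A| <o |UNIV :: 'u set|"

definition universe :: "'u itself \<Rightarrow> bool" where
  "universe TYPE('u) \<longleftrightarrow>
     (\<forall>A :: 'u set. small TYPE('u) A \<longrightarrow> small TYPE('u) (Pow A)) \<and>
     (\<forall>(A :: 'u set) (B :: 'u \<Rightarrow> 'u set). small TYPE('u) A \<longrightarrow> (\<forall>x\<in>A. small TYPE('u) (B x)) \<longrightarrow>
        small TYPE('u) (\<Union>x\<in>A. B x))"

definition is_sieve :: "('o, 'a) category \<Rightarrow> 'o \<Rightarrow> 'a set \<Rightarrow> bool" where
  "is_sieve D c S \<longleftrightarrow> S \<subseteq> {f \<in> Ar D. Cod D f = c} \<and>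
     (\<forall>f\<in>S. \<forall>g\<in>Ar D. Cod D g = Dom D f \<longrightarrow> f \<cdot>\<^bsub>D\<^esub> g \<in> S)"

definition pull_sieve :: "('o, 'a) category \<Rightarrow> 'a \<Rightarrow> 'a set \<Rightarrow> 'a set" where
  "pull_sieve D f S = {g \<in> Ar D. Cod D g = Dom D f \<and> f \<cdot>\<^bsub>D\<^esub> g \<in> S}"

definition is_topology :: "('o, 'a) category \<Rightarrow> ('o \<Rightarrow> 'a set set) \<Rightarrow> bool" where
  "is_topology D J \<longleftrightarrow>
     (\<forall>c\<in>Ob D. (\<forall>S\<in>J c. is_sieve D c S) \<and> {f \<in> Ar D. Cod D f = c} \<in> J c) \<and>
     (\<forall>f\<in>Ar D. \<forall>S\<in>J (Cod D f). pull_sieve D f S \<in> J (Dom D f)) \<and>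
     (\<forall>c\<in>Ob D. \<forall>S\<in>J c. \<forall>R. is_sieve D c R \<longrightarrow>
        (\<forall>f\<in>S. pull_sieve D f R \<in> J (Dom D f)) \<longrightarrow> R \<in> J c)"

record 'u presheaf =
  sec :: "'u \<Rightarrow> 'u set"
  res :: "'u \<Rightarrow> 'u \<Rightarrow> 'u"

definition is_presheaf :: "('u, 'u) category \<Rightarrow> 'u presheaf \<Rightarrow> bool" where
  "is_presheaf D F \<longleftrightarrow>
     (\<forall>c\<in>Ob D. small TYPE('u) (sec F c)) \<and>
     (\<forall>f\<in>Ar D. res F f \<in> sec F (Cod D f) \<rightarrow> sec F (Dom D f)) \<and>
     (\<forall>c\<in>Ob D. \<forall>x\<in>sec F c. res F (Id D c) x = x) \<and>
     (\<forall>a b c f g. f \<in> hom D a b \<longrightarrow> g \<in> hom D b c \<longrightarrow>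
        (\<forall>x\<in>sec F c. res F (g \<cdot>\<^bsub>D\<^esub> f) x = res F f (res F g x)))"

definition is_sheaf :: "('u, 'u) category \<Rightarrow> ('u \<Rightarrow> 'u set set) \<Rightarrow> 'u presheaf \<Rightarrow> bool" where
  "is_sheaf D J F \<longleftrightarrow> is_presheaf D F \<and>
     (\<forall>c\<in>Ob D. \<forall>S\<in>J c. \<forall>x.
        (\<forall>f\<in>S. x f \<in> sec F (Dom D f)) \<longrightarrow>
        (\<forall>f\<in>S. \<forall>g\<in>Ar D. Cod D g = Dom D f \<longrightarrow> x (f \<cdot>\<^bsub>D\<^esub> g) = res F g (x f)) \<longrightarrow>
        (\<exists>!y. y \<in> sec F c \<and> (\<forall>f\<in>S. res F f y = x f)))"

text \<open>Components of natural transformations are extensional, so that equality of arrows is equality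
  of transformations.\<close>

definition is_natural ::
  "('u, 'u) category \<Rightarrow> 'u presheaf \<Rightarrow> 'u presheaf \<Rightarrow> ('u \<Rightarrow> 'u \<Rightarrow> 'u) \<Rightarrow> bool" where
  "is_natural D F G \<eta> \<longleftrightarrow>
     \<eta> \<in> (\<Pi>\<^sub>E c\<in>Ob D. sec F c \<rightarrow>\<^sub>E sec G c) \<and>
     (\<forall>f\<in>Ar D. \<forall>x\<in>sec F (Cod D f). \<eta> (Dom D f) (res F f x) = res G f (\<eta> (Cod D f) x))"

definition Sh :: "('u, 'u) category \<Rightarrow> ('u \<Rightarrow> 'u set set) \<Rightarrow>
    ('u presheaf, 'u presheaf \<times> ('u \<Rightarrow> 'u \<Rightarrow> 'u) \<times> 'u presheaf) category" where
  "Sh D J =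
     \<lparr> Ob = {F. is_sheaf D J F},
       Ar = {(F, \<eta>, G). is_sheaf D J F \<and> is_sheaf D J G \<and> is_natural D F G \<eta>},
       Dom = (\<lambda>(F, \<eta>, G). F),
       Cod = (\<lambda>(F, \<eta>, G). G),
       Id = (\<lambda>F. (F, (\<lambda>c\<in>Ob D. \<lambda>x\<in>sec F c. x), F)),
       Comp = (\<lambda>(G', \<theta>, H) (F, \<eta>, G). (F, (\<lambda>c\<in>Ob D. \<lambda>x\<in>sec F c. \<theta> c (\<eta> c x)), H)) \<rparr>"

text \<open>A small site may be taken to have its objects and arrows in the universe.\<close>

definition grothendieck_topos :: "'u itself \<Rightarrow> ('o, 'a) category \<Rightarrow> bool" where
  "grothendieck_topos TYPE('u) E \<longleftrightarrow> is_category E \<and>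
     (\<exists>(D :: ('u, 'u) category) J \<Phi> \<phi>.
        is_category D \<and> small TYPE('u) (Ob D) \<and> small TYPE('u) (Ar D) \<and> is_topology D J \<and>
        is_equivalence E (Sh D J) \<Phi> \<phi>)"


section \<open>Covers and simplicial objects\<close>

text \<open>The family \<open>\<zeta> : U \<rightarrow> \<gamma>\<^sup>*I\<close> is given by its components \<open>U i\<close> and the coproduct
  \<open>\<Sigma>U\<close> of these with its injections.\<close>

definition is_cover ::
  "'u itself \<Rightarrow> ('o, 'a) category \<Rightarrow> 'i set \<Rightarrow> ('i \<Rightarrow> 'o) \<Rightarrow> 'o \<Rightarrow> ('i \<Rightarrow> 'a) \<Rightarrow> bool" where
  "is_cover TYPE('u) E I U \<Sigma>U inU \<longleftrightarrow>
     small TYPE('u) I \<and> (\<forall>i\<in>I. nonempty_ob E (U i)) \<and> is_coproduct E I U \<Sigma>U inU \<and>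
     (\<exists>T f. is_terminal E T \<and> f \<in> hom E \<Sigma>U T \<and> epimorphic E T {f})"

text \<open>\<open>sface H n i : H\<^sub>n \<rightarrow> H\<^sub>n\<^sub>-\<^sub>1\<close> for \<open>i \<le> n\<close>, \<open>n \<ge> 1\<close>, and
  \<open>sdegen H n j : H\<^sub>n \<rightarrow> H\<^sub>n\<^sub>+\<^sub>1\<close> for \<open>j \<le> n\<close>.\<close>

record ('o, 'a) simplicial =
  sob :: "nat \<Rightarrow> 'o"
  sface :: "nat \<Rightarrow> nat \<Rightarrow> 'a"
  sdegen :: "nat \<Rightarrow> nat \<Rightarrow> 'a"

text \<open>The Cech object, with \<open>pr n a : U\<^sup>n\<^sup>+\<^sup>1 \<rightarrow> U\<close> the \<open>a\<close>-th projection.\<close>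

definition is_cech ::
  "('o, 'a) category \<Rightarrow> 'o \<Rightarrow> ('o, 'a) simplicial \<Rightarrow> (nat \<Rightarrow> nat \<Rightarrow> 'a) \<Rightarrow> bool" where
  "is_cech E \<Sigma>U K pr \<longleftrightarrow>
     (\<forall>n. is_limit E {..n} (\<lambda>_. \<Sigma>U) {} (sob K n) (pr n)) \<and>
     (\<forall>n. \<forall>i\<le>Suc n. sface K (Suc n) i \<in> hom E (sob K (Suc n)) (sob K n) \<and>
        (\<forall>a\<le>n. pr n a \<cdot>\<^bsub>E\<^esub> sface K (Suc n) i = pr (Suc n) (if a < i then a else Suc a))) \<and>
     (\<forall>n. \<forall>j\<le>n. sdegen K n j \<in> hom E (sob K n) (sob K (Suc n)) \<and>
        (\<forall>a\<le>Suc n. pr (Suc n) a \<cdot>\<^bsub>E\<^esub> sdegen K n j = pr n (if a \<le> j then a else a - 1)))"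

text \<open>The object \<open>(cosk\<^sub>k\<^sub>-\<^sub>1 H)\<^sub>k\<close>, for \<open>k \<ge> 1\<close>, is the limit of the proper faces of the
  \<open>k\<close>-simplex: it consists of \<open>(x\<^sub>0, \<dots>, x\<^sub>k)\<close> in \<open>H\<^sub>k\<^sub>-\<^sub>1\<close> with
  \<open>d\<^sub>i x\<^sub>j = d\<^sub>j\<^sub>-\<^sub>1 x\<^sub>i\<close> for \<open>i < j\<close>.  For \<open>k = 1\<close> there is no condition.\<close>

definition cosk_rel :: "('o, 'a) simplicial \<Rightarrow> nat \<Rightarrow> (nat \<times> 'a \<times> nat \<times> 'a) set" where
  "cosk_rel H k = {(j, sface H (k - 1) i, i, sface H (k - 1) (j - 1)) | i j. 2 \<le> k \<and> i < j \<and> j \<le> k}"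

definition cosk_epi :: "('o, 'a) category \<Rightarrow> ('o, 'a) simplicial \<Rightarrow> nat \<Rightarrow> bool" where
  "cosk_epi E H k \<longleftrightarrow>
     (\<exists>K p \<kappa>. is_limit E {..k} (\<lambda>_. sob H (k - 1)) (cosk_rel H k) K p \<and>
        \<kappa> \<in> hom E (sob H k) K \<and> (\<forall>i\<le>k. p i \<cdot>\<^bsub>E\<^esub> \<kappa> = sface H k i) \<and>
        epimorphic E K {\<kappa>})"

definition is_hypercover :: "('o, 'a) category \<Rightarrow> ('o, 'a) simplicial \<Rightarrow> bool" where
  "is_hypercover E H \<longleftrightarrow> (\<forall>k\<ge>1. cosk_epi E H k)"


section \<open>Spans\<close>

text \<open>An \<open>n\<close>-span is its top vertex together with the list, for \<open>i = 0, \<dots>, n\<close>, of the arrow to the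
  top vertex of the \<open>i\<close>-th face and that face, an \<open>(n - 1)\<close>-span.  A \<open>0\<close>-span is an index.\<close>

datatype ('i, 'o, 'a) span =
    Vertex (base: 'i)
  | Span (apex: 'o) (sides: "('a \<times> ('i, 'o, 'a) span) list")

definition face :: "nat \<Rightarrow> ('i, 'o, 'a) span \<Rightarrow> ('i, 'o, 'a) span" where
  "face i w = snd (sides w ! i)"

definition face_arr :: "nat \<Rightarrow> ('i, 'o, 'a) span \<Rightarrow> 'a" where
  "face_arr i w = fst (sides w ! i)"

fun top_vertex :: "('i \<Rightarrow> 'o) \<Rightarrow> ('i, 'o, 'a) span \<Rightarrow> 'o" where
  "top_vertex U (Vertex i) = U i"
| "top_vertex U (Span V fs) = V"

text \<open>\<open>span1 i u V v j\<close> is \<open>U\<^sub>i \<leftarrow>u\<midarrow> V \<midarrow>v\<rightarrow> U\<^sub>j\<close>; its face \<open>\<partial>\<^sub>0\<close> is \<open>j\<close>.\<close>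

definition span1 :: "'i \<Rightarrow> 'a \<Rightarrow> 'o \<Rightarrow> 'a \<Rightarrow> 'i \<Rightarrow> ('i, 'o, 'a) span" where
  "span1 i u V v j = Span V [(v, Vertex j), (u, Vertex i)]"

definition all_span1 :: "('o, 'a) category \<Rightarrow> 'i set \<Rightarrow> ('i \<Rightarrow> 'o) \<Rightarrow> ('i, 'o, 'a) span set" where
  "all_span1 E I U =
     {span1 i u V v j | i u V v j. i \<in> I \<and> j \<in> I \<and> V \<in> Ob E \<and> u \<in> hom E V (U i) \<and> v \<in> hom E V (U j)}"

text \<open>The boundary of a \<open>k\<close>-span: \<open>k + 1\<close> matching \<open>(k - 1)\<close>-spans.  A \<open>k\<close>-span is then a cone over
  the diagram of its boundary, and the components of \<open>(cosk\<^sub>k\<^sub>-\<^sub>1 H)\<^sub>k\<close> are the limits of these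
  diagrams.\<close>

definition is_boundary :: "('i, 'o, 'a) span set \<Rightarrow> nat \<Rightarrow> ('i, 'o, 'a) span list \<Rightarrow> bool" where
  "is_boundary S k ws \<longleftrightarrow> length ws = k + 1 \<and> set ws \<subseteq> S \<and>
     (2 \<le> k \<longrightarrow> (\<forall>j\<le>k. \<forall>i<j. face i (ws ! j) = face (j - 1) (ws ! i)))"

definition boundary_rel :: "nat \<Rightarrow> ('i, 'o, 'a) span list \<Rightarrow> (nat \<times> 'a \<times> nat \<times> 'a) set" where
  "boundary_rel k ws =
     {(j, face_arr i (ws ! j), i, face_arr (j - 1) (ws ! i)) | i j. 2 \<le> k \<and> i < j \<and> j \<le> k}"

text \<open>The sets \<open>S\<^sub>n\<close>, for a given set \<open>S\<^sub>1\<close> of \<open>1\<close>-spans and a given set \<open>C\<close> of vertices.\<close>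

fun spans :: "('o, 'a) category \<Rightarrow> 'i set \<Rightarrow> ('i \<Rightarrow> 'o) \<Rightarrow> 'o set \<Rightarrow> ('i, 'o, 'a) span set \<Rightarrow>
    nat \<Rightarrow> ('i, 'o, 'a) span set" where
  "spans E I U C S1 0 = Vertex ` I"
| "spans E I U C S1 (Suc 0) = S1"
| "spans E I U C S1 (Suc (Suc n)) =
     {Span W fs | W fs. W \<in> C \<and>
        is_boundary (spans E I U C S1 (Suc n)) (n + 2) (map snd fs) \<and>
        is_cone E {..n + 2} (\<lambda>a. top_vertex U (snd (fs ! a))) (boundary_rel (n + 2) (map snd fs))
          W (\<lambda>a. fst (fs ! a))}"

text \<open>\<open>vertex_ix n a w\<close> is the index of the \<open>a\<close>-th bottom vertex of an \<open>n\<close>-span \<open>w\<close> and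
  \<open>vertex_arr E U n a w\<close> the composite from its top vertex down to that vertex.\<close>

primrec vertex_ix :: "nat \<Rightarrow> nat \<Rightarrow> ('i, 'o, 'a) span \<Rightarrow> 'i" where
  "vertex_ix 0 a w = base w"
| "vertex_ix (Suc n) a w =
     (if a \<le> n then vertex_ix n a (face (Suc n) w) else vertex_ix n n (face 0 w))"

primrec vertex_arr ::
  "('o, 'a) category \<Rightarrow> ('i \<Rightarrow> 'o) \<Rightarrow> nat \<Rightarrow> nat \<Rightarrow> ('i, 'o, 'a) span \<Rightarrow> 'a" where
  "vertex_arr E U 0 a w = Id E (U (base w))"
| "vertex_arr E U (Suc n) a w =
     (if a \<le> n then vertex_arr E U n a (face (Suc n) w) \<cdot>\<^bsub>E\<^esub> face_arr (Suc n) w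
      else vertex_arr E U n n (face 0 w) \<cdot>\<^bsub>E\<^esub> face_arr 0 w)"

text \<open>The degenerate span in which the top vertex of a face \<open>T\<close> is that of the image of \<open>T\<close> under
  the \<open>j\<close>-th codegeneracy; its faces are given by the simplicial identities.\<close>

primrec std_degen :: "('o, 'a) category \<Rightarrow> ('i \<Rightarrow> 'o) \<Rightarrow> nat \<Rightarrow> nat \<Rightarrow>
    ('i, 'o, 'a) span \<Rightarrow> ('i, 'o, 'a) span" where
  "std_degen E U 0 j w = span1 (base w) (Id E (U (base w))) (U (base w)) (Id E (U (base w))) (base w)"
| "std_degen E U (Suc n) j w = Span (apex w)
     (map (\<lambda>i. if i < j then (face_arr i w, std_degen E U n (j - 1) (face i w))
               else if i \<le> Suc j then (Id E (apex w), w)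
               else (face_arr (i - 1) w, std_degen E U n j (face (i - 1) w)))
        [0..<n + 3])"

text \<open>The degeneracies \<open>\<sigma>\<^sub>j\<close> of an \<open>n\<close>-span.  For a \<open>1\<close>-span \<open>l\<close> with legs \<open>u\<close>, \<open>v\<close> they are the
  \<open>2\<close>-spans all of whose vertices above the bottom level are the vertex of \<open>l\<close>; so \<open>\<partial>\<^sub>2 \<sigma>\<^sub>0 l\<close> has
  legs \<open>u\<close>, \<open>u\<close> and is not the identity span \<open>\<sigma>\<^sub>0 \<partial>\<^sub>1 l\<close>.  Only face maps enter into
  \<^const>\<open>is_hypercover\<close>.\<close>

definition span_degen :: "('o, 'a) category \<Rightarrow> ('i \<Rightarrow> 'o) \<Rightarrow> nat \<Rightarrow> nat \<Rightarrow>
    ('i, 'o, 'a) span \<Rightarrow> ('i, 'o, 'a) span" where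
  "span_degen E U n j w =
     (if n = 1 then
        let V = apex w; u = face_arr 1 w; v = face_arr 0 w; i = base (face 1 w); k = base (face 0 w)
        in if j = 0 then Span V [(Id E V, w), (Id E V, w), (Id E V, span1 i u V u i)]
           else Span V [(Id E V, span1 k v V v k), (Id E V, w), (Id E V, w)]
      else std_degen E U n j w)"


section \<open>Span refinements\<close>

text \<open>\<open>C\<close> and \<open>Sp\<close> contain whole isomorphism classes and are therefore not required to be small in
  the sense of \<^const>\<open>small\<close>; what their size must allow is the coproducts \<open>H\<^sub>n\<close>, which are part of
  the data in \<open>is_span_refinement\<close> below.\<close>

definition zero_span_set :: "('o, 'a) category \<Rightarrow> 'i set \<Rightarrow> ('i \<Rightarrow> 'o) \<Rightarrow> 'o set \<Rightarrow> bool" where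
  "zero_span_set E I U C \<longleftrightarrow>
     (\<forall>V\<in>C. nonempty_ob E V) \<and>
     (\<forall>V\<in>C. \<forall>V' f. is_iso E V' V f \<longrightarrow> V' \<in> C) \<and>
     (\<forall>i\<in>I. U i \<in> C)"

definition zero_span1 ::
  "('o, 'a) category \<Rightarrow> 'i set \<Rightarrow> ('i \<Rightarrow> 'o) \<Rightarrow> 'o set \<Rightarrow> ('i, 'o, 'a) span set" where
  "zero_span1 E I U C = {l \<in> all_span1 E I U. apex l \<in> C}"

definition one_span_set ::
  "('o, 'a) category \<Rightarrow> 'i set \<Rightarrow> ('i \<Rightarrow> 'o) \<Rightarrow> ('i, 'o, 'a) span set \<Rightarrow> bool" where
  "one_span_set E I U Sp \<longleftrightarrow>
     Sp \<subseteq> all_span1 E I U \<and>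
     (\<forall>l\<in>Sp. nonempty_ob E (apex l)) \<and>
     (\<forall>i u V v j V' f. span1 i u V v j \<in> Sp \<longrightarrow> is_iso E V' V f \<longrightarrow>
        span1 i (u \<cdot>\<^bsub>E\<^esub> f) V' (v \<cdot>\<^bsub>E\<^esub> f) j \<in> Sp) \<and>
     (\<forall>i u V v j. span1 i u V v j \<in> Sp \<longrightarrow> span1 j v V u i \<in> Sp) \<and>
     (\<forall>i\<in>I. span1 i (Id E (U i)) (U i) (Id E (U i)) i \<in> Sp) \<and>
     (\<forall>i u V v j. span1 i u V v j \<in> Sp \<longrightarrow> span1 i u V u i \<in> Sp \<and> span1 j v V v j \<in> Sp)"

text \<open>\<open>P\<^sub>i\<^sub>j = U\<^sub>i \<times> U\<^sub>j\<close>, with projections \<open>p 0\<close> and \<open>p 1\<close>.\<close>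

definition is_P2 :: "('o, 'a) category \<Rightarrow> ('i \<Rightarrow> 'o) \<Rightarrow> 'i \<Rightarrow> 'i \<Rightarrow> 'o \<Rightarrow> (nat \<Rightarrow> 'a) \<Rightarrow> bool" where
  "is_P2 E U i j P p \<longleftrightarrow> is_limit E {..<2} (\<lambda>a. [U i, U j] ! a) {} P p"

text \<open>\<open>P\<^sub>l\<^sub>t\<^sub>r\<close>, with projections \<open>p 0\<close>, \<open>p 1\<close>, \<open>p 2\<close> to the vertices of \<open>l\<close>, \<open>t\<close>, \<open>r\<close>.\<close>

definition is_P3 :: "('o, 'a) category \<Rightarrow> ('i, 'o, 'a) span \<Rightarrow> ('i, 'o, 'a) span \<Rightarrow>
    ('i, 'o, 'a) span \<Rightarrow> 'o \<Rightarrow> (nat \<Rightarrow> 'a) \<Rightarrow> bool" where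
  "is_P3 E l t r P p \<longleftrightarrow>
     is_limit E {..<3} (\<lambda>a. [apex l, apex t, apex r] ! a)
       {(0, face_arr 1 l, 1, face_arr 1 t), (0, face_arr 0 l, 2, face_arr 1 r),
        (1, face_arr 0 t, 2, face_arr 0 r)} P p"

definition maps_cover_P2 ::
  "('o, 'a) category \<Rightarrow> 'i set \<Rightarrow> ('i \<Rightarrow> 'o) \<Rightarrow> 'o set \<Rightarrow> bool" where
  "maps_cover_P2 E I U C \<longleftrightarrow>
     (\<forall>i\<in>I. \<forall>j\<in>I. \<forall>P p. is_P2 E U i j P p \<longrightarrow> nonempty_ob E P \<longrightarrow>
        epimorphic E P (maps_into E C P))"

definition spans_cover_P2 ::
  "('o, 'a) category \<Rightarrow> 'i set \<Rightarrow> ('i \<Rightarrow> 'o) \<Rightarrow> ('i, 'o, 'a) span set \<Rightarrow> bool" where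
  "spans_cover_P2 E I U Sp \<longleftrightarrow>
     (\<forall>i\<in>I. \<forall>j\<in>I. \<forall>P p. is_P2 E U i j P p \<longrightarrow> nonempty_ob E P \<longrightarrow>
        epimorphic E P {f. \<exists>V. f \<in> hom E V P \<and> span1 i (p 0 \<cdot>\<^bsub>E\<^esub> f) V (p 1 \<cdot>\<^bsub>E\<^esub> f) j \<in> Sp})"

definition maps_cover_P3 ::
  "('o, 'a) category \<Rightarrow> 'o set \<Rightarrow> ('i, 'o, 'a) span set \<Rightarrow> bool" where
  "maps_cover_P3 E C S1 \<longleftrightarrow>
     (\<forall>l\<in>S1. \<forall>t\<in>S1. \<forall>r\<in>S1.
        face 1 t = face 1 l \<longrightarrow> face 0 l = face 1 r \<longrightarrow> face 0 t = face 0 r \<longrightarrow>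
        (\<forall>P p. is_P3 E l t r P p \<longrightarrow> nonempty_ob E P \<longrightarrow> epimorphic E P (maps_into E C P)))"

text \<open>The same condition for the non-empty components of \<open>(cosk\<^sub>k\<^sub>-\<^sub>1 H)\<^sub>k\<close>.  For \<open>k \<ge> 3\<close> it does
  not follow from the previous ones, and degree \<open>k\<close> of the hypercover condition fails without it:
  in Set \<open>\<times>\<close> Set take the cover \<open>{1}\<close> of \<open>1\<close>, let \<open>A = (2, 2)\<close> and let \<open>C\<close> consist of the objects
  isomorphic to \<open>1\<close> or \<open>A\<close>.  For \<open>f = (0, 0)\<close> and \<open>g = (0, 1)\<close>, constant maps from \<open>A\<close> to \<open>A\<close> in each
  coordinate, \<open>A \<times>\<^sub>A A = (2 \<times> 2, \<emptyset>)\<close> is a component of \<open>(cosk\<^sub>2 H)\<^sub>3\<close> which no object in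
  \<open>C\<close> maps to.\<close>

definition maps_cover_boundaries :: "('o, 'a) category \<Rightarrow> ('i \<Rightarrow> 'o) \<Rightarrow> 'o set \<Rightarrow>
    (nat \<Rightarrow> ('i, 'o, 'a) span set) \<Rightarrow> nat \<Rightarrow> bool" where
  "maps_cover_boundaries E U C S k \<longleftrightarrow>
     (\<forall>ws P p. is_boundary (S (k - 1)) k ws \<longrightarrow>
        is_limit E {..k} (\<lambda>a. top_vertex U (ws ! a)) (boundary_rel k ws) P p \<longrightarrow>
        nonempty_ob E P \<longrightarrow> epimorphic E P (maps_into E C P))"

text \<open>\<open>H\<close> is the coproduct of the top vertices, with injections \<open>inH\<close>; its faces and degeneracies
  are those of spans, and \<open>h n : H\<^sub>n \<rightarrow> U\<^sup>n\<^sup>+\<^sup>1\<close> is induced by the maps to the bottom vertices.\<close>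

definition is_span_refinement :: "('o, 'a) category \<Rightarrow> ('i \<Rightarrow> 'o) \<Rightarrow> ('i \<Rightarrow> 'a) \<Rightarrow>
    (nat \<Rightarrow> ('i, 'o, 'a) span set) \<Rightarrow> ('o, 'a) simplicial \<Rightarrow> (nat \<Rightarrow> nat \<Rightarrow> 'a) \<Rightarrow>
    ('o, 'a) simplicial \<Rightarrow> (nat \<Rightarrow> ('i, 'o, 'a) span \<Rightarrow> 'a) \<Rightarrow> (nat \<Rightarrow> 'a) \<Rightarrow> bool" where
  "is_span_refinement E U inU S K pr H inH h \<longleftrightarrow>
     (\<forall>n. is_coproduct E (S n) (top_vertex U) (sob H n) (inH n)) \<and>
     (\<forall>n. \<forall>i\<le>Suc n. sface H (Suc n) i \<in> hom E (sob H (Suc n)) (sob H n) \<and>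
        (\<forall>w\<in>S (Suc n). sface H (Suc n) i \<cdot>\<^bsub>E\<^esub> inH (Suc n) w = inH n (face i w) \<cdot>\<^bsub>E\<^esub> face_arr i w)) \<and>
     (\<forall>n. \<forall>j\<le>n. sdegen H n j \<in> hom E (sob H n) (sob H (Suc n)) \<and>
        (\<forall>w\<in>S n. sdegen H n j \<cdot>\<^bsub>E\<^esub> inH n w = inH (Suc n) (span_degen E U n j w))) \<and>
     (\<forall>n. h n \<in> hom E (sob H n) (sob K n) \<and>
        (\<forall>w\<in>S n. \<forall>a\<le>n. pr n a \<cdot>\<^bsub>E\<^esub> (h n \<cdot>\<^bsub>E\<^esub> inH n w) =
           inU (vertex_ix n a w) \<cdot>\<^bsub>E\<^esub> vertex_arr E U n a w))"

end

theory Submission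
  imports Defs
begin

text \<open>
  Let \<open>K = (cosk\<^sub>k\<^sub>-\<^sub>1 H)\<^sub>k\<close>.  Since \<open>H\<^sub>k\<^sub>-\<^sub>1\<close> is the coproduct of the top vertices of
  the \<open>(k - 1)\<close>-spans and coproducts in a topos are universal, \<open>K\<close> is covered by the maps
  \<open>q : P \<rightarrow> K\<close> all of whose \<open>k + 1\<close> components factor through injections, the \<open>j\<close>-th one through that
  of a span \<open>w\<^sub>j\<close>.  If \<open>P\<close> is not initial and \<open>k \<ge> 2\<close>, then the simplicial identities that hold on \<open>K\<close> and
  the disjointness of the coproduct \<open>H\<^sub>k\<^sub>-\<^sub>2\<close> force the spans \<open>w\<^sub>j\<close> to match along their faces, and since
  injections are monic, \<open>P\<close> maps to the limit \<open>L\<close> of the diagram formed by \<open>w\<^sub>0, \<dots>, w\<^sub>k\<close>.  A map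
  from an object of \<open>C\<close> to \<open>L\<close> is a \<open>k\<close>-span with boundary \<open>w\<^sub>0, \<dots>, w\<^sub>k\<close>, that is, a component of
  \<open>H\<^sub>k\<close>, except that for \<open>k = 1\<close> in the \<open>1\<close>-span construction only the maps that belong to \<open>S\<^sub>1\<close> are
  admitted; so if these maps cover every such \<open>L\<close> that is not initial, then \<open>H\<^sub>k\<close> covers \<open>K\<close>
  (\<open>cosk_epi_Suc\<close>).  For \<open>k = 1\<close> the limits \<open>L\<close> are the products \<open>P\<^sub>i\<^sub>j\<close>, for \<open>k = 2\<close> they are the
  objects \<open>P\<^sub>l\<^sub>t\<^sub>r\<close> (\<open>is_P2_boundary\<close>, \<open>is_P3_boundary\<close>).

  The facts on toposes that this needs are the existence of finite limits (\<open>ex_limit\<close>), disjointness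
  of coproducts with monic injections (\<open>coproduct_disjoint\<close>), and universality of coproducts, in the
  form that two maps out of \<open>Z\<close> agree if they agree on those parts of \<open>Z\<close> that a given map from \<open>Z\<close>
  to a coproduct sends into a single summand (\<open>coproduct_universal\<close>).  They are proved for sheaves on
  a small site and carried over along the equivalence.  Limits of sheaves are formed sectionwise.
  Disjointness follows from the existence, for every sheaf \<open>F\<close>, of a sheaf \<open>Q\<close> with a monomorphism
  \<open>F \<rightarrow> Q\<close> and a global point of \<open>Q\<close> disjoint from it: the power object of \<open>F\<close> with its singletons and
  its empty subobject (\<open>ex_embedding_with_point\<close>).  A coproduct with summand \<open>F\<close> maps to this \<open>Q\<close> by
  the monomorphism on \<open>F\<close> and by the point on all other summands.  Universality holds because the
  sections of the coproduct over which the two given maps agree form a subsheaf that contains all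
  summands, and such a subsheaf is everything.
\<close>

section \<open>Small sets\<close>

lemma small_iff_no_inj:
  "small TYPE('u) A \<longleftrightarrow> (\<nexists>f :: 'u \<Rightarrow> 'x. inj f \<and> range f \<subseteq> A)"
  unfolding small_def by (rule card_of_ordLess[symmetric])

text \<open>A type with \<open>n\<close> elements is not a universe: a subset with \<open>n - 1\<close> elements is small, but its
  power set has \<open>2\<^sup>n\<^sup>-\<^sup>1 \<ge> n\<close> elements.\<close>

lemma infinite_universe:
  assumes "universe TYPE('u)"
  shows "infinite (UNIV :: 'u set)"
proof
  assume fin: "finite (UNIV :: 'u set)"
  define A where "A = UNIV - {undefined :: 'u}"
  have "A \<subset> (UNIV :: 'u set)"
    by (auto simp: A_def)
  then have "small TYPE('u) A"
    unfolding small_iff_no_inj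
    using fin card_inj_on_le[of _ "UNIV :: 'u set" A] psubset_card_mono[OF fin]
    by (meson finite_subset leD top_greatest)
  then have "small TYPE('u) (Pow A)"
    using assms by (auto simp: universe_def)
  moreover have "card (UNIV :: 'u set) \<le> card (Pow A)"
  proof -
    have "card (UNIV :: 'u set) = Suc (card A)"
      using card.remove[OF fin UNIV_I] unfolding A_def .
    then show ?thesis
      using less_exp[of "card A"] finite_subset[OF subset_UNIV fin, of A] by (simp only: card_Pow Suc_le_eq)
  qed
  ultimately show False
    using card_le_inj[OF fin, of "Pow A"] fin unfolding small_iff_no_inj
    by (auto simp: A_def)
qed

lemma small_subset:
  assumes "small TYPE('u) A" and "B \<subseteq> A"
  shows "small TYPE('u) B"
  using assms unfolding small_def by (meson card_of_mono1 ordLeq_ordLess_trans)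

lemma small_image:
  assumes "small TYPE('u) A"
  shows "small TYPE('u) (f ` A)"
  using assms unfolding small_def by (meson card_of_image ordLeq_ordLess_trans)

lemma small_inj_image:
  assumes "small TYPE('u) (f ` A)" and "inj_on f A"
  shows "small TYPE('u) A"
proof -
  have "A = inv_into A f ` f ` A"
    using assms(2) by simp
  then show ?thesis
    using small_image[OF assms(1), of "inv_into A f"] by simp
qed

lemma small_ex_inj:
  assumes "small TYPE('u) A"
  shows "\<exists>e :: 'x \<Rightarrow> 'u. inj_on e A"
proof -
  have "|A| \<le>o |UNIV :: 'u set|"
    using assms unfolding small_def by (rule ordLess_imp_ordLeq)
  then show ?thesis
    by (auto simp: card_of_ordLeq[symmetric])
qed

lemma small_finite:
  assumes "universe TYPE('u)" and "finite A"
  shows "small TYPE('u) A"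
  unfolding small_iff_no_inj
  using infinite_universe[OF assms(1)] assms(2) by (meson finite_imageD finite_subset)

lemma small_Pow:
  fixes A :: "'x set"
  assumes "universe TYPE('u)" and "small TYPE('u) A"
  shows "small TYPE('u) (Pow A)"
proof -
  obtain e :: "'x \<Rightarrow> 'u" where e: "inj_on e A"
    using small_ex_inj[OF assms(2)] by blast
  have "small TYPE('u) (Pow (e ` A))"
    using assms(1) small_image[OF assms(2)] by (auto simp: universe_def)
  then have "small TYPE('u) ((`) e ` Pow A)"
    by (simp add: image_Pow_surj)
  then show ?thesis
    by (rule small_inj_image) (rule inj_on_image_Pow[OF e])
qed

text \<open>Unions in the definition of a universe are unions of subsets of the universe, whence the injection
  of pairs.\<close>

lemma small_Sigma:
  fixes A :: "'x set" and B :: "'x \<Rightarrow> 'y set"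
  assumes univ: "universe TYPE('u)" and A: "small TYPE('u) A"
    and B: "\<And>x. x \<in> A \<Longrightarrow> small TYPE('u) (B x)"
  shows "small TYPE('u) (Sigma A B)"
proof -
  have "|UNIV \<times> UNIV :: ('u \<times> 'u) set| \<le>o |UNIV :: 'u set|"
    using card_of_Times_same_infinite[OF infinite_universe[OF univ]] ordIso_iff_ordLeq by blast
  then obtain pair :: "'u \<times> 'u \<Rightarrow> 'u" where pair: "inj pair"
    by (auto simp: card_of_ordLeq[symmetric])
  obtain e :: "'x \<Rightarrow> 'u" where e: "inj_on e A"
    using small_ex_inj[OF A] by blast
  have "\<forall>x\<in>A. \<exists>k :: 'y \<Rightarrow> 'u. inj_on k (B x)"
    using small_ex_inj[OF B] by blast
  then obtain k :: "'x \<Rightarrow> 'y \<Rightarrow> 'u" where k: "\<And>x. x \<in> A \<Longrightarrow> inj_on (k x) (B x)"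
    by (auto dest!: bchoice)
  define m where "m = (\<lambda>(x, y). pair (e x, k x y))"
  have "inj_on m (Sigma A B)"
  proof (rule inj_onI, clarify)
    fix x y x' y'
    assume *: "x \<in> A" "y \<in> B x" "x' \<in> A" "y' \<in> B x'" "m (x, y) = m (x', y')"
    then have "e x = e x'" and eq: "k x y = k x' y'"
      using injD[OF pair, of "(e x, k x y)" "(e x', k x' y')"] by (simp_all add: m_def)
    then have "x = x'"
      using inj_onD[OF e _ *(1,3)] by simp
    then show "x = x' \<and> y = y'"
      using inj_onD[OF k[OF *(1)], of y y'] eq * by simp
  qed
  moreover have "small TYPE('u) (\<Union>a\<in>e ` A. m ` ({inv_into A e a} \<times> B (inv_into A e a)))"
  proof -
    have "small TYPE('u) (m ` ({x} \<times> B x))" if "x \<in> A" for x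
    proof -
      have "{x} \<times> B x = Pair x ` B x"
        by auto
      then show ?thesis
        using small_image[OF B[OF that], of "\<lambda>y. m (x, y)"] by (simp add: image_image)
    qed
    then show ?thesis
      by (intro univ[unfolded universe_def, THEN conjunct2, rule_format, OF small_image[OF A, of e]])
        (simp add: inv_into_into)
  qed
  moreover have "(\<Union>a\<in>e ` A. m ` ({inv_into A e a} \<times> B (inv_into A e a))) = m ` Sigma A B"
    using e by force
  ultimately show ?thesis
    using small_inj_image[of m "Sigma A B"] by simp
qed

lemma small_PiE:
  assumes univ: "universe TYPE('u)" and A: "small TYPE('u) A"
    and B: "\<And>x. x \<in> A \<Longrightarrow> small TYPE('u) (B x)"
  shows "small TYPE('u) (Pi\<^sub>E A B)"
proof -
  let ?graph = "\<lambda>f. {(x, f x) | x. x \<in> A}"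
  have "small TYPE('u) (?graph ` Pi\<^sub>E A B)"
    by (rule small_subset[OF small_Pow[OF univ small_Sigma[OF univ A B]]]) auto
  moreover have "inj_on ?graph (Pi\<^sub>E A B)"
    by (intro inj_onI PiE_ext) blast+
  ultimately show ?thesis
    by (rule small_inj_image)
qed

section \<open>Limits and coproducts in a category\<close>

text \<open>The data \<open>D\<close>, \<open>R\<close> from which a limit is formed, with domains and codomains that match.\<close>

definition is_diagram ::
  "('o, 'a) category \<Rightarrow> 'x set \<Rightarrow> ('x \<Rightarrow> 'o) \<Rightarrow> ('x \<times> 'a \<times> 'x \<times> 'a) set \<Rightarrow> bool" where
  "is_diagram E X D R \<longleftrightarrow>
     (\<forall>x\<in>X. D x \<in> Ob E) \<and>
     (\<forall>(x, a, y, b)\<in>R. x \<in> X \<and> y \<in> X \<and> (\<exists>B. a \<in> hom E (D x) B \<and> b \<in> hom E (D y) B))"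

lemma is_diagramD:
  assumes "is_diagram E X D R" and "(x, a, y, b) \<in> R"
  obtains B where "x \<in> X" and "y \<in> X" and "a \<in> hom E (D x) B" and "b \<in> hom E (D y) B"
  using bspec[OF conjunct2[OF assms(1)[unfolded is_diagram_def]] assms(2)] by auto

lemma is_coneI:
  assumes "P \<in> Ob E" and "\<And>x. x \<in> X \<Longrightarrow> p x \<in> hom E P (D x)"
    and "\<And>x a y b. (x, a, y, b) \<in> R \<Longrightarrow> a \<cdot>\<^bsub>E\<^esub> p x = b \<cdot>\<^bsub>E\<^esub> p y"
  shows "is_cone E X D R P p"
  using assms by (auto simp: is_cone_def)

lemma is_coneD:
  assumes "is_cone E X D R P p"
  shows "P \<in> Ob E" and "x \<in> X \<Longrightarrow> p x \<in> hom E P (D x)"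
    and "(x, a, y, b) \<in> R \<Longrightarrow> a \<cdot>\<^bsub>E\<^esub> p x = b \<cdot>\<^bsub>E\<^esub> p y"
  using assms by (auto simp: is_cone_def)

lemma limit_cone: "is_limit E X D R P p \<Longrightarrow> is_cone E X D R P p"
  by (simp add: is_limit_def)

text \<open>The axioms of a category, as a context for the lemmas on composition, limits and coproducts.\<close>

locale cat =
  fixes E :: "('o, 'a) category"
  assumes category: "is_category E"
begin

lemma hom_Ob:
  assumes "f \<in> hom E A B"
  shows "A \<in> Ob E" and "B \<in> Ob E"
  using assms category by (auto simp: hom_def is_category_def)

lemma Id_hom: "A \<in> Ob E \<Longrightarrow> Id E A \<in> hom E A A"
  using category unfolding is_category_def by blast

lemma comp_hom: "g \<in> hom E B C \<Longrightarrow> f \<in> hom E A B \<Longrightarrow> g \<cdot>\<^bsub>E\<^esub> f \<in> hom E A C"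
  using category unfolding is_category_def by blast

lemma comp_Id: "f \<in> hom E A B \<Longrightarrow> f \<cdot>\<^bsub>E\<^esub> Id E A = f"
  using category unfolding is_category_def by blast

lemma Id_comp: "f \<in> hom E A B \<Longrightarrow> Id E B \<cdot>\<^bsub>E\<^esub> f = f"
  using category unfolding is_category_def by blast

lemma comp_assoc:
  "k \<in> hom E C D \<Longrightarrow> g \<in> hom E B C \<Longrightarrow> f \<in> hom E A B \<Longrightarrow>
     (k \<cdot>\<^bsub>E\<^esub> g) \<cdot>\<^bsub>E\<^esub> f = k \<cdot>\<^bsub>E\<^esub> (g \<cdot>\<^bsub>E\<^esub> f)"
  by (rule category[unfolded is_category_def, THEN conjunct2, THEN conjunct2, THEN conjunct2,
        THEN conjunct2, rule_format, symmetric])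

lemma cone_comp:
  assumes diag: "is_diagram E X D R" and cone: "is_cone E X D R P p" and f: "f \<in> hom E Q P"
  shows "is_cone E X D R Q (\<lambda>x. p x \<cdot>\<^bsub>E\<^esub> f)"
proof (rule is_coneI)
  fix x a y b assume R: "(x, a, y, b) \<in> R"
  then obtain B where B: "x \<in> X" "y \<in> X" "a \<in> hom E (D x) B" "b \<in> hom E (D y) B"
    using is_diagramD[OF diag] by blast
  show "a \<cdot>\<^bsub>E\<^esub> (p x \<cdot>\<^bsub>E\<^esub> f) = b \<cdot>\<^bsub>E\<^esub> (p y \<cdot>\<^bsub>E\<^esub> f)"
    using comp_assoc[OF B(3) is_coneD(2)[OF cone B(1)] f]
      comp_assoc[OF B(4) is_coneD(2)[OF cone B(2)] f] is_coneD(3)[OF cone R] by simp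
qed (use hom_Ob(1)[OF f] comp_hom[OF is_coneD(2)[OF cone] f] in auto)

lemma limit_eqI:
  assumes diag: "is_diagram E X D R" and lim: "is_limit E X D R P p"
    and f: "f \<in> hom E Q P" and g: "g \<in> hom E Q P"
    and eq: "\<And>x. x \<in> X \<Longrightarrow> p x \<cdot>\<^bsub>E\<^esub> f = p x \<cdot>\<^bsub>E\<^esub> g"
  shows "f = g"
proof -
  have "is_cone E X D R Q (\<lambda>x. p x \<cdot>\<^bsub>E\<^esub> f)"
    by (rule cone_comp[OF diag limit_cone[OF lim] f])
  then have "\<exists>!k. k \<in> hom E Q P \<and> (\<forall>x\<in>X. p x \<cdot>\<^bsub>E\<^esub> k = p x \<cdot>\<^bsub>E\<^esub> f)"
    using lim unfolding is_limit_def by blast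
  then show ?thesis
    using f g eq by metis
qed

lemma limit_hom: "is_limit E X D R P p \<Longrightarrow> x \<in> X \<Longrightarrow> p x \<in> hom E P (D x)"
  by (rule is_coneD(2)[OF limit_cone])

lemma limit_lift:
  assumes "is_limit E X D R P p" and "is_cone E X D R Q q"
  obtains f where "f \<in> hom E Q P" and "\<And>x. x \<in> X \<Longrightarrow> p x \<cdot>\<^bsub>E\<^esub> f = q x"
  using assms unfolding is_limit_def by blast

lemma coproduct_hom: "is_coproduct E X D S inc \<Longrightarrow> x \<in> X \<Longrightarrow> inc x \<in> hom E (D x) S"
  unfolding is_coproduct_def by blast

lemma coproduct_ex1:
  assumes "is_coproduct E X D S inc" and "Q \<in> Ob E" and "\<And>x. x \<in> X \<Longrightarrow> q x \<in> hom E (D x) Q"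
  shows "\<exists>!f. f \<in> hom E S Q \<and> (\<forall>x\<in>X. f \<cdot>\<^bsub>E\<^esub> inc x = q x)"
  using assms unfolding is_coproduct_def by blast

lemma coproduct_lift:
  assumes "is_coproduct E X D S inc" and "Q \<in> Ob E" and "\<And>x. x \<in> X \<Longrightarrow> q x \<in> hom E (D x) Q"
  obtains f where "f \<in> hom E S Q" and "\<And>x. x \<in> X \<Longrightarrow> f \<cdot>\<^bsub>E\<^esub> inc x = q x"
  using coproduct_ex1[OF assms] by blast

lemma coproduct_eqI:
  assumes cop: "is_coproduct E X D S inc" and f: "f \<in> hom E S Q" and g: "g \<in> hom E S Q"
    and eq: "\<And>x. x \<in> X \<Longrightarrow> f \<cdot>\<^bsub>E\<^esub> inc x = g \<cdot>\<^bsub>E\<^esub> inc x"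
  shows "f = g"
proof -
  have "\<exists>!k. k \<in> hom E S Q \<and> (\<forall>x\<in>X. k \<cdot>\<^bsub>E\<^esub> inc x = f \<cdot>\<^bsub>E\<^esub> inc x)"
    by (rule coproduct_ex1[OF cop hom_Ob(2)[OF f] comp_hom[OF f coproduct_hom[OF cop]]])
  then show ?thesis
    using f g eq by (auto elim!: ex1E)
qed

end


section \<open>Sheaves on a small site\<close>

text \<open>A small site with its objects and arrows in the universe.\<close>

locale site = D: cat D for D :: "('u, 'u) category" +
  fixes J :: "'u \<Rightarrow> 'u set set"
  assumes univ: "universe TYPE('u)"
    and small_Ob: "small TYPE('u) (Ob D)" and small_Ar: "small TYPE('u) (Ar D)"
    and topology: "is_topology D J"
begin

lemma Ar_Ob: "f \<in> Ar D \<Longrightarrow> Dom D f \<in> Ob D" "f \<in> Ar D \<Longrightarrow> Cod D f \<in> Ob D"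
  using D.category unfolding is_category_def by blast+

lemma comp_Ar:
  assumes "f \<in> Ar D" and "g \<in> Ar D" and "Cod D g = Dom D f"
  shows "f \<cdot>\<^bsub>D\<^esub> g \<in> Ar D" and "Dom D (f \<cdot>\<^bsub>D\<^esub> g) = Dom D g" and "Cod D (f \<cdot>\<^bsub>D\<^esub> g) = Cod D f"
proof -
  have "f \<cdot>\<^bsub>D\<^esub> g \<in> hom D (Dom D g) (Cod D f)"
    using assms by (intro D.comp_hom) (auto simp: hom_def)
  then show "f \<cdot>\<^bsub>D\<^esub> g \<in> Ar D" and "Dom D (f \<cdot>\<^bsub>D\<^esub> g) = Dom D g" and "Cod D (f \<cdot>\<^bsub>D\<^esub> g) = Cod D f"
    by (auto simp: hom_def)
qed

lemma assoc_Ar: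
  assumes "f \<in> Ar D" and "g \<in> Ar D" and "k \<in> Ar D" and "Cod D g = Dom D f" and "Cod D k = Dom D g"
  shows "(f \<cdot>\<^bsub>D\<^esub> g) \<cdot>\<^bsub>D\<^esub> k = f \<cdot>\<^bsub>D\<^esub> (g \<cdot>\<^bsub>D\<^esub> k)"
  using assms by (intro D.comp_assoc) (auto simp: hom_def)

lemma Id_Ar:
  assumes "c \<in> Ob D"
  shows "Id D c \<in> Ar D" and "Dom D (Id D c) = c" and "Cod D (Id D c) = c"
  using D.Id_hom[OF assms] by (auto simp: hom_def)

lemma Id_comp_Ar: "f \<in> Ar D \<Longrightarrow> Id D (Cod D f) \<cdot>\<^bsub>D\<^esub> f = f"
  by (rule D.Id_comp) (auto simp: hom_def)

lemma comp_Id_Ar: "f \<in> Ar D \<Longrightarrow> f \<cdot>\<^bsub>D\<^esub> Id D (Dom D f) = f"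
  by (rule D.comp_Id) (auto simp: hom_def)

lemmas Ar_simps [simp] = Ar_Ob comp_Ar assoc_Ar Id_Ar Id_comp_Ar comp_Id_Ar

lemma cover_sieve: "c \<in> Ob D \<Longrightarrow> T \<in> J c \<Longrightarrow> is_sieve D c T"
  using topology unfolding is_topology_def by blast

lemma coverD:
  assumes "c \<in> Ob D" and "T \<in> J c" and "f \<in> T"
  shows "f \<in> Ar D" and "Cod D f = c"
    and "g \<in> Ar D \<Longrightarrow> Cod D g = Dom D f \<Longrightarrow> f \<cdot>\<^bsub>D\<^esub> g \<in> T"
  using cover_sieve[OF assms(1,2)] assms(3) unfolding is_sieve_def by auto

lemma cover_max: "c \<in> Ob D \<Longrightarrow> {f \<in> Ar D. Cod D f = c} \<in> J c"
  using topology unfolding is_topology_def by blast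

lemma cover_pull: "f \<in> Ar D \<Longrightarrow> T \<in> J (Cod D f) \<Longrightarrow> pull_sieve D f T \<in> J (Dom D f)"
  using topology unfolding is_topology_def by blast

lemma cover_local:
  "c \<in> Ob D \<Longrightarrow> T \<in> J c \<Longrightarrow> is_sieve D c R \<Longrightarrow>
     (\<And>f. f \<in> T \<Longrightarrow> pull_sieve D f R \<in> J (Dom D f)) \<Longrightarrow> R \<in> J c"
  using topology unfolding is_topology_def by blast

text \<open>The conditions for a sheaf, for sections in an arbitrary type; such a sheaf with small sets of
  sections is isomorphic to one with sections in the universe.\<close>

definition sheaf_on :: "('u \<Rightarrow> 'x set) \<Rightarrow> ('u \<Rightarrow> 'x \<Rightarrow> 'x) \<Rightarrow> bool" where
  "sheaf_on A r \<longleftrightarrow>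
     (\<forall>f\<in>Ar D. \<forall>x\<in>A (Cod D f). r f x \<in> A (Dom D f)) \<and>
     (\<forall>c\<in>Ob D. \<forall>x\<in>A c. r (Id D c) x = x) \<and>
     (\<forall>f\<in>Ar D. \<forall>g\<in>Ar D. Cod D f = Dom D g \<longrightarrow>
        (\<forall>x\<in>A (Cod D g). r (g \<cdot>\<^bsub>D\<^esub> f) x = r f (r g x))) \<and>
     (\<forall>c\<in>Ob D. \<forall>T\<in>J c. \<forall>x.
        (\<forall>f\<in>T. x f \<in> A (Dom D f)) \<longrightarrow>
        (\<forall>f\<in>T. \<forall>g\<in>Ar D. Cod D g = Dom D f \<longrightarrow> x (f \<cdot>\<^bsub>D\<^esub> g) = r g (x f)) \<longrightarrow>
        (\<exists>!y. y \<in> A c \<and> (\<forall>f\<in>T. r f y = x f)))"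

lemma is_sheaf_iff:
  "is_sheaf D J F \<longleftrightarrow> (\<forall>c\<in>Ob D. small TYPE('u) (sec F c)) \<and> sheaf_on (sec F) (res F)"
  unfolding is_sheaf_def is_presheaf_def sheaf_on_def hom_def Pi_iff by auto

lemma sheaf_onD:
  assumes "sheaf_on A r"
  shows "f \<in> Ar D \<Longrightarrow> x \<in> A (Cod D f) \<Longrightarrow> r f x \<in> A (Dom D f)"
    and "c \<in> Ob D \<Longrightarrow> x \<in> A c \<Longrightarrow> r (Id D c) x = x"
    and "f \<in> Ar D \<Longrightarrow> g \<in> Ar D \<Longrightarrow> Cod D f = Dom D g \<Longrightarrow> x \<in> A (Cod D g) \<Longrightarrow>
           r (g \<cdot>\<^bsub>D\<^esub> f) x = r f (r g x)"
  using assms[unfolded sheaf_on_def, THEN conjunct1]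
    assms[unfolded sheaf_on_def, THEN conjunct2, THEN conjunct1]
    assms[unfolded sheaf_on_def, THEN conjunct2, THEN conjunct2, THEN conjunct1]
  by simp_all

lemma sheaf_on_ex1:
  assumes "sheaf_on A r" and "c \<in> Ob D" and "T \<in> J c" and "\<And>f. f \<in> T \<Longrightarrow> x f \<in> A (Dom D f)"
    and "\<And>f g. f \<in> T \<Longrightarrow> g \<in> Ar D \<Longrightarrow> Cod D g = Dom D f \<Longrightarrow> x (f \<cdot>\<^bsub>D\<^esub> g) = r g (x f)"
  shows "\<exists>!y. y \<in> A c \<and> (\<forall>f\<in>T. r f y = x f)"
  by (rule assms(1)[unfolded sheaf_on_def, THEN conjunct2, THEN conjunct2, THEN conjunct2,
        rule_format, OF assms(2-5)])

lemma sheaf_on_glue: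
  assumes "sheaf_on A r" and "c \<in> Ob D" and "T \<in> J c" and "\<And>f. f \<in> T \<Longrightarrow> x f \<in> A (Dom D f)"
    and "\<And>f g. f \<in> T \<Longrightarrow> g \<in> Ar D \<Longrightarrow> Cod D g = Dom D f \<Longrightarrow> x (f \<cdot>\<^bsub>D\<^esub> g) = r g (x f)"
  obtains y where "y \<in> A c" and "\<And>f. f \<in> T \<Longrightarrow> r f y = x f"
  using sheaf_on_ex1[OF assms] by blast

lemma sheaf_on_eqI:
  assumes sh: "sheaf_on A r" and c: "c \<in> Ob D" and T: "T \<in> J c"
    and y: "y \<in> A c" and z: "z \<in> A c" and eq: "\<And>f. f \<in> T \<Longrightarrow> r f y = r f z"
  shows "y = z"
proof -
  have "\<exists>!x. x \<in> A c \<and> (\<forall>f\<in>T. r f x = r f y)"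
  proof (rule sheaf_on_ex1[OF sh c T])
    fix f assume "f \<in> T"
    note f = coverD[OF c T this]
    show "r f y \<in> A (Dom D f)"
      using sheaf_onD(1)[OF sh] f y by simp
    show "r (f \<cdot>\<^bsub>D\<^esub> g) y = r g (r f y)" if "g \<in> Ar D" "Cod D g = Dom D f" for g
      using sheaf_onD(3)[OF sh] f y that by simp
  qed
  then show ?thesis
    using y z eq by (auto elim!: ex1E)
qed

lemma sheaf_onI:
  assumes "\<And>f x. f \<in> Ar D \<Longrightarrow> x \<in> A (Cod D f) \<Longrightarrow> r f x \<in> A (Dom D f)"
    and "\<And>c x. c \<in> Ob D \<Longrightarrow> x \<in> A c \<Longrightarrow> r (Id D c) x = x"
    and "\<And>f g x. f \<in> Ar D \<Longrightarrow> g \<in> Ar D \<Longrightarrow> Cod D f = Dom D g \<Longrightarrow> x \<in> A (Cod D g) \<Longrightarrow>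
           r (g \<cdot>\<^bsub>D\<^esub> f) x = r f (r g x)"
    and "\<And>c T y z. c \<in> Ob D \<Longrightarrow> T \<in> J c \<Longrightarrow> y \<in> A c \<Longrightarrow> z \<in> A c \<Longrightarrow>
           (\<And>f. f \<in> T \<Longrightarrow> r f y = r f z) \<Longrightarrow> y = z"
    and "\<And>c T x. c \<in> Ob D \<Longrightarrow> T \<in> J c \<Longrightarrow> (\<And>f. f \<in> T \<Longrightarrow> x f \<in> A (Dom D f)) \<Longrightarrow>
           (\<And>f g. f \<in> T \<Longrightarrow> g \<in> Ar D \<Longrightarrow> Cod D g = Dom D f \<Longrightarrow> x (f \<cdot>\<^bsub>D\<^esub> g) = r g (x f)) \<Longrightarrow>
           \<exists>y\<in>A c. \<forall>f\<in>T. r f y = x f"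
  shows "sheaf_on A r"
proof -
  have ex1: "\<exists>!y. y \<in> A c \<and> (\<forall>f\<in>T. r f y = x f)"
    if hyps: "c \<in> Ob D" "T \<in> J c" "\<forall>f\<in>T. x f \<in> A (Dom D f)"
      "\<forall>f\<in>T. \<forall>g\<in>Ar D. Cod D g = Dom D f \<longrightarrow> x (f \<cdot>\<^bsub>D\<^esub> g) = r g (x f)" for c T x
  proof -
    obtain y where "y \<in> A c" "\<forall>f\<in>T. r f y = x f"
      using assms(5)[of c T x] hyps by blast
    moreover from this have "z = y" if "z \<in> A c" "\<forall>f\<in>T. r f z = x f" for z
      using assms(4)[of c T z y] hyps that by simp
    ultimately show ?thesis
      by blast
  qed
  then show ?thesis
    unfolding sheaf_on_def
    by (intro conjI ballI allI impI) (rule ex1 assms(1-3); assumption)+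
qed

text \<open>The map \<open>u c\<close> decodes sections of the sheaf \<open>F\<close> in the universe as elements of \<open>A c\<close>.\<close>

lemma sheaf_encode:
  fixes A :: "'u \<Rightarrow> 'x set"
  assumes sh: "sheaf_on A r" and small: "\<And>c. c \<in> Ob D \<Longrightarrow> small TYPE('u) (A c)"
  obtains F u where "is_sheaf D J F" and "\<And>c. c \<in> Ob D \<Longrightarrow> bij_betw (u c) (sec F c) (A c)"
    and "\<And>f z. f \<in> Ar D \<Longrightarrow> z \<in> sec F (Cod D f) \<Longrightarrow> u (Dom D f) (res F f z) = r f (u (Cod D f) z)"
proof -
  have "\<forall>c\<in>Ob D. \<exists>e :: 'x \<Rightarrow> 'u. inj_on e (A c)"
    using small_ex_inj[OF small] by blast
  then obtain e :: "'u \<Rightarrow> 'x \<Rightarrow> 'u" where e: "\<And>c. c \<in> Ob D \<Longrightarrow> inj_on (e c) (A c)"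
    by (auto dest!: bchoice)
  define F where "F = \<lparr>sec = \<lambda>c. e c ` A c,
    res = \<lambda>f y. e (Dom D f) (r f (inv_into (A (Cod D f)) (e (Cod D f)) y))\<rparr>"
  have sec: "sec F c = e c ` A c" for c
    by (simp add: F_def)
  have res: "res F f (e (Cod D f) x) = e (Dom D f) (r f x)" if "f \<in> Ar D" "x \<in> A (Cod D f)" for f x
    using that e by (simp add: F_def)
  have res': "res F f (e c x) = e (Dom D f) (r f x)" if "f \<in> Ar D" "Cod D f = c" "x \<in> A c" for f x c
    using res that by blast
  have "sheaf_on (sec F) (res F)"
  proof (rule sheaf_onI)
    show "res F f y \<in> sec F (Dom D f)" if "f \<in> Ar D" "y \<in> sec F (Cod D f)" for f y
      using that sheaf_onD(1)[OF sh] by (auto simp: sec res)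
    show "res F (Id D c) y = y" if "c \<in> Ob D" "y \<in> sec F c" for c y
      using that sheaf_onD(2)[OF sh] by (auto simp: sec res')
    show "res F (g \<cdot>\<^bsub>D\<^esub> f) y = res F f (res F g y)"
      if "f \<in> Ar D" "g \<in> Ar D" "Cod D f = Dom D g" "y \<in> sec F (Cod D g)" for f g y
      using that sheaf_onD(1,3)[OF sh] by (auto simp: sec res')
    show "y = z"
      if *: "c \<in> Ob D" "T \<in> J c" "y \<in> sec F c" "z \<in> sec F c" "\<And>f. f \<in> T \<Longrightarrow> res F f y = res F f z"
      for c T y z
    proof -
      obtain y' z' where y': "y' \<in> A c" "y = e c y'" and z': "z' \<in> A c" "z = e c z'"
        using *(3,4) by (auto simp: sec)
      have "r f y' = r f z'" if "f \<in> T" for f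
      proof -
        have "f \<in> Ar D" "Cod D f = c"
          using coverD[OF *(1,2) that] by blast+
        then show ?thesis
          using *(5)[OF that] y' z' sheaf_onD(1)[OF sh] inj_onD[OF e, of "Dom D f" "r f y'" "r f z'"]
          by (auto simp: res')
      qed
      then show ?thesis
        using sheaf_on_eqI[OF sh *(1,2) y'(1) z'(1)] y' z' by simp
    qed
    show "\<exists>y\<in>sec F c. \<forall>f\<in>T. res F f y = x f"
      if *: "c \<in> Ob D" "T \<in> J c" "\<And>f. f \<in> T \<Longrightarrow> x f \<in> sec F (Dom D f)"
        "\<And>f g. f \<in> T \<Longrightarrow> g \<in> Ar D \<Longrightarrow> Cod D g = Dom D f \<Longrightarrow> x (f \<cdot>\<^bsub>D\<^esub> g) = res F g (x f)" for c T x
    proof -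
      define x' where "x' f = inv_into (A (Dom D f)) (e (Dom D f)) (x f)" for f
      have x': "x' f \<in> A (Dom D f)" "x f = e (Dom D f) (x' f)" if "f \<in> T" for f
        using *(3)[OF that] by (auto simp: x'_def sec inv_into_into f_inv_into_f)
      have "x' (f \<cdot>\<^bsub>D\<^esub> g) = r g (x' f)" if fg: "f \<in> T" "g \<in> Ar D" "Cod D g = Dom D f" for f g
      proof -
        note f = coverD[OF *(1,2) fg(1)]
        have "e (Dom D g) (x' (f \<cdot>\<^bsub>D\<^esub> g)) = e (Dom D g) (r g (x' f))"
          using *(4)[OF fg] x'[OF fg(1)] x'[OF f(3)[OF fg(2,3)]] fg f(1) res'[OF fg(2,3)] by simp
        then show ?thesis
          using inj_onD[OF e] x'[OF f(3)[OF fg(2,3)]] x'[OF fg(1)] fg f(1) sheaf_onD(1)[OF sh, of g]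
          by (metis Ar_Ob(1) comp_Ar(2))
      qed
      then obtain y where "y \<in> A c" "\<And>f. f \<in> T \<Longrightarrow> r f y = x' f"
        using sheaf_on_glue[OF sh *(1,2), of x'] x'(1) by metis
      then show ?thesis
        using x'(2) coverD[OF *(1,2)] by (intro bexI[of _ "e c y"]) (auto simp: sec res')
    qed
  qed
  then have "is_sheaf D J F"
    by (auto simp: is_sheaf_iff sec intro: small_image small)
  moreover have "bij_betw (inv_into (A c) (e c)) (sec F c) (A c)" if "c \<in> Ob D" for c
    unfolding sec by (rule bij_betw_inv_into[OF inj_on_imp_bij_betw[OF e[OF that]]])
  moreover have "inv_into (A (Dom D f)) (e (Dom D f)) (res F f z) =
      r f (inv_into (A (Cod D f)) (e (Cod D f)) z)" if f: "f \<in> Ar D" and z: "z \<in> sec F (Cod D f)" for f z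
  proof -
    obtain x where "x \<in> A (Cod D f)" "z = e (Cod D f) x"
      using z by (auto simp: sec)
    then show ?thesis
      using res[OF f] e Ar_Ob[OF f] sheaf_onD(1)[OF sh f] by simp
  qed
  ultimately show ?thesis
    by (rule that)
qed

end

subsection \<open>The category of sheaves\<close>

text \<open>The component of a morphism of sheaves at \<open>c\<close>, applied to a section over \<open>c\<close>.\<close>

definition app :: "'u presheaf \<times> ('u \<Rightarrow> 'u \<Rightarrow> 'u) \<times> 'u presheaf \<Rightarrow> 'u \<Rightarrow> 'u \<Rightarrow> 'u" where
  "app m = fst (snd m)"

context site
begin

text \<open>The arrow of \<open>Sh D J\<close> with components \<open>\<eta>\<close>, made extensional.\<close>

definition nat_arr ::
  "'u presheaf \<Rightarrow> ('u \<Rightarrow> 'u \<Rightarrow> 'u) \<Rightarrow> 'u presheaf \<Rightarrow> 'u presheaf \<times> ('u \<Rightarrow> 'u \<Rightarrow> 'u) \<times> 'u presheaf"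
  where "nat_arr F \<eta> G = (F, (\<lambda>c\<in>Ob D. \<lambda>x\<in>sec F c. \<eta> c x), G)"

lemma Ob_Sh [simp]: "F \<in> Ob (Sh D J) \<longleftrightarrow> is_sheaf D J F"
  by (simp add: Sh_def)

lemma sheaf_sheaf_on: "is_sheaf D J F \<Longrightarrow> sheaf_on (sec F) (res F)"
  by (simp add: is_sheaf_iff)

lemma res_sec: "is_sheaf D J F \<Longrightarrow> f \<in> Ar D \<Longrightarrow> x \<in> sec F (Cod D f) \<Longrightarrow> res F f x \<in> sec F (Dom D f)"
  by (rule sheaf_onD(1)[OF sheaf_sheaf_on])

lemma res_Id: "is_sheaf D J F \<Longrightarrow> c \<in> Ob D \<Longrightarrow> x \<in> sec F c \<Longrightarrow> res F (Id D c) x = x"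
  by (rule sheaf_onD(2)[OF sheaf_sheaf_on])

lemma res_comp:
  "is_sheaf D J F \<Longrightarrow> f \<in> Ar D \<Longrightarrow> g \<in> Ar D \<Longrightarrow> Cod D f = Dom D g \<Longrightarrow> x \<in> sec F (Cod D g) \<Longrightarrow>
     res F (g \<cdot>\<^bsub>D\<^esub> f) x = res F f (res F g x)"
  by (rule sheaf_onD(3)[OF sheaf_sheaf_on])

lemma Sh_homD:
  assumes "m \<in> hom (Sh D J) F G"
  shows "is_sheaf D J F" and "is_sheaf D J G" and "m = nat_arr F (app m) G"
    and "c \<in> Ob D \<Longrightarrow> x \<in> sec F c \<Longrightarrow> app m c x \<in> sec G c"
    and "f \<in> Ar D \<Longrightarrow> x \<in> sec F (Cod D f) \<Longrightarrow>
           app m (Dom D f) (res F f x) = res G f (app m (Cod D f) x)"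
proof -
  obtain \<eta> where m: "m = (F, \<eta>, G)" and F: "is_sheaf D J F" and G: "is_sheaf D J G"
    and nat: "is_natural D F G \<eta>"
    using assms by (auto simp: hom_def Sh_def)
  show "is_sheaf D J F" and "is_sheaf D J G"
    by fact+
  have \<eta>: "\<eta> \<in> (\<Pi>\<^sub>E c\<in>Ob D. sec F c \<rightarrow>\<^sub>E sec G c)"
    using nat by (simp add: is_natural_def)
  have "\<eta> = (\<lambda>c\<in>Ob D. \<lambda>x\<in>sec F c. \<eta> c x)"
  proof
    fix c
    show "\<eta> c = (\<lambda>c\<in>Ob D. \<lambda>x\<in>sec F c. \<eta> c x) c"
    proof (cases "c \<in> Ob D")
      case True
      then have "\<eta> c \<in> sec F c \<rightarrow>\<^sub>E sec G c"
        by (rule PiE_mem[OF \<eta>])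
      then show ?thesis
        using True by (simp add: PiE_restrict)
    next
      case False
      then show ?thesis
        using PiE_arb[OF \<eta>] by simp
    qed
  qed
  then show "m = nat_arr F (app m) G"
    by (simp add: nat_arr_def app_def m)
  show "app m c x \<in> sec G c" if "c \<in> Ob D" "x \<in> sec F c"
    using PiE_mem[OF PiE_mem[OF \<eta> that(1)] that(2)] by (simp add: app_def m)
  show "app m (Dom D f) (res F f x) = res G f (app m (Cod D f) x)"
    if "f \<in> Ar D" "x \<in> sec F (Cod D f)"
    using nat that by (simp add: app_def m is_natural_def)
qed

lemma nat_arr_hom:
  assumes "is_sheaf D J F" and "is_sheaf D J G"
    and "\<And>c x. c \<in> Ob D \<Longrightarrow> x \<in> sec F c \<Longrightarrow> \<eta> c x \<in> sec G c"
    and "\<And>f x. f \<in> Ar D \<Longrightarrow> x \<in> sec F (Cod D f) \<Longrightarrow>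
           \<eta> (Dom D f) (res F f x) = res G f (\<eta> (Cod D f) x)"
  shows "nat_arr F \<eta> G \<in> hom (Sh D J) F G"
proof -
  have "is_natural D F G (\<lambda>c\<in>Ob D. \<lambda>x\<in>sec F c. \<eta> c x)"
    using assms(3,4) res_sec[OF assms(1)] by (simp add: is_natural_def)
  then show ?thesis
    using assms(1,2) by (simp add: hom_def Sh_def nat_arr_def)
qed

lemma app_nat_arr: "c \<in> Ob D \<Longrightarrow> x \<in> sec F c \<Longrightarrow> app (nat_arr F \<eta> G) c x = \<eta> c x"
  by (simp add: app_def nat_arr_def)

lemma nat_arr_cong:
  assumes "\<And>c x. c \<in> Ob D \<Longrightarrow> x \<in> sec F c \<Longrightarrow> \<eta> c x = \<theta> c x"
  shows "nat_arr F \<eta> G = nat_arr F \<theta> G"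
  using assms by (auto simp: nat_arr_def intro!: restrict_ext)

lemma Sh_eqI:
  assumes "m \<in> hom (Sh D J) F G" and "n \<in> hom (Sh D J) F G"
    and "\<And>c x. c \<in> Ob D \<Longrightarrow> x \<in> sec F c \<Longrightarrow> app m c x = app n c x"
  shows "m = n"
  using Sh_homD(3)[OF assms(1)] Sh_homD(3)[OF assms(2)] nat_arr_cong[OF assms(3)] by simp

lemma Sh_comp:
  assumes m: "m \<in> hom (Sh D J) F G" and n: "n \<in> hom (Sh D J) G H"
  shows "n \<cdot>\<^bsub>Sh D J\<^esub> m = nat_arr F (\<lambda>c x. app n c (app m c x)) H"
  by (subst Sh_homD(3)[OF m], subst Sh_homD(3)[OF n])
    (simp add: Sh_def nat_arr_def, intro ext, auto simp: app_def nat_arr_def Sh_homD(4)[OF m, unfolded app_def])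

lemma app_comp:
  assumes "m \<in> hom (Sh D J) F G" and "n \<in> hom (Sh D J) G H" and "c \<in> Ob D" and "x \<in> sec F c"
  shows "app (n \<cdot>\<^bsub>Sh D J\<^esub> m) c x = app n c (app m c x)"
  using assms by (simp add: Sh_comp app_nat_arr)

lemma Sh_comp_hom:
  assumes m: "m \<in> hom (Sh D J) F G" and n: "n \<in> hom (Sh D J) G H"
  shows "n \<cdot>\<^bsub>Sh D J\<^esub> m \<in> hom (Sh D J) F H"
  unfolding Sh_comp[OF m n] using Sh_homD[OF m] Sh_homD[OF n]
  by (intro nat_arr_hom) simp_all

lemma Id_Sh: "Id (Sh D J) F = nat_arr F (\<lambda>c x. x) F"
  by (simp add: Sh_def nat_arr_def)

lemma Id_Sh_hom: "is_sheaf D J F \<Longrightarrow> Id (Sh D J) F \<in> hom (Sh D J) F F"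
  unfolding Id_Sh by (rule nat_arr_hom) auto

lemma app_Id: "c \<in> Ob D \<Longrightarrow> x \<in> sec F c \<Longrightarrow> app (Id (Sh D J) F) c x = x"
  unfolding Id_Sh by (rule app_nat_arr)

lemma is_category_Sh: "is_category (Sh D J)"
  unfolding is_category_def
proof (intro conjI ballI allI impI)
  fix f assume "f \<in> Ar (Sh D J)"
  then show "Dom (Sh D J) f \<in> Ob (Sh D J)" "Cod (Sh D J) f \<in> Ob (Sh D J)"
    by (auto simp: Sh_def)
next
  fix F assume "F \<in> Ob (Sh D J)"
  then show "Id (Sh D J) F \<in> hom (Sh D J) F F"
    by (simp add: Id_Sh_hom)
next
  fix F G H m n assume "m \<in> hom (Sh D J) F G" "n \<in> hom (Sh D J) G H"
  then show "n \<cdot>\<^bsub>Sh D J\<^esub> m \<in> hom (Sh D J) F H"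
    by (rule Sh_comp_hom)
next
  fix F G m assume m: "m \<in> hom (Sh D J) F G"
  note ids = Id_Sh_hom[OF Sh_homD(1)[OF m]] Id_Sh_hom[OF Sh_homD(2)[OF m]]
  show "m \<cdot>\<^bsub>Sh D J\<^esub> Id (Sh D J) F = m"
    by (rule Sh_eqI[OF Sh_comp_hom[OF ids(1) m] m]) (simp add: app_comp[OF ids(1) m] app_Id)
  show "Id (Sh D J) G \<cdot>\<^bsub>Sh D J\<^esub> m = m"
    by (rule Sh_eqI[OF Sh_comp_hom[OF m ids(2)] m])
      (simp add: app_comp[OF m ids(2)] app_Id Sh_homD(4)[OF m])
next
  fix A B C F f g k
  assume f: "f \<in> hom (Sh D J) A B" and g: "g \<in> hom (Sh D J) B C" and k: "k \<in> hom (Sh D J) C F"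
  note gf = Sh_comp_hom[OF f g] and kg = Sh_comp_hom[OF g k]
  show "k \<cdot>\<^bsub>Sh D J\<^esub> (g \<cdot>\<^bsub>Sh D J\<^esub> f) = (k \<cdot>\<^bsub>Sh D J\<^esub> g) \<cdot>\<^bsub>Sh D J\<^esub> f"
    by (rule Sh_eqI[OF Sh_comp_hom[OF gf k] Sh_comp_hom[OF f kg]])
      (simp add: app_comp[OF gf k] app_comp[OF f kg] app_comp[OF f g] app_comp[OF g k] Sh_homD(4)[OF f])
qed

sublocale Sh: cat "Sh D J"
  by unfold_locales (rule is_category_Sh)

subsection \<open>Limits of sheaves\<close>

text \<open>The second conclusion says that the limit has all the sections that a sectionwise limit has: a
  compatible family of sections of the objects \<open>F x\<close> comes from a section of \<open>P\<close>.\<close>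

lemma Sh_limit:
  fixes X :: "'x set"
  assumes X: "small TYPE('u) X" and diag: "is_diagram (Sh D J) X F R"
  obtains P p where "is_limit (Sh D J) X F R P p"
    and "\<And>c t. c \<in> Ob D \<Longrightarrow> (\<And>x. x \<in> X \<Longrightarrow> t x \<in> sec (F x) c) \<Longrightarrow>
           (\<And>x a y b. (x, a, y, b) \<in> R \<Longrightarrow> app a c (t x) = app b c (t y)) \<Longrightarrow>
           \<exists>z\<in>sec P c. \<forall>x\<in>X. app (p x) c z = t x"
proof -
  have F: "is_sheaf D J (F x)" if "x \<in> X" for x
    using diag that by (auto simp: is_diagram_def)
  have F': "sheaf_on (sec (F x)) (res (F x))" if "x \<in> X" for x
    using sheaf_sheaf_on[OF F[OF that]] .
  define A where "A c = {t \<in> \<Pi>\<^sub>E x\<in>X. sec (F x) c.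
    \<forall>x a y b. (x, a, y, b) \<in> R \<longrightarrow> app a c (t x) = app b c (t y)}" for c
  define r where "r f t = (\<lambda>x\<in>X. res (F x) f (t x))" for f t
  have A_sec: "t x \<in> sec (F x) c" if "t \<in> A c" "x \<in> X" for t x c
    using that by (auto simp: A_def)
  have A_rel: "app a c (t x) = app b c (t y)" if "t \<in> A c" "(x, a, y, b) \<in> R" for a b x y t c
    using that unfolding A_def mem_Collect_eq by blast
  have A_I: "(\<lambda>x\<in>X. t x) \<in> A c"
    if "\<And>x. x \<in> X \<Longrightarrow> t x \<in> sec (F x) c" "\<And>x a y b. (x, a, y, b) \<in> R \<Longrightarrow> app a c (t x) = app b c (t y)"
    for t c
  proof -
    have "app a c ((\<lambda>x\<in>X. t x) x) = app b c ((\<lambda>x\<in>X. t x) y)" if R: "(x, a, y, b) \<in> R" for x a y b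
    proof -
      have "x \<in> X" "y \<in> X"
        using is_diagramD[OF diag R] by blast+
      then show ?thesis
        using \<open>\<And>x a y b. (x, a, y, b) \<in> R \<Longrightarrow> app a c (t x) = app b c (t y)\<close>[OF R] by simp
    qed
    then show ?thesis
      using that(1) unfolding A_def mem_Collect_eq by (intro conjI allI impI) auto
  qed
  have A_eqI: "t = t'" if "t \<in> A c" "t' \<in> A c" "\<And>x. x \<in> X \<Longrightarrow> t x = t' x" for t t' c
    using that by (auto simp: A_def intro: PiE_ext)
  have r_A: "r f t \<in> A (Dom D f)" if f: "f \<in> Ar D" and t: "t \<in> A (Cod D f)" for f t
    unfolding r_def
  proof (rule A_I)
    show "res (F x) f (t x) \<in> sec (F x) (Dom D f)" if "x \<in> X" for x
      using sheaf_onD(1)[OF F'[OF that] f A_sec[OF t that]] .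
    show "app a (Dom D f) (res (F x) f (t x)) = app b (Dom D f) (res (F y) f (t y))"
      if R: "(x, a, y, b) \<in> R" for x a y b
    proof -
      obtain B where B: "x \<in> X" "y \<in> X" "a \<in> hom (Sh D J) (F x) B" "b \<in> hom (Sh D J) (F y) B"
        using is_diagramD[OF diag R] by blast
      show ?thesis
        using Sh_homD(5)[OF B(3) f A_sec[OF t B(1)]] Sh_homD(5)[OF B(4) f A_sec[OF t B(2)]]
          A_rel[OF t R] by simp
    qed
  qed
  have "sheaf_on A r"
  proof (rule sheaf_onI)
    show "r f t \<in> A (Dom D f)" if "f \<in> Ar D" "t \<in> A (Cod D f)" for f t
      using r_A that .
  next
    fix c t assume c: "c \<in> Ob D" and t: "t \<in> A c"
    show "r (Id D c) t = t"
      using r_A[of "Id D c" t] c t sheaf_onD(2)[OF F' c A_sec[OF t]]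
      by (intro A_eqI[of _ c]) (simp_all add: r_def)
  next
    fix f g t assume fg: "f \<in> Ar D" "g \<in> Ar D" "Cod D f = Dom D g" and t: "t \<in> A (Cod D g)"
    show "r (g \<cdot>\<^bsub>D\<^esub> f) t = r f (r g t)"
      using sheaf_onD(3)[OF F' fg A_sec[OF t]] by (auto simp: r_def)
  next
    fix c T y z assume c: "c \<in> Ob D" and T: "T \<in> J c" and y: "y \<in> A c" and z: "z \<in> A c"
      and eq: "\<And>f. f \<in> T \<Longrightarrow> r f y = r f z"
    show "y = z"
    proof (rule A_eqI[OF y z])
      fix x assume x: "x \<in> X"
      show "y x = z x"
      proof (rule sheaf_on_eqI[OF F'[OF x] c T A_sec[OF y x] A_sec[OF z x]])
        fix f assume "f \<in> T"
        then show "res (F x) f (y x) = res (F x) f (z x)"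
          using fun_cong[OF eq, of f x] x by (simp add: r_def)
      qed
    qed
  next
    fix c T s assume c: "c \<in> Ob D" and T: "T \<in> J c" and s: "\<And>f. f \<in> T \<Longrightarrow> s f \<in> A (Dom D f)"
      and match: "\<And>f g. f \<in> T \<Longrightarrow> g \<in> Ar D \<Longrightarrow> Cod D g = Dom D f \<Longrightarrow> s (f \<cdot>\<^bsub>D\<^esub> g) = r g (s f)"
    have "\<exists>y. y \<in> sec (F x) c \<and> (\<forall>f\<in>T. res (F x) f y = s f x)" if x: "x \<in> X" for x
    proof (rule sheaf_on_glue[OF F'[OF x] c T])
      show "s f x \<in> sec (F x) (Dom D f)" if "f \<in> T" for f
        using A_sec[OF s[OF that] x] .
      show "s (f \<cdot>\<^bsub>D\<^esub> g) x = res (F x) g (s f x)"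
        if "f \<in> T" "g \<in> Ar D" "Cod D g = Dom D f" for f g
        using match[OF that] x by (simp add: r_def)
    qed blast
    then obtain y where y: "\<And>x. x \<in> X \<Longrightarrow> y x \<in> sec (F x) c"
      and y_res: "\<And>x f. x \<in> X \<Longrightarrow> f \<in> T \<Longrightarrow> res (F x) f (y x) = s f x"
      by metis
    have "(\<lambda>x\<in>X. y x) \<in> A c"
    proof (rule A_I[OF y])
      fix x a z b assume R: "(x, a, z, b) \<in> R"
      then obtain B where B: "x \<in> X" "z \<in> X" "a \<in> hom (Sh D J) (F x) B" "b \<in> hom (Sh D J) (F z) B"
        using is_diagramD[OF diag R] by blast
      show "app a c (y x) = app b c (y z)"
      proof (rule sheaf_on_eqI[OF sheaf_sheaf_on[OF Sh_homD(2)[OF B(3)]] c T])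
        show "app a c (y x) \<in> sec B c" "app b c (y z) \<in> sec B c"
          using Sh_homD(4)[OF B(3) c] Sh_homD(4)[OF B(4) c] y B by simp_all
        fix f assume f: "f \<in> T"
        note f' = coverD[OF c T f]
        have "res B f (app a c (y x)) = app a (Dom D f) (s f x)"
          using Sh_homD(5)[OF B(3) f'(1), of "y x"] f'(2) y B y_res[OF B(1) f] by simp
        moreover have "res B f (app b c (y z)) = app b (Dom D f) (s f z)"
          using Sh_homD(5)[OF B(4) f'(1), of "y z"] f'(2) y B y_res[OF B(2) f] by simp
        ultimately show "res B f (app a c (y x)) = res B f (app b c (y z))"
          using A_rel[OF s[OF f] R] by simp
      qed
    qed
    moreover have "r f (\<lambda>x\<in>X. y x) = s f" if f: "f \<in> T" for f
    proof (rule A_eqI[OF _ s[OF f]])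
      show "r f (\<lambda>x\<in>X. y x) \<in> A (Dom D f)"
        using r_A[of f] coverD[OF c T f] calculation by simp
      show "r f (\<lambda>x\<in>X. y x) x = s f x" if "x \<in> X" for x
        using that y_res[OF that f] by (simp add: r_def)
    qed
    ultimately show "\<exists>y\<in>A c. \<forall>f\<in>T. r f y = s f"
      by blast
  qed
  moreover have "small TYPE('u) (A c)" if "c \<in> Ob D" for c
  proof (rule small_subset)
    show "small TYPE('u) (\<Pi>\<^sub>E x\<in>X. sec (F x) c)"
      using F that by (intro small_PiE[OF univ X]) (simp add: is_sheaf_iff)
    show "A c \<subseteq> (\<Pi>\<^sub>E x\<in>X. sec (F x) c)"
      by (auto simp: A_def)
  qed
  ultimately obtain P u where P: "is_sheaf D J P"
    and u: "\<And>c. c \<in> Ob D \<Longrightarrow> bij_betw (u c) (sec P c) (A c)"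
    and u_res: "\<And>f z. f \<in> Ar D \<Longrightarrow> z \<in> sec P (Cod D f) \<Longrightarrow>
      u (Dom D f) (res P f z) = r f (u (Cod D f) z)"
    by (rule sheaf_encode) (assumption, rule that)
  have u_A: "u c z \<in> A c" if "c \<in> Ob D" "z \<in> sec P c" for c z
    using bij_betwE[OF u[OF that(1)]] that(2) by blast
  have u_eqI: "z = z'"
    if "c \<in> Ob D" "z \<in> sec P c" "z' \<in> sec P c" "\<And>x. x \<in> X \<Longrightarrow> u c z x = u c z' x" for c z z'
  proof -
    have "u c z = u c z'"
      using that by (intro A_eqI[of _ c] u_A) simp_all
    then show ?thesis
      using inj_onD[OF bij_betw_imp_inj_on[OF u[OF that(1)]] _ that(2,3)] by simp
  qed
  have u_surj: "\<exists>z\<in>sec P c. u c z = t" if "c \<in> Ob D" "t \<in> A c" for c t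
    using that(2)[folded bij_betw_imp_surj_on[OF u[OF that(1)]]] by (auto simp only: image_iff)
  define p where "p x = nat_arr P (\<lambda>c z. u c z x) (F x)" for x
  have p: "p x \<in> hom (Sh D J) P (F x)" if x: "x \<in> X" for x
    unfolding p_def
  proof (rule nat_arr_hom[OF P F[OF x]])
    show "u c z x \<in> sec (F x) c" if "c \<in> Ob D" "z \<in> sec P c" for c z
      using A_sec[OF u_A[OF that] x] .
    show "u (Dom D f) (res P f z) x = res (F x) f (u (Cod D f) z x)"
      if "f \<in> Ar D" "z \<in> sec P (Cod D f)" for f z
      using u_res[OF that] x by (simp add: r_def)
  qed
  have app_p: "app (p x) c z = u c z x" if "c \<in> Ob D" "z \<in> sec P c" for x c z
    using that by (simp add: p_def app_nat_arr)
  have cone: "is_cone (Sh D J) X F R P p"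
  proof (rule is_coneI)
    fix x a y b assume R: "(x, a, y, b) \<in> R"
    then obtain B where B: "x \<in> X" "y \<in> X" "a \<in> hom (Sh D J) (F x) B" "b \<in> hom (Sh D J) (F y) B"
      using is_diagramD[OF diag R] by blast
    show "a \<cdot>\<^bsub>Sh D J\<^esub> p x = b \<cdot>\<^bsub>Sh D J\<^esub> p y"
    proof (rule Sh_eqI[OF Sh_comp_hom[OF p[OF B(1)] B(3)] Sh_comp_hom[OF p[OF B(2)] B(4)]])
      fix c z assume cz: "c \<in> Ob D" "z \<in> sec P c"
      then show "app (a \<cdot>\<^bsub>Sh D J\<^esub> p x) c z = app (b \<cdot>\<^bsub>Sh D J\<^esub> p y) c z"
        using app_comp[OF p[OF B(1)] B(3) cz] app_comp[OF p[OF B(2)] B(4) cz] app_p[OF cz]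
          A_rel[OF u_A[OF cz] R] by simp
    qed
  qed (use P p in auto)
  have "is_limit (Sh D J) X F R P p"
    unfolding is_limit_def
  proof (intro conjI allI impI)
    fix Q q assume Q: "is_cone (Sh D J) X F R Q q"
    note q = is_coneD(2)[OF Q]
    have Qs: "is_sheaf D J Q"
      using is_coneD(1)[OF Q] by simp
    have q_A: "(\<lambda>x\<in>X. app (q x) c y) \<in> A c" if cy: "c \<in> Ob D" "y \<in> sec Q c" for c y
    proof (rule A_I)
      show "app (q x) c y \<in> sec (F x) c" if "x \<in> X" for x
        using Sh_homD(4)[OF q[OF that] cy] .
      show "app a c (app (q x) c y) = app b c (app (q z) c y)" if R: "(x, a, z, b) \<in> R" for x a z b
      proof -
        obtain B where B: "x \<in> X" "z \<in> X" "a \<in> hom (Sh D J) (F x) B" "b \<in> hom (Sh D J) (F z) B"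
          using is_diagramD[OF diag R] by blast
        show ?thesis
          using app_comp[OF q[OF B(1)] B(3) cy] app_comp[OF q[OF B(2)] B(4) cy]
            is_coneD(3)[OF Q R] by simp
      qed
    qed
    have "\<forall>c y. \<exists>z. c \<in> Ob D \<longrightarrow> y \<in> sec Q c \<longrightarrow> z \<in> sec P c \<and> u c z = (\<lambda>x\<in>X. app (q x) c y)"
      using u_surj[OF _ q_A] by blast
    then obtain \<eta> where \<eta>: "\<And>c y. c \<in> Ob D \<Longrightarrow> y \<in> sec Q c \<Longrightarrow> \<eta> c y \<in> sec P c"
      "\<And>c y. c \<in> Ob D \<Longrightarrow> y \<in> sec Q c \<Longrightarrow> u c (\<eta> c y) = (\<lambda>x\<in>X. app (q x) c y)"
      by metis
    define m where "m = nat_arr Q \<eta> P"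
    have m: "m \<in> hom (Sh D J) Q P"
      unfolding m_def
    proof (rule nat_arr_hom[OF Qs P \<eta>(1)])
      fix f y assume f: "f \<in> Ar D" and y: "y \<in> sec Q (Cod D f)"
      note ry = res_sec[OF Qs f y]
      show "\<eta> (Dom D f) (res Q f y) = res P f (\<eta> (Cod D f) y)"
      proof (rule u_eqI)
        show "res P f (\<eta> (Cod D f) y) \<in> sec P (Dom D f)"
          using res_sec[OF P f] \<eta>(1)[of "Cod D f" y] f y by simp
        show "u (Dom D f) (\<eta> (Dom D f) (res Q f y)) x = u (Dom D f) (res P f (\<eta> (Cod D f) y)) x"
          if "x \<in> X" for x
          using u_res[OF f \<eta>(1)[of "Cod D f" y]] \<eta>(2)[of "Cod D f" y] \<eta>(2)[of "Dom D f", OF _ ry] f y that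
            Sh_homD(5)[OF q[OF that] f y] by (simp add: r_def)
      qed (use f \<eta>(1) ry in auto)
    qed
    have pm: "p x \<cdot>\<^bsub>Sh D J\<^esub> m = q x" if x: "x \<in> X" for x
    proof (rule Sh_eqI[OF Sh_comp_hom[OF m p[OF x]] q[OF x]])
      fix c y assume cy: "c \<in> Ob D" "y \<in> sec Q c"
      show "app (p x \<cdot>\<^bsub>Sh D J\<^esub> m) c y = app (q x) c y"
        using app_comp[OF m p[OF x] cy] app_p[OF cy(1) \<eta>(1)[OF cy]] \<eta>(2)[OF cy] x
        by (simp add: m_def app_nat_arr[OF cy])
    qed
    moreover have "n = m" if n: "n \<in> hom (Sh D J) Q P" and pn: "\<forall>x\<in>X. p x \<cdot>\<^bsub>Sh D J\<^esub> n = q x" for n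
    proof (rule Sh_eqI[OF n m])
      fix c y assume cy: "c \<in> Ob D" "y \<in> sec Q c"
      show "app n c y = app m c y"
      proof (rule u_eqI[OF cy(1) Sh_homD(4)[OF n cy] Sh_homD(4)[OF m cy]])
        fix x assume x: "x \<in> X"
        have "p x \<cdot>\<^bsub>Sh D J\<^esub> n = p x \<cdot>\<^bsub>Sh D J\<^esub> m"
          using pm[OF x] pn x by simp
        then show "u c (app n c y) x = u c (app m c y) x"
          using app_comp[OF n p[OF x] cy] app_comp[OF m p[OF x] cy]
            app_p[OF cy(1) Sh_homD(4)[OF n cy]] app_p[OF cy(1) Sh_homD(4)[OF m cy]] by simp
      qed
    qed
    ultimately show "\<exists>!m. m \<in> hom (Sh D J) Q P \<and> (\<forall>x\<in>X. p x \<cdot>\<^bsub>Sh D J\<^esub> m = q x)"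
      using m by blast
  qed (rule cone)
  moreover have "\<exists>z\<in>sec P c. \<forall>x\<in>X. app (p x) c z = t x"
    if c: "c \<in> Ob D" and t: "\<And>x. x \<in> X \<Longrightarrow> t x \<in> sec (F x) c"
      "\<And>x a y b. (x, a, y, b) \<in> R \<Longrightarrow> app a c (t x) = app b c (t y)" for c t
  proof -
    obtain z where "z \<in> sec P c" "u c z = (\<lambda>x\<in>X. t x)"
      using u_surj[OF c A_I[OF t]] by blast
    then show ?thesis
      using app_p[OF c] by (intro bexI[of _ z]) auto
  qed
  ultimately show ?thesis
    by (rule that)
qed

subsection \<open>Coproducts of sheaves\<close>

text \<open>Over an object covered by the empty sieve every sheaf has exactly one section.\<close>

lemma is_initial_Sh:
  assumes P: "is_sheaf D J P" and empty: "\<And>c. c \<in> Ob D \<Longrightarrow> sec P c \<noteq> {} \<Longrightarrow> {} \<in> J c"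
  shows "is_initial (Sh D J) P"
  unfolding is_initial_def
proof (intro conjI ballI)
  fix Q assume "Q \<in> Ob (Sh D J)"
  then have Q: "is_sheaf D J Q"
    by simp
  have ex1: "\<exists>!y. y \<in> sec Q c" if "c \<in> Ob D" "x \<in> sec P c" for c x
    using sheaf_on_ex1[OF sheaf_sheaf_on[OF Q] that(1) empty[OF that(1)], of "\<lambda>_. undefined"] that(2)
    by auto
  have uniq: "y = z" if "c \<in> Ob D" "x \<in> sec P c" "y \<in> sec Q c" "z \<in> sec Q c" for c x y z
    using ex1[OF that(1,2)] that(3,4) by blast
  define \<eta> where "\<eta> c x = (THE y. y \<in> sec Q c)" for c :: 'u and x :: 'u
  have \<eta>: "\<eta> c x \<in> sec Q c" if "c \<in> Ob D" "x \<in> sec P c" for c x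
    unfolding \<eta>_def by (rule theI'[OF ex1[OF that]])
  have m: "nat_arr P \<eta> Q \<in> hom (Sh D J) P Q"
  proof (rule nat_arr_hom[OF P Q \<eta>])
    fix f x assume f: "f \<in> Ar D" and x: "x \<in> sec P (Cod D f)"
    note rx = res_sec[OF P f x]
    show "\<eta> (Dom D f) (res P f x) = res Q f (\<eta> (Cod D f) x)"
      using uniq[OF _ rx \<eta>[OF _ rx] res_sec[OF Q f \<eta>[OF _ x]]] f by simp
  qed
  show "\<exists>!m. m \<in> hom (Sh D J) P Q"
  proof (rule ex1I, rule m)
    fix n assume n: "n \<in> hom (Sh D J) P Q"
    show "n = nat_arr P \<eta> Q"
    proof (rule Sh_eqI[OF n m])
      fix c x assume cx: "c \<in> Ob D" "x \<in> sec P c"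
      show "app n c x = app (nat_arr P \<eta> Q) c x"
        by (rule uniq[OF cx Sh_homD(4)[OF n cx] Sh_homD(4)[OF m cx]])
    qed
  qed
qed (use P in simp)

text \<open>The power object of a sheaf \<open>F\<close>: its sections over \<open>c\<close> are the closed subpresheaves \<open>G\<close> of the
  product of \<open>F\<close> with the presheaf represented by \<open>c\<close>, as sets of pairs of an arrow \<open>f\<close> to \<open>c\<close> and a section of \<open>F\<close>
  over the domain of \<open>f\<close>.  The conditions say that \<open>G\<close> consists of such pairs, is closed under
  restriction, and contains every pair that it contains locally.\<close>

definition power_sec :: "'u presheaf \<Rightarrow> 'u \<Rightarrow> ('u \<times> 'u) set set" where
  "power_sec F c =
     {G. (\<forall>f s. (f, s) \<in> G \<longrightarrow> f \<in> Ar D \<and> Cod D f = c \<and> s \<in> sec F (Dom D f)) \<and>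
         (\<forall>f s g. (f, s) \<in> G \<longrightarrow> g \<in> Ar D \<longrightarrow> Cod D g = Dom D f \<longrightarrow> (f \<cdot>\<^bsub>D\<^esub> g, res F g s) \<in> G) \<and>
         (\<forall>f s. f \<in> Ar D \<longrightarrow> Cod D f = c \<longrightarrow> s \<in> sec F (Dom D f) \<longrightarrow>
            (\<exists>T\<in>J (Dom D f). \<forall>g\<in>T. (f \<cdot>\<^bsub>D\<^esub> g, res F g s) \<in> G) \<longrightarrow> (f, s) \<in> G)}"

text \<open>Restriction of such a subpresheaf along \<open>h\<close>.\<close>

definition power_res :: "'u presheaf \<Rightarrow> 'u \<Rightarrow> ('u \<times> 'u) set \<Rightarrow> ('u \<times> 'u) set" where
  "power_res F h G =
     {(f, s). f \<in> Ar D \<and> Cod D f = Dom D h \<and> s \<in> sec F (Dom D f) \<and> (h \<cdot>\<^bsub>D\<^esub> f, s) \<in> G}"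

lemma power_secD:
  assumes "G \<in> power_sec F c"
  shows "(f, s) \<in> G \<Longrightarrow> f \<in> Ar D" and "(f, s) \<in> G \<Longrightarrow> Cod D f = c"
    and "(f, s) \<in> G \<Longrightarrow> s \<in> sec F (Dom D f)"
    and "(f, s) \<in> G \<Longrightarrow> g \<in> Ar D \<Longrightarrow> Cod D g = Dom D f \<Longrightarrow> (f \<cdot>\<^bsub>D\<^esub> g, res F g s) \<in> G"
    and "f \<in> Ar D \<Longrightarrow> Cod D f = c \<Longrightarrow> s \<in> sec F (Dom D f) \<Longrightarrow> T \<in> J (Dom D f) \<Longrightarrow>
           (\<And>g. g \<in> T \<Longrightarrow> (f \<cdot>\<^bsub>D\<^esub> g, res F g s) \<in> G) \<Longrightarrow> (f, s) \<in> G"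
proof -
  note G = assms[unfolded power_sec_def mem_Collect_eq]
  show "(f, s) \<in> G \<Longrightarrow> f \<in> Ar D" and "(f, s) \<in> G \<Longrightarrow> Cod D f = c"
    and "(f, s) \<in> G \<Longrightarrow> s \<in> sec F (Dom D f)"
    using G[THEN conjunct1] by simp_all
  show "(f, s) \<in> G \<Longrightarrow> g \<in> Ar D \<Longrightarrow> Cod D g = Dom D f \<Longrightarrow> (f \<cdot>\<^bsub>D\<^esub> g, res F g s) \<in> G"
    using G[THEN conjunct2, THEN conjunct1] by simp
  show "f \<in> Ar D \<Longrightarrow> Cod D f = c \<Longrightarrow> s \<in> sec F (Dom D f) \<Longrightarrow> T \<in> J (Dom D f) \<Longrightarrow>
      (\<And>g. g \<in> T \<Longrightarrow> (f \<cdot>\<^bsub>D\<^esub> g, res F g s) \<in> G) \<Longrightarrow> (f, s) \<in> G"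
    by (rule G[THEN conjunct2, THEN conjunct2, rule_format], assumption+) blast
qed

lemma power_secI:
  assumes "\<And>f s. (f, s) \<in> G \<Longrightarrow> f \<in> Ar D \<and> Cod D f = c \<and> s \<in> sec F (Dom D f)"
    and "\<And>f s g. (f, s) \<in> G \<Longrightarrow> g \<in> Ar D \<Longrightarrow> Cod D g = Dom D f \<Longrightarrow> (f \<cdot>\<^bsub>D\<^esub> g, res F g s) \<in> G"
    and "\<And>f s T. f \<in> Ar D \<Longrightarrow> Cod D f = c \<Longrightarrow> s \<in> sec F (Dom D f) \<Longrightarrow> T \<in> J (Dom D f) \<Longrightarrow>
           (\<And>g. g \<in> T \<Longrightarrow> (f \<cdot>\<^bsub>D\<^esub> g, res F g s) \<in> G) \<Longrightarrow> (f, s) \<in> G"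
  shows "G \<in> power_sec F c"
  unfolding power_sec_def mem_Collect_eq
proof (intro conjI; intro allI impI)
  fix f s assume f: "f \<in> Ar D" "Cod D f = c" "s \<in> sec F (Dom D f)"
    and "\<exists>T\<in>J (Dom D f). \<forall>g\<in>T. (f \<cdot>\<^bsub>D\<^esub> g, res F g s) \<in> G"
  then obtain T where "T \<in> J (Dom D f)" "\<And>g. g \<in> T \<Longrightarrow> (f \<cdot>\<^bsub>D\<^esub> g, res F g s) \<in> G"
    by blast
  then show "(f, s) \<in> G"
    by (rule assms(3)[OF f])
qed (rule assms(1,2); assumption)+

lemma mem_power_res:
  "(f, s) \<in> power_res F h G \<longleftrightarrow>
     f \<in> Ar D \<and> Cod D f = Dom D h \<and> s \<in> sec F (Dom D f) \<and> (h \<cdot>\<^bsub>D\<^esub> f, s) \<in> G"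
  by (simp add: power_res_def)

lemma power_res_sec:
  assumes F: "is_sheaf D J F" and h: "h \<in> Ar D" and G: "G \<in> power_sec F (Cod D h)"
  shows "power_res F h G \<in> power_sec F (Dom D h)"
proof (rule power_secI)
  fix f s T assume f: "f \<in> Ar D" "Cod D f = Dom D h" and s: "s \<in> sec F (Dom D f)"
    and T: "T \<in> J (Dom D f)" and "\<And>g. g \<in> T \<Longrightarrow> (f \<cdot>\<^bsub>D\<^esub> g, res F g s) \<in> power_res F h G"
  then have "((h \<cdot>\<^bsub>D\<^esub> f) \<cdot>\<^bsub>D\<^esub> g, res F g s) \<in> G" if "g \<in> T" for g
    using coverD[OF _ T that] h that by (simp add: mem_power_res)
  then have "(h \<cdot>\<^bsub>D\<^esub> f, s) \<in> G"
    using power_secD(5)[OF G, of "h \<cdot>\<^bsub>D\<^esub> f" s T] f h s T by simp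
  then show "(f, s) \<in> power_res F h G"
    using f s by (simp add: mem_power_res)
qed (use h F power_secD(4)[OF G] in \<open>auto simp: mem_power_res res_sec simp flip: assoc_Ar\<close>)

lemma sheaf_on_power:
  assumes F: "is_sheaf D J F"
  shows "sheaf_on (power_sec F) (power_res F)"
proof (rule sheaf_onI)
  show "power_res F h G \<in> power_sec F (Dom D h)" if "h \<in> Ar D" "G \<in> power_sec F (Cod D h)" for h G
    by (rule power_res_sec[OF F that])
next
  fix c G assume c: "c \<in> Ob D" and G: "G \<in> power_sec F c"
  have "(f, s) \<in> power_res F (Id D c) G \<longleftrightarrow> (f, s) \<in> G" for f s
    using power_secD(1-3)[OF G, of f s] c Id_comp_Ar[of f] by (auto simp: mem_power_res)
  then show "power_res F (Id D c) G = G"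
    by auto
next
  fix f g G assume fg: "f \<in> Ar D" "g \<in> Ar D" "Cod D f = Dom D g" and "G \<in> power_sec F (Cod D g)"
  have "(k, s) \<in> power_res F (g \<cdot>\<^bsub>D\<^esub> f) G \<longleftrightarrow> (k, s) \<in> power_res F f (power_res F g G)" for k s
    using fg by (auto simp: mem_power_res)
  then show "power_res F (g \<cdot>\<^bsub>D\<^esub> f) G = power_res F f (power_res F g G)"
    by auto
next
  fix c T and G H :: "('u \<times> 'u) set"
  assume c: "c \<in> Ob D" and T: "T \<in> J c" and GH: "G \<in> power_sec F c" "H \<in> power_sec F c"
    "\<And>t. t \<in> T \<Longrightarrow> power_res F t G = power_res F t H"
  have sub: "(f, s) \<in> H" if G: "G \<in> power_sec F c" and H: "H \<in> power_sec F c"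
    and eq: "\<And>t. t \<in> T \<Longrightarrow> power_res F t G = power_res F t H" and fs: "(f, s) \<in> G" for G H f s
  proof -
    note f = power_secD(1-3)[OF G fs]
    have cov: "pull_sieve D f T \<in> J (Dom D f)"
      using cover_pull f T by simp
    show ?thesis
    proof (rule power_secD(5)[OF H f cov])
      fix g assume "g \<in> pull_sieve D f T"
      then have g: "g \<in> Ar D" "Cod D g = Dom D f" and fg: "f \<cdot>\<^bsub>D\<^esub> g \<in> T"
        by (auto simp: pull_sieve_def)
      have "(Id D (Dom D g), res F g s) \<in> power_res F (f \<cdot>\<^bsub>D\<^esub> g) G"
        using power_secD(4)[OF G fs g] f g res_sec[OF F g(1)] comp_Id_Ar[of "f \<cdot>\<^bsub>D\<^esub> g"]
        by (simp add: mem_power_res)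
      then show "(f \<cdot>\<^bsub>D\<^esub> g, res F g s) \<in> H"
        using eq[OF fg] f g comp_Id_Ar[of "f \<cdot>\<^bsub>D\<^esub> g"] by (simp add: mem_power_res)
    qed
  qed
  show "G = H"
  proof (intro equalityI subrelI)
    show "(f, s) \<in> H" if "(f, s) \<in> G" for f s
      by (rule sub[OF GH that])
    show "(f, s) \<in> G" if "(f, s) \<in> H" for f s
      by (rule sub[OF GH(2,1) GH(3)[symmetric] that])
  qed
next
  fix c T x assume c: "c \<in> Ob D" and T: "T \<in> J c" and x: "\<And>f. f \<in> T \<Longrightarrow> x f \<in> power_sec F (Dom D f)"
    and match: "\<And>f g. f \<in> T \<Longrightarrow> g \<in> Ar D \<Longrightarrow> Cod D g = Dom D f \<Longrightarrow>
      x (f \<cdot>\<^bsub>D\<^esub> g) = power_res F g (x f)"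
  define G where "G = {(f, s). f \<in> Ar D \<and> Cod D f = c \<and> s \<in> sec F (Dom D f) \<and>
    (\<forall>g\<in>Ar D. Cod D g = Dom D f \<longrightarrow> f \<cdot>\<^bsub>D\<^esub> g \<in> T \<longrightarrow>
       (Id D (Dom D g), res F g s) \<in> x (f \<cdot>\<^bsub>D\<^esub> g))}"
  have GI: "(f, s) \<in> G" if "f \<in> Ar D" "Cod D f = c" "s \<in> sec F (Dom D f)"
    "\<And>g. g \<in> Ar D \<Longrightarrow> Cod D g = Dom D f \<Longrightarrow> f \<cdot>\<^bsub>D\<^esub> g \<in> T \<Longrightarrow>
       (Id D (Dom D g), res F g s) \<in> x (f \<cdot>\<^bsub>D\<^esub> g)" for f s
    using that by (simp add: G_def)
  have GD: "f \<in> Ar D" "Cod D f = c" "s \<in> sec F (Dom D f)" if "(f, s) \<in> G" for f s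
    using that by (simp_all add: G_def)
  have G_mem: "(Id D (Dom D g), res F g s) \<in> x (f \<cdot>\<^bsub>D\<^esub> g)"
    if "(f, s) \<in> G" "g \<in> Ar D" "Cod D g = Dom D f" "f \<cdot>\<^bsub>D\<^esub> g \<in> T" for f s g
    using that by (simp add: G_def)
  have "G \<in> power_sec F c"
  proof (rule power_secI)
    fix f s g assume fs: "(f, s) \<in> G" and g: "g \<in> Ar D" "Cod D g = Dom D f"
    note f = GD[OF fs]
    show "(f \<cdot>\<^bsub>D\<^esub> g, res F g s) \<in> G"
    proof (rule GI)
      fix k assume k: "k \<in> Ar D" "Cod D k = Dom D (f \<cdot>\<^bsub>D\<^esub> g)" "(f \<cdot>\<^bsub>D\<^esub> g) \<cdot>\<^bsub>D\<^esub> k \<in> T"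
      then show "(Id D (Dom D k), res F k (res F g s)) \<in> x ((f \<cdot>\<^bsub>D\<^esub> g) \<cdot>\<^bsub>D\<^esub> k)"
        using G_mem[OF fs, of "g \<cdot>\<^bsub>D\<^esub> k"] f g res_comp[OF F k(1) g(1), of s] by simp
    qed (use f g res_sec[OF F g(1)] in auto)
  next
    fix f s N assume f: "f \<in> Ar D" "Cod D f = c" "s \<in> sec F (Dom D f)" and N: "N \<in> J (Dom D f)"
      and NG: "\<And>n. n \<in> N \<Longrightarrow> (f \<cdot>\<^bsub>D\<^esub> n, res F n s) \<in> G"
    show "(f, s) \<in> G"
    proof (rule GI[OF f])
      fix g assume g: "g \<in> Ar D" "Cod D g = Dom D f" and fg: "f \<cdot>\<^bsub>D\<^esub> g \<in> T"
      have xfg: "x (f \<cdot>\<^bsub>D\<^esub> g) \<in> power_sec F (Dom D g)"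
        using x[OF fg] f g by simp
      have cov: "pull_sieve D g N \<in> J (Dom D (Id D (Dom D g)))"
        using cover_pull[OF g(1)] g N by simp
      show "(Id D (Dom D g), res F g s) \<in> x (f \<cdot>\<^bsub>D\<^esub> g)"
      proof (rule power_secD(5)[OF xfg _ _ _ cov])
        fix k assume "k \<in> pull_sieve D g N"
        then have k: "k \<in> Ar D" "Cod D k = Dom D g" "g \<cdot>\<^bsub>D\<^esub> k \<in> N"
          by (auto simp: pull_sieve_def)
        have fgk: "f \<cdot>\<^bsub>D\<^esub> (g \<cdot>\<^bsub>D\<^esub> k) \<in> T"
          using coverD(3)[OF c T fg k(1)] f g k by simp
        have "(Id D (Dom D k), res F (Id D (Dom D k)) (res F (g \<cdot>\<^bsub>D\<^esub> k) s)) \<in>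
            x ((f \<cdot>\<^bsub>D\<^esub> (g \<cdot>\<^bsub>D\<^esub> k)) \<cdot>\<^bsub>D\<^esub> Id D (Dom D k))"
          using G_mem[OF NG[OF k(3)], of "Id D (Dom D k)"] comp_Id_Ar[of "f \<cdot>\<^bsub>D\<^esub> (g \<cdot>\<^bsub>D\<^esub> k)"] f g k fgk
          by simp
        moreover have "(f \<cdot>\<^bsub>D\<^esub> (g \<cdot>\<^bsub>D\<^esub> k)) \<cdot>\<^bsub>D\<^esub> Id D (Dom D k) = (f \<cdot>\<^bsub>D\<^esub> g) \<cdot>\<^bsub>D\<^esub> k"
          using f g k comp_Id_Ar[of k] by simp
        moreover have "res F (Id D (Dom D k)) (res F (g \<cdot>\<^bsub>D\<^esub> k) s) = res F k (res F g s)"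
          using res_Id[OF F] res_sec[OF F, of "g \<cdot>\<^bsub>D\<^esub> k" s] res_comp[OF F k(1) g(1) k(2)] f g k by simp
        ultimately have "(Id D (Dom D k), res F k (res F g s)) \<in> power_res F k (x (f \<cdot>\<^bsub>D\<^esub> g))"
          using match[OF fg k(1)] f g k(2) by simp
        then show "(Id D (Dom D g) \<cdot>\<^bsub>D\<^esub> k, res F k (res F g s)) \<in> x (f \<cdot>\<^bsub>D\<^esub> g)"
          using k comp_Id_Ar[of k] Id_comp_Ar[of k] by (simp add: mem_power_res)
      qed (use f g res_sec[OF F g(1)] in auto)
    qed
  qed (use GD in blast)
  moreover have "power_res F t G = x t" if t: "t \<in> T" for t
  proof -
    note t' = coverD[OF c T t] and xt = x[OF t]
    have "(f, s) \<in> power_res F t G \<longleftrightarrow> (f, s) \<in> x t" for f s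
    proof
      assume "(f, s) \<in> power_res F t G"
      then have f: "f \<in> Ar D" "Cod D f = Dom D t" "s \<in> sec F (Dom D f)" and G: "(t \<cdot>\<^bsub>D\<^esub> f, s) \<in> G"
        by (auto simp: mem_power_res)
      have "(Id D (Dom D f), s) \<in> x (t \<cdot>\<^bsub>D\<^esub> f)"
        using G_mem[OF G, of "Id D (Dom D f)"] f t' t'(3)[OF f(1,2)] comp_Id_Ar[of f] res_Id[OF F _ f(3)]
        by simp
      then show "(f, s) \<in> x t"
        using match[OF t f(1,2)] f comp_Id_Ar[of f] by (simp add: mem_power_res)
    next
      assume fs: "(f, s) \<in> x t"
      note f = power_secD(1-3)[OF xt fs]
      have "(t \<cdot>\<^bsub>D\<^esub> f, s) \<in> G"
      proof (rule GI)
        fix g assume g: "g \<in> Ar D" "Cod D g = Dom D (t \<cdot>\<^bsub>D\<^esub> f)"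
        then have "(Id D (Dom D g), res F g s) \<in> power_res F (f \<cdot>\<^bsub>D\<^esub> g) (x t)"
          using power_secD(4)[OF xt fs g(1)] f t' res_sec[OF F g(1)] comp_Id_Ar[of g]
          by (simp add: mem_power_res)
        then show "(Id D (Dom D g), res F g s) \<in> x ((t \<cdot>\<^bsub>D\<^esub> f) \<cdot>\<^bsub>D\<^esub> g)"
          using match[OF t, of "f \<cdot>\<^bsub>D\<^esub> g"] f g t' by simp
      qed (use f t' in auto)
      then show "(f, s) \<in> power_res F t G"
        using f by (simp add: mem_power_res)
    qed
    then show ?thesis
      by auto
  qed
  ultimately show "\<exists>y\<in>power_sec F c. \<forall>f\<in>T. power_res F f y = x f"
    by blast
qed

text \<open>Every sheaf \<open>F\<close> embeds into a sheaf \<open>Q\<close> by a map \<open>i\<close> such that \<open>Q\<close> has a global point outside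
  the image of \<open>i\<close>; \<open>z G\<close> is the constant map from \<open>G\<close> to this point.  The last conclusion says that a
  section of \<open>F\<close> can agree with the point only over an object that is covered by the empty sieve.\<close>

lemma ex_embedding_with_point:
  assumes F: "is_sheaf D J F"
  obtains Q i z where "i \<in> hom (Sh D J) F Q"
    and "\<And>G. is_sheaf D J G \<Longrightarrow> z G \<in> hom (Sh D J) G Q"
    and "\<And>c x y. c \<in> Ob D \<Longrightarrow> x \<in> sec F c \<Longrightarrow> y \<in> sec F c \<Longrightarrow> app i c x = app i c y \<Longrightarrow> x = y"
    and "\<And>G c x y. is_sheaf D J G \<Longrightarrow> c \<in> Ob D \<Longrightarrow> x \<in> sec F c \<Longrightarrow> y \<in> sec G c \<Longrightarrow>
           app i c x = app (z G) c y \<Longrightarrow> {} \<in> J c"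
proof -
  have small: "small TYPE('u) (power_sec F c)" for c
  proof (rule small_subset)
    show "small TYPE('u) (Pow (Sigma (Ar D) (\<lambda>f. sec F (Dom D f))))"
      using F by (intro small_Pow[OF univ] small_Sigma[OF univ small_Ar]) (simp add: is_sheaf_iff)
    show "power_sec F c \<subseteq> Pow (Sigma (Ar D) (\<lambda>f. sec F (Dom D f)))"
      using power_secD(1,3)[of _ F c] by fast
  qed
  obtain Q u where Q: "is_sheaf D J Q"
    and u: "\<And>c. c \<in> Ob D \<Longrightarrow> bij_betw (u c) (sec Q c) (power_sec F c)"
    and u_res: "\<And>f q. f \<in> Ar D \<Longrightarrow> q \<in> sec Q (Cod D f) \<Longrightarrow>
      u (Dom D f) (res Q f q) = power_res F f (u (Cod D f) q)"
    by (rule sheaf_encode[OF sheaf_on_power[OF F] small]) (rule that)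
  define e where "e c = inv_into (sec Q c) (u c)" for c
  have e: "e c G \<in> sec Q c" "u c (e c G) = G" if "c \<in> Ob D" "G \<in> power_sec F c" for c G
    using that u[OF that(1)] unfolding e_def
    by (simp_all add: bij_betw_def f_inv_into_f inv_into_into)
  have e_res: "e (Dom D f) (power_res F f G) = res Q f (e (Cod D f) G)"
    if f: "f \<in> Ar D" and G: "G \<in> power_sec F (Cod D f)" for f G
  proof -
    have "u (Dom D f) (res Q f (e (Cod D f) G)) = power_res F f G"
      using u_res[OF f] e[OF _ G] f by simp
    moreover have "res Q f (e (Cod D f) G) \<in> sec Q (Dom D f)"
      using res_sec[OF Q f] e[OF _ G] f by simp
    ultimately show ?thesis
      using bij_betw_imp_inj_on[OF u] f unfolding e_def by (metis Ar_Ob(1) inv_into_f_f)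
  qed
  \<comment> \<open>The singletons, and the least closed subpresheaf: it has the sections over objects that the
    empty sieve covers.\<close>
  define sing where "sing c x = {(f, s). f \<in> Ar D \<and> Cod D f = c \<and> s = res F f x}" for c x
  define emp where "emp c = {(f, s). f \<in> Ar D \<and> Cod D f = c \<and> s \<in> sec F (Dom D f) \<and> {} \<in> J (Dom D f)}" for c
  have sing: "sing c x \<in> power_sec F c" if c: "c \<in> Ob D" and x: "x \<in> sec F c" for c x
  proof (rule power_secI)
    fix f s T assume f: "f \<in> Ar D" "Cod D f = c" and s: "s \<in> sec F (Dom D f)" and T: "T \<in> J (Dom D f)"
      and fs: "\<And>g. g \<in> T \<Longrightarrow> (f \<cdot>\<^bsub>D\<^esub> g, res F g s) \<in> sing c x"
    have "s = res F f x"
    proof (rule sheaf_on_eqI[OF sheaf_sheaf_on[OF F] Ar_Ob(1)[OF f(1)] T s])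
      show "res F f x \<in> sec F (Dom D f)"
        using res_sec[OF F f(1)] f x by simp
      show "res F g s = res F g (res F f x)" if "g \<in> T" for g
        using fs[OF that] coverD[OF _ T that] f x res_comp[OF F _ f(1), of g x] by (simp add: sing_def)
    qed
    then show "(f, s) \<in> sing c x"
      using f by (simp add: sing_def)
  qed (use x res_sec[OF F] res_comp[OF F] in \<open>auto simp: sing_def\<close>)
  have emp: "emp c \<in> power_sec F c" if c: "c \<in> Ob D" for c
  proof (rule power_secI)
    fix f s g assume "(f, s) \<in> emp c" and g: "g \<in> Ar D" "Cod D g = Dom D f"
    then have f: "f \<in> Ar D" "Cod D f = c" "s \<in> sec F (Dom D f)" "{} \<in> J (Dom D f)"
      by (auto simp: emp_def)
    then have "{} \<in> J (Dom D g)"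
      using cover_pull[OF g(1), of "{}"] g by (simp add: pull_sieve_def)
    then show "(f \<cdot>\<^bsub>D\<^esub> g, res F g s) \<in> emp c"
      using f g res_sec[OF F g(1)] by (simp add: emp_def)
  next
    fix f s T assume f: "f \<in> Ar D" "Cod D f = c" and s: "s \<in> sec F (Dom D f)" and T: "T \<in> J (Dom D f)"
      and fs: "\<And>g. g \<in> T \<Longrightarrow> (f \<cdot>\<^bsub>D\<^esub> g, res F g s) \<in> emp c"
    have "{} \<in> J (Dom D f)"
    proof (rule cover_local[OF Ar_Ob(1)[OF f(1)] T])
      show "pull_sieve D g {} \<in> J (Dom D g)" if "g \<in> T" for g
        using fs[OF that] coverD[OF _ T that] f by (simp add: emp_def pull_sieve_def)
    qed (simp add: is_sieve_def)
    then show "(f, s) \<in> emp c"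
      using f s by (simp add: emp_def)
  qed (auto simp: emp_def)
  have sing_res: "power_res F f (sing (Cod D f) x) = sing (Dom D f) (res F f x)"
    if f: "f \<in> Ar D" and x: "x \<in> sec F (Cod D f)" for f x
  proof -
    have "(g, s) \<in> power_res F f (sing (Cod D f) x) \<longleftrightarrow> (g, s) \<in> sing (Dom D f) (res F f x)" for g s
      using f x res_comp[OF F _ f, of g x] res_sec[OF F, of g "res F f x"] res_sec[OF F f x]
      by (auto simp: mem_power_res sing_def)
    then show ?thesis
      by (intro equalityI subrelI) simp_all
  qed
  have emp_res: "power_res F f (emp (Cod D f)) = emp (Dom D f)" if f: "f \<in> Ar D" for f
  proof -
    have "(g, s) \<in> power_res F f (emp (Cod D f)) \<longleftrightarrow> (g, s) \<in> emp (Dom D f)" for g s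
      using f by (auto simp: mem_power_res emp_def)
    then show ?thesis
      by (intro equalityI subrelI) simp_all
  qed
  define i where "i = nat_arr F (\<lambda>c x. e c (sing c x)) Q"
  define z where "z G = nat_arr G (\<lambda>c x. e c (emp c)) Q" for G
  have app_i: "u c (app i c x) = sing c x" if "c \<in> Ob D" "x \<in> sec F c" for c x
    using that sing[OF that] e(2) by (simp add: i_def app_nat_arr)
  have app_z: "u c (app (z G) c x) = emp c" if "c \<in> Ob D" "x \<in> sec G c" for G c x
    using that emp[OF that(1)] e(2) by (simp add: z_def app_nat_arr)
  have Id_sing: "(Id D c, x) \<in> sing c x" if "c \<in> Ob D" "x \<in> sec F c" for c x
    using that res_Id[OF F] by (simp add: sing_def)
  show ?thesis
  proof (rule that)
    show "i \<in> hom (Sh D J) F Q"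
      unfolding i_def
      by (rule nat_arr_hom[OF F Q]) (simp_all add: e sing sing_res flip: e_res)
    show "z G \<in> hom (Sh D J) G Q" if "is_sheaf D J G" for G
      unfolding z_def
      by (rule nat_arr_hom[OF that Q]) (simp_all add: e emp emp_res flip: e_res)
    show "x = y" if "c \<in> Ob D" "x \<in> sec F c" "y \<in> sec F c" "app i c x = app i c y" for c x y
    proof -
      have "(Id D c, x) \<in> sing c y"
        using Id_sing[of c x] app_i[of c x] app_i[of c y] that by simp
      then show ?thesis
        using that res_Id[OF F] by (simp add: sing_def)
    qed
    show "{} \<in> J c" if "is_sheaf D J G" "c \<in> Ob D" "x \<in> sec F c" "y \<in> sec G c"
      "app i c x = app (z G) c y" for G c x y
    proof -
      have "(Id D c, x) \<in> emp c"
        using Id_sing[of c x] app_i[of c x] app_z[of c y G] that by simp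
      then show ?thesis
        using that by (simp add: emp_def)
    qed
  qed
qed

text \<open>For \<open>x = y\<close> this says that injections are monic, and for \<open>x \<noteq> y\<close> that summands are disjoint.\<close>

lemma Sh_coproduct_disjoint:
  assumes cop: "is_coproduct (Sh D J) X F S inc" and x: "x \<in> X" and y: "y \<in> X"
    and a: "a \<in> hom (Sh D J) P (F x)" and b: "b \<in> hom (Sh D J) P (F y)"
    and eq: "inc x \<cdot>\<^bsub>Sh D J\<^esub> a = inc y \<cdot>\<^bsub>Sh D J\<^esub> b"
  shows "is_initial (Sh D J) P \<or> x = y \<and> a = b"
proof -
  note inc = Sh.coproduct_hom[OF cop]
  obtain Q i z where i: "i \<in> hom (Sh D J) (F x) Q"
    and z: "\<And>G. is_sheaf D J G \<Longrightarrow> z G \<in> hom (Sh D J) G Q"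
    and i_inj: "\<And>c s t. c \<in> Ob D \<Longrightarrow> s \<in> sec (F x) c \<Longrightarrow> t \<in> sec (F x) c \<Longrightarrow>
      app i c s = app i c t \<Longrightarrow> s = t"
    and i_z: "\<And>G c s t. is_sheaf D J G \<Longrightarrow> c \<in> Ob D \<Longrightarrow> s \<in> sec (F x) c \<Longrightarrow> t \<in> sec G c \<Longrightarrow>
      app i c s = app (z G) c t \<Longrightarrow> {} \<in> J c"
    by (rule ex_embedding_with_point[OF Sh_homD(2)[OF a]]) (rule that)
  \<comment> \<open>The embedding on the summand \<open>x\<close> and the point on all others are induced by a map \<open>f\<close>.\<close>
  have "(if w = x then i else z (F w)) \<in> hom (Sh D J) (F w) Q" if "w \<in> X" for w
    using i z[OF Sh_homD(1)[OF inc[OF that]]] by simp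
  then obtain f where f: "f \<in> hom (Sh D J) S Q"
    and f_inc: "\<And>w. w \<in> X \<Longrightarrow> f \<cdot>\<^bsub>Sh D J\<^esub> inc w = (if w = x then i else z (F w))"
    using Sh.coproduct_lift[OF cop Sh.hom_Ob(2)[OF i], of "\<lambda>w. if w = x then i else z (F w)"] by blast
  have app_eq: "app i c (app a c p) = app (if y = x then i else z (F y)) c (app b c p)"
    if cp: "c \<in> Ob D" "p \<in> sec P c" for c p
  proof -
    have "app i c (app a c p) = app (f \<cdot>\<^bsub>Sh D J\<^esub> inc x) c (app a c p)"
      using f_inc[OF x] by simp
    also have "\<dots> = app f c (app (inc x \<cdot>\<^bsub>Sh D J\<^esub> a) c p)"
      using app_comp[OF inc[OF x] f cp(1) Sh_homD(4)[OF a cp]] app_comp[OF a inc[OF x] cp] by simp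
    also have "\<dots> = app f c (app (inc y \<cdot>\<^bsub>Sh D J\<^esub> b) c p)"
      by (simp only: eq)
    also have "\<dots> = app (f \<cdot>\<^bsub>Sh D J\<^esub> inc y) c (app b c p)"
      using app_comp[OF inc[OF y] f cp(1) Sh_homD(4)[OF b cp]] app_comp[OF b inc[OF y] cp] by simp
    finally show ?thesis
      by (simp only: f_inc[OF y])
  qed
  show ?thesis
  proof (cases "y = x")
    case True
    have "a = b"
    proof (rule Sh_eqI[OF a b[unfolded True]])
      fix c p assume cp: "c \<in> Ob D" "p \<in> sec P c"
      show "app a c p = app b c p"
        using i_inj[OF cp(1) Sh_homD(4)[OF a cp] Sh_homD(4)[OF b[unfolded True] cp]] app_eq[OF cp] True
        by simp
    qed
    then show ?thesis
      using True by simp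
  next
    case False
    have "is_initial (Sh D J) P"
    proof (rule is_initial_Sh[OF Sh_homD(1)[OF a]])
      fix c assume c: "c \<in> Ob D" and "sec P c \<noteq> {}"
      then obtain p where "p \<in> sec P c"
        by blast
      note cp = c this
      show "{} \<in> J c"
        using i_z[OF Sh_homD(2)[OF b] c Sh_homD(4)[OF a cp] Sh_homD(4)[OF b cp]] app_eq[OF cp] False
        by simp
    qed
    then show ?thesis ..
  qed
qed

text \<open>A section \<open>s\<close> of the coproduct is \<open>good\<close> if \<open>g\<close> and \<open>h\<close> agree on all sections of \<open>Z\<close> that lie over a
  restriction of \<open>s\<close>.  The good sections form a subsheaf \<open>R\<close>.  It contains the image of each summand,
  by the assumption applied to the pullback of \<open>f\<close> and the injection; hence the inclusion of \<open>R\<close> has a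
  right inverse by the universal property, and all sections are good.\<close>

lemma Sh_coproduct_universal:
  assumes cop: "is_coproduct (Sh D J) X F S inc" and f: "f \<in> hom (Sh D J) Z S"
    and g: "g \<in> hom (Sh D J) Z Q" and h: "h \<in> hom (Sh D J) Z Q"
    and agree: "\<And>P q x a. q \<in> hom (Sh D J) P Z \<Longrightarrow> x \<in> X \<Longrightarrow> a \<in> hom (Sh D J) P (F x) \<Longrightarrow>
      f \<cdot>\<^bsub>Sh D J\<^esub> q = inc x \<cdot>\<^bsub>Sh D J\<^esub> a \<Longrightarrow> g \<cdot>\<^bsub>Sh D J\<^esub> q = h \<cdot>\<^bsub>Sh D J\<^esub> q"
  shows "g = h"
proof -
  note inc = Sh.coproduct_hom[OF cop]
  note Z = Sh_homD(1)[OF f] and S = Sh_homD(2)[OF f] and Q = Sh_homD(2)[OF g]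
  define good where "good c s \<longleftrightarrow> (\<forall>k\<in>Ar D. Cod D k = c \<longrightarrow> (\<forall>z\<in>sec Z (Dom D k).
    app f (Dom D k) z = res S k s \<longrightarrow> app g (Dom D k) z = app h (Dom D k) z))" for c s
  have goodD: "app g (Dom D k) z = app h (Dom D k) z"
    if "good c s" "k \<in> Ar D" "Cod D k = c" "z \<in> sec Z (Dom D k)" "app f (Dom D k) z = res S k s"
    for c s k z
    using that unfolding good_def by blast
  have goodI: "good c s"
    if "\<And>k z. k \<in> Ar D \<Longrightarrow> Cod D k = c \<Longrightarrow> z \<in> sec Z (Dom D k) \<Longrightarrow>
      app f (Dom D k) z = res S k s \<Longrightarrow> app g (Dom D k) z = app h (Dom D k) z" for c s
    using that unfolding good_def by blast
  have good_res: "good (Dom D k) (res S k s)"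
    if k: "k \<in> Ar D" and s: "s \<in> sec S (Cod D k)" and good: "good (Cod D k) s" for k s
  proof (rule goodI)
    fix l z assume l: "l \<in> Ar D" "Cod D l = Dom D k" and z: "z \<in> sec Z (Dom D l)"
      and fz: "app f (Dom D l) z = res S l (res S k s)"
    then show "app g (Dom D l) z = app h (Dom D l) z"
      using goodD[OF good, of "k \<cdot>\<^bsub>D\<^esub> l" z] k res_comp[OF S l(1) k l(2) s] by simp
  qed
  have good_local: "good c s"
    if c: "c \<in> Ob D" and T: "T \<in> J c" and s: "s \<in> sec S c" and loc: "\<And>t. t \<in> T \<Longrightarrow> good (Dom D t) (res S t s)"
    for c T s
  proof (rule goodI)
    fix k z assume k: "k \<in> Ar D" "Cod D k = c" and z: "z \<in> sec Z (Dom D k)"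
      and fz: "app f (Dom D k) z = res S k s"
    have cov: "pull_sieve D k T \<in> J (Dom D k)"
      using cover_pull k T by simp
    show "app g (Dom D k) z = app h (Dom D k) z"
    proof (rule sheaf_on_eqI[OF sheaf_sheaf_on[OF Q] Ar_Ob(1)[OF k(1)] cov])
      show "app g (Dom D k) z \<in> sec Q (Dom D k)" "app h (Dom D k) z \<in> sec Q (Dom D k)"
        using Sh_homD(4)[OF g _ z] Sh_homD(4)[OF h _ z] k by simp_all
      fix l assume "l \<in> pull_sieve D k T"
      then have l: "l \<in> Ar D" "Cod D l = Dom D k" and kl: "k \<cdot>\<^bsub>D\<^esub> l \<in> T"
        by (auto simp: pull_sieve_def)
      have z': "z \<in> sec Z (Cod D l)"
        using z l by simp
      have "app f (Dom D l) (res Z l z) = res S (k \<cdot>\<^bsub>D\<^esub> l) s"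
        using Sh_homD(5)[OF f l(1) z'] fz l(2) res_comp[OF S l(1) k(1) l(2), of s] s k(2) by simp
      moreover have "res S (k \<cdot>\<^bsub>D\<^esub> l) s \<in> sec S (Dom D l)"
        using res_sec[OF S, of "k \<cdot>\<^bsub>D\<^esub> l" s] k l s by simp
      ultimately have "app g (Dom D l) (res Z l z) = app h (Dom D l) (res Z l z)"
        using goodD[OF loc[OF kl], of "Id D (Dom D l)" "res Z l z"] k l res_sec[OF Z l(1) z'] res_Id[OF S]
        by simp
      then show "res Q l (app g (Dom D k) z) = res Q l (app h (Dom D k) z)"
        using Sh_homD(5)[OF g l(1) z'] Sh_homD(5)[OF h l(1) z'] l(2) by simp
    qed
  qed
  define R where "R = \<lparr>sec = \<lambda>c. {s \<in> sec S c. good c s}, res = res S\<rparr>"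
  have R_sec: "s \<in> sec R c \<longleftrightarrow> s \<in> sec S c \<and> good c s" for s c
    by (simp add: R_def)
  have R_res: "res R = res S"
    by (simp add: R_def)
  have "sheaf_on (sec R) (res R)"
    unfolding R_res
  proof (rule sheaf_onI)
    fix c T y z assume "c \<in> Ob D" "T \<in> J c" "y \<in> sec R c" "z \<in> sec R c"
      "\<And>t. t \<in> T \<Longrightarrow> res S t y = res S t z"
    then show "y = z"
      using sheaf_on_eqI[OF sheaf_sheaf_on[OF S], of c T y z] by (simp add: R_sec)
  next
    fix c T x assume c: "c \<in> Ob D" and T: "T \<in> J c" and x: "\<And>t. t \<in> T \<Longrightarrow> x t \<in> sec R (Dom D t)"
      and match: "\<And>t g. t \<in> T \<Longrightarrow> g \<in> Ar D \<Longrightarrow> Cod D g = Dom D t \<Longrightarrow> x (t \<cdot>\<^bsub>D\<^esub> g) = res S g (x t)"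
    have "x t \<in> sec S (Dom D t)" if "t \<in> T" for t
      using x[OF that] by (simp add: R_sec)
    then obtain y where y: "y \<in> sec S c" "\<And>t. t \<in> T \<Longrightarrow> res S t y = x t"
      using sheaf_on_glue[OF sheaf_sheaf_on[OF S] c T _ match] by blast
    then have "good c y"
      using x by (intro good_local[OF c T]) (auto simp: R_sec)
    then show "\<exists>y\<in>sec R c. \<forall>t\<in>T. res S t y = x t"
      using y by (intro bexI[of _ y]) (auto simp: R_sec)
  qed (use res_sec[OF S] res_Id[OF S] res_comp[OF S] good_res in \<open>auto simp: R_sec\<close>)
  moreover have "small TYPE('u) (sec R c)" if "c \<in> Ob D" for c
  proof (rule small_subset)
    show "small TYPE('u) (sec S c)"
      using S that by (simp add: is_sheaf_iff)
    show "sec R c \<subseteq> sec S c"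
      by (auto simp: R_sec)
  qed
  ultimately have R: "is_sheaf D J R"
    by (simp add: is_sheaf_iff)
  define m where "m = nat_arr R (\<lambda>c s. s) S"
  have m: "m \<in> hom (Sh D J) R S"
    unfolding m_def by (rule nat_arr_hom[OF R S]) (simp_all add: R_sec R_res)
  have app_m: "app m c s = s" if "c \<in> Ob D" "s \<in> sec R c" for c s
    using that by (simp add: m_def app_nat_arr)
  have good_inc: "good c (app (inc x) c s)" if x: "x \<in> X" and c: "c \<in> Ob D" and s: "s \<in> sec (F x) c" for x c s
  proof (rule goodI)
    fix k z assume k: "k \<in> Ar D" "Cod D k = c" and z: "z \<in> sec Z (Dom D k)"
      and fz: "app f (Dom D k) z = res S k (app (inc x) c s)"
    \<comment> \<open>The section \<open>z\<close> and the restriction of \<open>s\<close> give a section of the pullback.\<close>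
    define B where "B n = (if n = (0::nat) then Z else F x)" for n
    have diag: "is_diagram (Sh D J) {0, 1} B {(0, f, 1, inc x)}"
      using Z inc[OF x] f Sh_homD(1)[OF inc[OF x]] by (auto simp: is_diagram_def B_def)
    show "app g (Dom D k) z = app h (Dom D k) z"
    proof (rule Sh_limit[OF small_finite[OF univ] diag])
      fix P p assume lim: "is_limit (Sh D J) {0, 1} B {(0, f, 1, inc x)} P p"
        and pts: "\<And>c t. c \<in> Ob D \<Longrightarrow> (\<And>n. n \<in> {0, 1} \<Longrightarrow> t n \<in> sec (B n) c) \<Longrightarrow>
          (\<And>x' a y b. (x', a, y, b) \<in> {(0, f, 1, inc x)} \<Longrightarrow> app a c (t x') = app b c (t y)) \<Longrightarrow>
          \<exists>w\<in>sec P c. \<forall>n\<in>{0, 1}. app (p n) c w = t n"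
      have p0: "p 0 \<in> hom (Sh D J) P Z" and p1: "p 1 \<in> hom (Sh D J) P (F x)"
        using Sh.limit_hom[OF lim, of 0] Sh.limit_hom[OF lim, of 1] by (simp_all add: B_def)
      have eq: "g \<cdot>\<^bsub>Sh D J\<^esub> p 0 = h \<cdot>\<^bsub>Sh D J\<^esub> p 0"
        by (rule agree[OF p0 x p1]) (rule is_coneD(3)[OF limit_cone[OF lim]], simp)
      have s': "s \<in> sec (F x) (Cod D k)"
        using s k by simp
      have "\<exists>w\<in>sec P (Dom D k). \<forall>n\<in>{0, 1}. app (p n) (Dom D k) w = (if n = 0 then z else res (F x) k s)"
        using k z fz Sh_homD(5)[OF inc[OF x] k(1) s'] res_sec[OF Sh_homD(1)[OF inc[OF x]] k(1) s']
        by (intro pts) (auto simp: B_def)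
      then obtain w where w: "w \<in> sec P (Dom D k)" "app (p 0) (Dom D k) w = z"
        by auto
      show ?thesis
        using app_comp[OF p0 g _ w(1)] app_comp[OF p0 h _ w(1)] eq w(2) k by simp
    qed simp
  qed
  have inc_R: "nat_arr (F x) (app (inc x)) R \<in> hom (Sh D J) (F x) R" if x: "x \<in> X" for x
    by (rule nat_arr_hom[OF Sh_homD(1)[OF inc[OF x]] R])
      (simp_all add: R_sec R_res good_inc[OF x] Sh_homD(4,5)[OF inc[OF x]])
  have R_Ob: "R \<in> Ob (Sh D J)"
    using R by simp
  obtain r where r: "r \<in> hom (Sh D J) S R"
    and r_inc: "\<And>x. x \<in> X \<Longrightarrow> r \<cdot>\<^bsub>Sh D J\<^esub> inc x = nat_arr (F x) (app (inc x)) R"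
    by (rule Sh.coproduct_lift[OF cop R_Ob inc_R]) (assumption, rule that)
  have mr: "m \<cdot>\<^bsub>Sh D J\<^esub> r \<in> hom (Sh D J) S S"
    using Sh_comp_hom[OF r m] .
  have "m \<cdot>\<^bsub>Sh D J\<^esub> r = Id (Sh D J) S"
  proof (rule Sh.coproduct_eqI[OF cop mr Id_Sh_hom[OF S]])
    fix x assume x: "x \<in> X"
    show "(m \<cdot>\<^bsub>Sh D J\<^esub> r) \<cdot>\<^bsub>Sh D J\<^esub> inc x = Id (Sh D J) S \<cdot>\<^bsub>Sh D J\<^esub> inc x"
    proof (rule Sh_eqI[OF Sh_comp_hom[OF inc[OF x] mr] Sh_comp_hom[OF inc[OF x] Id_Sh_hom[OF S]]])
      fix c s assume cs: "c \<in> Ob D" "s \<in> sec (F x) c"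
      note inc_s = Sh_homD(4)[OF inc[OF x] cs]
      have "app r c (app (inc x) c s) = app (inc x) c s"
        using app_comp[OF inc[OF x] r cs] r_inc[OF x] app_nat_arr[OF cs] by simp
      then show "app ((m \<cdot>\<^bsub>Sh D J\<^esub> r) \<cdot>\<^bsub>Sh D J\<^esub> inc x) c s = app (Id (Sh D J) S \<cdot>\<^bsub>Sh D J\<^esub> inc x) c s"
        using app_comp[OF inc[OF x] mr cs] app_comp[OF inc[OF x] Id_Sh_hom[OF S] cs]
          app_comp[OF r m cs(1) inc_s] app_Id[OF cs(1) inc_s] app_m[OF cs(1)] good_inc[OF x cs] inc_s
        by (simp add: R_sec)
    qed
  qed
  then have good: "good c s" if cs: "c \<in> Ob D" "s \<in> sec S c" for c s
    using app_comp[OF r m cs] app_Id[OF cs] app_m[OF cs(1) Sh_homD(4)[OF r cs]] Sh_homD(4)[OF r cs]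
    by (simp add: R_sec)
  show "g = h"
  proof (rule Sh_eqI[OF g h])
    fix c z assume cz: "c \<in> Ob D" "z \<in> sec Z c"
    note fz = Sh_homD(4)[OF f cz]
    show "app g c z = app h c z"
      using goodD[OF good[OF cz(1) fz], of "Id D c" z] cz res_Id[OF S cz(1) fz] by simp
  qed
qed

end

section \<open>Limits and coproducts in a Grothendieck topos\<close>

text \<open>A category with an equivalence to the sheaves on a small site.\<close>

locale topos_presentation = cat E + site D J
  for E :: "('o, 'a) category" and D :: "('u, 'u) category" and J +
  fixes \<Phi> :: "'o \<Rightarrow> 'u presheaf" and \<phi> :: "'a \<Rightarrow> 'u presheaf \<times> ('u \<Rightarrow> 'u \<Rightarrow> 'u) \<times> 'u presheaf"
  assumes equivalence: "is_equivalence E (Sh D J) \<Phi> \<phi>"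
begin

lemma \<Phi>_Ob: "A \<in> Ob E \<Longrightarrow> \<Phi> A \<in> Ob (Sh D J)"
  using equivalence[unfolded is_equivalence_def, THEN conjunct1] by blast

lemma \<phi>_comp:
  assumes "g \<in> hom E B C" and "f \<in> hom E A B"
  shows "\<phi> (g \<cdot>\<^bsub>E\<^esub> f) = \<phi> g \<cdot>\<^bsub>Sh D J\<^esub> \<phi> f"
  using equivalence[unfolded is_equivalence_def, THEN conjunct2, THEN conjunct1] assms by blast

lemma \<phi>_bij: "A \<in> Ob E \<Longrightarrow> B \<in> Ob E \<Longrightarrow> bij_betw \<phi> (hom E A B) (hom (Sh D J) (\<Phi> A) (\<Phi> B))"
  using equivalence[unfolded is_equivalence_def, THEN conjunct2, THEN conjunct2, THEN conjunct1]
  by blast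

lemma \<phi>_hom: "f \<in> hom E A B \<Longrightarrow> \<phi> f \<in> hom (Sh D J) (\<Phi> A) (\<Phi> B)"
  using bij_betwE[OF \<phi>_bij] hom_Ob by blast

lemma \<phi>_faithful: "f \<in> hom E A B \<Longrightarrow> g \<in> hom E A B \<Longrightarrow> \<phi> f = \<phi> g \<Longrightarrow> f = g"
  using inj_onD[OF bij_betw_imp_inj_on[OF \<phi>_bij]] hom_Ob by blast

lemma \<phi>_full:
  assumes "m \<in> hom (Sh D J) (\<Phi> A) (\<Phi> B)" and "A \<in> Ob E" and "B \<in> Ob E"
  obtains f where "f \<in> hom E A B" and "\<phi> f = m"
proof -
  have "m \<in> \<phi> ` hom E A B"
    using assms(1) unfolding bij_betw_imp_surj_on[OF \<phi>_bij[OF assms(2,3)]] .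
  then show ?thesis
    by (rule imageE) (rule that, simp_all)
qed

text \<open>Every sheaf \<open>Y\<close> is isomorphic to the image of some \<open>A\<close>; the two last conclusions express that \<open>e\<close>
  and \<open>e'\<close> are inverse to each other in the form in which this is used.\<close>

lemma \<Phi>_iso:
  assumes "Y \<in> Ob (Sh D J)"
  obtains A e e' where "A \<in> Ob E" and "e \<in> hom (Sh D J) (\<Phi> A) Y" and "e' \<in> hom (Sh D J) Y (\<Phi> A)"
    and "\<And>Z m. m \<in> hom (Sh D J) Z (\<Phi> A) \<Longrightarrow> e' \<cdot>\<^bsub>Sh D J\<^esub> (e \<cdot>\<^bsub>Sh D J\<^esub> m) = m"
    and "\<And>Z m. m \<in> hom (Sh D J) Z Y \<Longrightarrow> e \<cdot>\<^bsub>Sh D J\<^esub> (e' \<cdot>\<^bsub>Sh D J\<^esub> m) = m"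
proof -
  obtain A e where A: "A \<in> Ob E" and "is_iso (Sh D J) (\<Phi> A) Y e"
    using equivalence[unfolded is_equivalence_def, THEN conjunct2, THEN conjunct2, THEN conjunct2] assms
    by blast
  then obtain e' where e: "e \<in> hom (Sh D J) (\<Phi> A) Y" and e': "e' \<in> hom (Sh D J) Y (\<Phi> A)"
    and ids: "e' \<cdot>\<^bsub>Sh D J\<^esub> e = Id (Sh D J) (\<Phi> A)" "e \<cdot>\<^bsub>Sh D J\<^esub> e' = Id (Sh D J) Y"
    unfolding is_iso_def by blast
  show ?thesis
  proof (rule that[OF A e e'])
    show "e' \<cdot>\<^bsub>Sh D J\<^esub> (e \<cdot>\<^bsub>Sh D J\<^esub> m) = m" if "m \<in> hom (Sh D J) Z (\<Phi> A)" for Z m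
      using Sh.comp_assoc[OF e' e that] Sh.Id_comp[OF that] ids by simp
    show "e \<cdot>\<^bsub>Sh D J\<^esub> (e' \<cdot>\<^bsub>Sh D J\<^esub> m) = m" if "m \<in> hom (Sh D J) Z Y" for Z m
      using Sh.comp_assoc[OF e e' that] Sh.Id_comp[OF that] ids by simp
  qed
qed

lemma \<Phi>_reflects_initial:
  assumes P: "P \<in> Ob E" and init: "is_initial (Sh D J) (\<Phi> P)"
  shows "is_initial E P"
  unfolding is_initial_def
proof (intro conjI ballI)
  fix A assume A: "A \<in> Ob E"
  have ex1: "\<exists>!m. m \<in> hom (Sh D J) (\<Phi> P) (\<Phi> A)"
    using init \<Phi>_Ob[OF A] unfolding is_initial_def by blast
  then obtain m where "m \<in> hom (Sh D J) (\<Phi> P) (\<Phi> A)"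
    by blast
  then obtain f where f: "f \<in> hom E P A"
    using \<phi>_full P A by blast
  have "g = f" if "g \<in> hom E P A" for g
    using \<phi>_faithful[OF that f] \<phi>_hom[OF that] \<phi>_hom[OF f] ex1 by blast
  then show "\<exists>!f. f \<in> hom E P A"
    using f by blast
qed (rule P)

lemma \<Phi>_coproduct:
  assumes cop: "is_coproduct E X F S inc"
  shows "is_coproduct (Sh D J) X (\<lambda>x. \<Phi> (F x)) (\<Phi> S) (\<lambda>x. \<phi> (inc x))"
  unfolding is_coproduct_def
proof (intro conjI ballI allI impI)
  note inc = coproduct_hom[OF cop]
  have S: "S \<in> Ob E"
    using cop unfolding is_coproduct_def by blast
  show "\<Phi> S \<in> Ob (Sh D J)"
    by (rule \<Phi>_Ob[OF S])
  show "\<phi> (inc x) \<in> hom (Sh D J) (\<Phi> (F x)) (\<Phi> S)" if "x \<in> X" for x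
    by (rule \<phi>_hom[OF inc[OF that]])
  fix Q q assume Q: "Q \<in> Ob (Sh D J)" and "\<forall>x\<in>X. q x \<in> hom (Sh D J) (\<Phi> (F x)) Q"
  then have q: "q x \<in> hom (Sh D J) (\<Phi> (F x)) Q" if "x \<in> X" for x
    using that by blast
  obtain A e e' where A: "A \<in> Ob E" and e: "e \<in> hom (Sh D J) (\<Phi> A) Q"
    and e': "e' \<in> hom (Sh D J) Q (\<Phi> A)"
    and e'e: "\<And>Z m. m \<in> hom (Sh D J) Z (\<Phi> A) \<Longrightarrow> e' \<cdot>\<^bsub>Sh D J\<^esub> (e \<cdot>\<^bsub>Sh D J\<^esub> m) = m"
    and ee': "\<And>Z m. m \<in> hom (Sh D J) Z Q \<Longrightarrow> e \<cdot>\<^bsub>Sh D J\<^esub> (e' \<cdot>\<^bsub>Sh D J\<^esub> m) = m"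
    by (rule \<Phi>_iso[OF Q]) (rule that)
  have "\<forall>x\<in>X. \<exists>k. k \<in> hom E (F x) A \<and> \<phi> k = e' \<cdot>\<^bsub>Sh D J\<^esub> q x"
  proof
    fix x assume x: "x \<in> X"
    show "\<exists>k. k \<in> hom E (F x) A \<and> \<phi> k = e' \<cdot>\<^bsub>Sh D J\<^esub> q x"
      by (rule \<phi>_full[OF Sh.comp_hom[OF e' q[OF x]] hom_Ob(1)[OF inc[OF x]] A]) blast
  qed
  then obtain q' where q': "\<And>x. x \<in> X \<Longrightarrow> q' x \<in> hom E (F x) A"
    and \<phi>_q': "\<And>x. x \<in> X \<Longrightarrow> \<phi> (q' x) = e' \<cdot>\<^bsub>Sh D J\<^esub> q x"
    by (auto dest!: bchoice)
  obtain f where f: "f \<in> hom E S A" and f_inc: "\<And>x. x \<in> X \<Longrightarrow> f \<cdot>\<^bsub>E\<^esub> inc x = q' x"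
    by (rule coproduct_lift[OF cop A q']) (assumption, rule that)
  show "\<exists>!k. k \<in> hom (Sh D J) (\<Phi> S) Q \<and> (\<forall>x\<in>X. k \<cdot>\<^bsub>Sh D J\<^esub> \<phi> (inc x) = q x)"
  proof (rule ex1I, intro conjI ballI)
    show "e \<cdot>\<^bsub>Sh D J\<^esub> \<phi> f \<in> hom (Sh D J) (\<Phi> S) Q"
      by (rule Sh.comp_hom[OF e \<phi>_hom[OF f]])
    show "(e \<cdot>\<^bsub>Sh D J\<^esub> \<phi> f) \<cdot>\<^bsub>Sh D J\<^esub> \<phi> (inc x) = q x" if x: "x \<in> X" for x
      using Sh.comp_assoc[OF e \<phi>_hom[OF f] \<phi>_hom[OF inc[OF x]]] \<phi>_comp[OF f inc[OF x]]
        f_inc[OF x] \<phi>_q'[OF x] ee'[OF q[OF x]] by simp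
    fix k assume "k \<in> hom (Sh D J) (\<Phi> S) Q \<and> (\<forall>x\<in>X. k \<cdot>\<^bsub>Sh D J\<^esub> \<phi> (inc x) = q x)"
    then have k: "k \<in> hom (Sh D J) (\<Phi> S) Q" and k_inc: "\<And>x. x \<in> X \<Longrightarrow> k \<cdot>\<^bsub>Sh D J\<^esub> \<phi> (inc x) = q x"
      by blast+
    obtain k' where k': "k' \<in> hom E S A" and \<phi>_k': "\<phi> k' = e' \<cdot>\<^bsub>Sh D J\<^esub> k"
      by (rule \<phi>_full[OF Sh.comp_hom[OF e' k] S A])
    have "k' = f"
    proof (rule coproduct_eqI[OF cop k' f])
      fix x assume x: "x \<in> X"
      show "k' \<cdot>\<^bsub>E\<^esub> inc x = f \<cdot>\<^bsub>E\<^esub> inc x"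
        using \<phi>_faithful[OF comp_hom[OF k' inc[OF x]] q'[OF x]] \<phi>_comp[OF k' inc[OF x]] \<phi>_k'
          Sh.comp_assoc[OF e' k \<phi>_hom[OF inc[OF x]]] k_inc[OF x] \<phi>_q'[OF x] f_inc[OF x] by simp
    qed
    then show "k = e \<cdot>\<^bsub>Sh D J\<^esub> \<phi> f"
      using ee'[OF k] \<phi>_k' by simp
  qed
qed

lemma ex_limit:
  fixes X :: "'x set"
  assumes X: "finite X" and diag: "is_diagram E X F R"
  shows "\<exists>P p. is_limit E X F R P p"
proof -
  define R' where "R' = {(x, \<phi> a, y, \<phi> b) | x a y b. (x, a, y, b) \<in> R}"
  have R'I: "(x, \<phi> a, y, \<phi> b) \<in> R'" if "(x, a, y, b) \<in> R" for x a y b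
    using that unfolding R'_def by blast
  have R'E: thesis if "(x, m, y, n) \<in> R'" "\<And>a b. m = \<phi> a \<Longrightarrow> n = \<phi> b \<Longrightarrow> (x, a, y, b) \<in> R \<Longrightarrow> thesis"
    for x m y n thesis
    using that unfolding R'_def by blast
  have F: "F x \<in> Ob E" if "x \<in> X" for x
    using diag that by (simp add: is_diagram_def)
  have diag': "is_diagram (Sh D J) X (\<lambda>x. \<Phi> (F x)) R'"
    unfolding is_diagram_def
  proof (intro conjI ballI)
    show "\<Phi> (F x) \<in> Ob (Sh D J)" if "x \<in> X" for x
      by (rule \<Phi>_Ob[OF F[OF that]])
    fix r assume "r \<in> R'"
    then obtain x a y b where r: "r = (x, \<phi> a, y, \<phi> b)" and R: "(x, a, y, b) \<in> R"
      unfolding R'_def by blast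
    obtain B where "x \<in> X" "y \<in> X" "a \<in> hom E (F x) B" "b \<in> hom E (F y) B"
      by (rule is_diagramD[OF diag R])
    then show "case r of (x, a, y, b) \<Rightarrow> x \<in> X \<and> y \<in> X \<and>
        (\<exists>B. a \<in> hom (Sh D J) (\<Phi> (F x)) B \<and> b \<in> hom (Sh D J) (\<Phi> (F y)) B)"
      unfolding r prod.case using \<phi>_hom by blast
  qed
  obtain L p where lim: "is_limit (Sh D J) X (\<lambda>x. \<Phi> (F x)) R' L p"
    by (rule Sh_limit[OF small_finite[OF univ X] diag'])
  note p = Sh.limit_hom[OF lim]
  have L: "L \<in> Ob (Sh D J)"
    by (rule is_coneD(1)[OF limit_cone[OF lim]])
  obtain A e e' where A: "A \<in> Ob E" and e: "e \<in> hom (Sh D J) (\<Phi> A) L"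
    and e': "e' \<in> hom (Sh D J) L (\<Phi> A)"
    and e'e: "\<And>Z m. m \<in> hom (Sh D J) Z (\<Phi> A) \<Longrightarrow> e' \<cdot>\<^bsub>Sh D J\<^esub> (e \<cdot>\<^bsub>Sh D J\<^esub> m) = m"
    and ee': "\<And>Z m. m \<in> hom (Sh D J) Z L \<Longrightarrow> e \<cdot>\<^bsub>Sh D J\<^esub> (e' \<cdot>\<^bsub>Sh D J\<^esub> m) = m"
    by (rule \<Phi>_iso[OF L]) (rule that)
  have "\<forall>x\<in>X. \<exists>k. k \<in> hom E A (F x) \<and> \<phi> k = p x \<cdot>\<^bsub>Sh D J\<^esub> e"
  proof
    fix x assume x: "x \<in> X"
    show "\<exists>k. k \<in> hom E A (F x) \<and> \<phi> k = p x \<cdot>\<^bsub>Sh D J\<^esub> e"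
      by (rule \<phi>_full[OF Sh.comp_hom[OF p[OF x] e] A F[OF x]]) blast
  qed
  then obtain p' where p': "\<And>x. x \<in> X \<Longrightarrow> p' x \<in> hom E A (F x)"
    and \<phi>_p': "\<And>x. x \<in> X \<Longrightarrow> \<phi> (p' x) = p x \<cdot>\<^bsub>Sh D J\<^esub> e"
    by (auto dest!: bchoice)
  have "is_limit E X F R A p'"
    unfolding is_limit_def
  proof (intro conjI allI impI)
    show "is_cone E X F R A p'"
    proof (rule is_coneI[OF A p'])
      fix x a y b assume R: "(x, a, y, b) \<in> R"
      obtain B where B: "x \<in> X" "y \<in> X" "a \<in> hom E (F x) B" "b \<in> hom E (F y) B"
        by (rule is_diagramD[OF diag R])
      have "\<phi> a \<cdot>\<^bsub>Sh D J\<^esub> (p x \<cdot>\<^bsub>Sh D J\<^esub> e) = \<phi> b \<cdot>\<^bsub>Sh D J\<^esub> (p y \<cdot>\<^bsub>Sh D J\<^esub> e)"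
        using is_coneD(3)[OF Sh.cone_comp[OF diag' limit_cone[OF lim] e] R'I[OF R]] .
      then show "a \<cdot>\<^bsub>E\<^esub> p' x = b \<cdot>\<^bsub>E\<^esub> p' y"
        using \<phi>_faithful[OF comp_hom[OF B(3) p'[OF B(1)]] comp_hom[OF B(4) p'[OF B(2)]]]
          \<phi>_comp[OF B(3) p'[OF B(1)]] \<phi>_comp[OF B(4) p'[OF B(2)]] \<phi>_p'[OF B(1)] \<phi>_p'[OF B(2)]
        by simp
    qed
    fix Q q assume cone: "is_cone E X F R Q q"
    note Q = is_coneD(1)[OF cone] and q = is_coneD(2)[OF cone]
    have cone': "is_cone (Sh D J) X (\<lambda>x. \<Phi> (F x)) R' (\<Phi> Q) (\<lambda>x. \<phi> (q x))"
    proof (rule is_coneI[OF \<Phi>_Ob[OF Q] \<phi>_hom[OF q]])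
      fix x m y n assume "(x, m, y, n) \<in> R'"
      then obtain a b where mn: "m = \<phi> a" "n = \<phi> b" and R: "(x, a, y, b) \<in> R"
        by (rule R'E)
      obtain B where B: "x \<in> X" "y \<in> X" "a \<in> hom E (F x) B" "b \<in> hom E (F y) B"
        by (rule is_diagramD[OF diag R])
      show "m \<cdot>\<^bsub>Sh D J\<^esub> \<phi> (q x) = n \<cdot>\<^bsub>Sh D J\<^esub> \<phi> (q y)"
        using \<phi>_comp[OF B(3) q[OF B(1)]] \<phi>_comp[OF B(4) q[OF B(2)]] is_coneD(3)[OF cone R] mn by simp
    qed
    obtain k where k: "k \<in> hom (Sh D J) (\<Phi> Q) L" and pk: "\<And>x. x \<in> X \<Longrightarrow> p x \<cdot>\<^bsub>Sh D J\<^esub> k = \<phi> (q x)"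
      by (rule Sh.limit_lift[OF lim cone']) (rule that)
    obtain f where f: "f \<in> hom E Q A" and \<phi>_f: "\<phi> f = e' \<cdot>\<^bsub>Sh D J\<^esub> k"
      by (rule \<phi>_full[OF Sh.comp_hom[OF e' k] Q A])
    show "\<exists>!f. f \<in> hom E Q A \<and> (\<forall>x\<in>X. p' x \<cdot>\<^bsub>E\<^esub> f = q x)"
    proof (rule ex1I, intro conjI ballI)
      show "f \<in> hom E Q A"
        by (rule f)
      show "p' x \<cdot>\<^bsub>E\<^esub> f = q x" if x: "x \<in> X" for x
        using \<phi>_faithful[OF comp_hom[OF p'[OF x] f] q[OF x]] \<phi>_comp[OF p'[OF x] f] \<phi>_p'[OF x] \<phi>_f
          Sh.comp_assoc[OF p[OF x] e Sh.comp_hom[OF e' k]] ee'[OF k] pk[OF x] by simp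
      fix g assume "g \<in> hom E Q A \<and> (\<forall>x\<in>X. p' x \<cdot>\<^bsub>E\<^esub> g = q x)"
      then have g: "g \<in> hom E Q A" and p'g: "\<And>x. x \<in> X \<Longrightarrow> p' x \<cdot>\<^bsub>E\<^esub> g = q x"
        by blast+
      have "e \<cdot>\<^bsub>Sh D J\<^esub> \<phi> g = k"
      proof (rule Sh.limit_eqI[OF diag' lim Sh.comp_hom[OF e \<phi>_hom[OF g]] k])
        fix x assume x: "x \<in> X"
        show "p x \<cdot>\<^bsub>Sh D J\<^esub> (e \<cdot>\<^bsub>Sh D J\<^esub> \<phi> g) = p x \<cdot>\<^bsub>Sh D J\<^esub> k"
          using Sh.comp_assoc[OF p[OF x] e \<phi>_hom[OF g]] \<phi>_comp[OF p'[OF x] g] \<phi>_p'[OF x] p'g[OF x]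
            pk[OF x] by simp
      qed
      then show "g = f"
        using \<phi>_faithful[OF g f] e'e[OF \<phi>_hom[OF g]] \<phi>_f by simp
    qed
  qed
  then show ?thesis
    by blast
qed

lemma coproduct_disjoint:
  assumes cop: "is_coproduct E X F S inc" and x: "x \<in> X" and y: "y \<in> X"
    and a: "a \<in> hom E P (F x)" and b: "b \<in> hom E P (F y)" and eq: "inc x \<cdot>\<^bsub>E\<^esub> a = inc y \<cdot>\<^bsub>E\<^esub> b"
  shows "is_initial E P \<or> x = y \<and> a = b"
proof -
  have "\<phi> (inc x) \<cdot>\<^bsub>Sh D J\<^esub> \<phi> a = \<phi> (inc y) \<cdot>\<^bsub>Sh D J\<^esub> \<phi> b"
    using \<phi>_comp[OF coproduct_hom[OF cop x] a] \<phi>_comp[OF coproduct_hom[OF cop y] b] eq by simp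
  then have "is_initial (Sh D J) (\<Phi> P) \<or> x = y \<and> \<phi> a = \<phi> b"
    by (rule Sh_coproduct_disjoint[OF \<Phi>_coproduct[OF cop] x y \<phi>_hom[OF a] \<phi>_hom[OF b]])
  then show ?thesis
  proof
    assume "is_initial (Sh D J) (\<Phi> P)"
    then show ?thesis
      using \<Phi>_reflects_initial[OF hom_Ob(1)[OF a]] by simp
  next
    assume "x = y \<and> \<phi> a = \<phi> b"
    then show ?thesis
      using \<phi>_faithful[OF a, of b] b by simp
  qed
qed

lemma coproduct_universal:
  assumes cop: "is_coproduct E X F S inc" and f: "f \<in> hom E Z S"
    and g: "g \<in> hom E Z Q" and h: "h \<in> hom E Z Q"
    and agree: "\<And>P q x a. q \<in> hom E P Z \<Longrightarrow> x \<in> X \<Longrightarrow> a \<in> hom E P (F x) \<Longrightarrow>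
      f \<cdot>\<^bsub>E\<^esub> q = inc x \<cdot>\<^bsub>E\<^esub> a \<Longrightarrow> g \<cdot>\<^bsub>E\<^esub> q = h \<cdot>\<^bsub>E\<^esub> q"
  shows "g = h"
proof (rule \<phi>_faithful[OF g h])
  show "\<phi> g = \<phi> h"
  proof (rule Sh_coproduct_universal[OF \<Phi>_coproduct[OF cop] \<phi>_hom[OF f] \<phi>_hom[OF g] \<phi>_hom[OF h]])
    fix P q x a assume q: "q \<in> hom (Sh D J) P (\<Phi> Z)" and x: "x \<in> X"
      and a: "a \<in> hom (Sh D J) P (\<Phi> (F x))" and eq: "\<phi> f \<cdot>\<^bsub>Sh D J\<^esub> q = \<phi> (inc x) \<cdot>\<^bsub>Sh D J\<^esub> a"
    note inc = coproduct_hom[OF cop x]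
    obtain A e e' where A: "A \<in> Ob E" and e: "e \<in> hom (Sh D J) (\<Phi> A) P"
      and e': "e' \<in> hom (Sh D J) P (\<Phi> A)"
      and e'e: "\<And>Z m. m \<in> hom (Sh D J) Z (\<Phi> A) \<Longrightarrow> e' \<cdot>\<^bsub>Sh D J\<^esub> (e \<cdot>\<^bsub>Sh D J\<^esub> m) = m"
      and ee': "\<And>Z m. m \<in> hom (Sh D J) Z P \<Longrightarrow> e \<cdot>\<^bsub>Sh D J\<^esub> (e' \<cdot>\<^bsub>Sh D J\<^esub> m) = m"
      by (rule \<Phi>_iso[OF Sh.hom_Ob(1)[OF q]]) (rule that)
    obtain q' where q': "q' \<in> hom E A Z" and \<phi>_q': "\<phi> q' = q \<cdot>\<^bsub>Sh D J\<^esub> e"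
      by (rule \<phi>_full[OF Sh.comp_hom[OF q e] A hom_Ob(1)[OF f]])
    obtain a' where a': "a' \<in> hom E A (F x)" and \<phi>_a': "\<phi> a' = a \<cdot>\<^bsub>Sh D J\<^esub> e"
      by (rule \<phi>_full[OF Sh.comp_hom[OF a e] A hom_Ob(1)[OF inc]])
    have "\<phi> (f \<cdot>\<^bsub>E\<^esub> q') = \<phi> (inc x \<cdot>\<^bsub>E\<^esub> a')"
      using \<phi>_comp[OF f q'] \<phi>_comp[OF inc a'] \<phi>_q' \<phi>_a' eq
        Sh.comp_assoc[OF \<phi>_hom[OF f] q e] Sh.comp_assoc[OF \<phi>_hom[OF inc] a e] by simp
    then have "f \<cdot>\<^bsub>E\<^esub> q' = inc x \<cdot>\<^bsub>E\<^esub> a'"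
      by (rule \<phi>_faithful[OF comp_hom[OF f q'] comp_hom[OF inc a']])
    then have "g \<cdot>\<^bsub>E\<^esub> q' = h \<cdot>\<^bsub>E\<^esub> q'"
      by (rule agree[OF q' x a'])
    then have ge: "(\<phi> g \<cdot>\<^bsub>Sh D J\<^esub> q) \<cdot>\<^bsub>Sh D J\<^esub> e = (\<phi> h \<cdot>\<^bsub>Sh D J\<^esub> q) \<cdot>\<^bsub>Sh D J\<^esub> e"
      using \<phi>_comp[OF g q'] \<phi>_comp[OF h q'] \<phi>_q'
        Sh.comp_assoc[OF \<phi>_hom[OF g] q e] Sh.comp_assoc[OF \<phi>_hom[OF h] q e] by simp
    have "m = (m \<cdot>\<^bsub>Sh D J\<^esub> e) \<cdot>\<^bsub>Sh D J\<^esub> e'" if m: "m \<in> hom (Sh D J) P (\<Phi> Q)" for m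
      using Sh.comp_assoc[OF m e e'] Sh.comp_Id[OF m] Sh.Id_hom[OF Sh.hom_Ob(1)[OF q]]
        ee'[OF Sh.Id_hom[OF Sh.hom_Ob(1)[OF q]]] Sh.comp_Id[OF e'] by simp
    then show "\<phi> g \<cdot>\<^bsub>Sh D J\<^esub> q = \<phi> h \<cdot>\<^bsub>Sh D J\<^esub> q"
      using ge Sh.comp_hom[OF \<phi>_hom[OF g] q] Sh.comp_hom[OF \<phi>_hom[OF h] q] by metis
  qed
qed

text \<open>Universality for finitely many maps to the same coproduct.\<close>

lemma coproduct_universal_finite:
  fixes n :: nat
  assumes cop: "is_coproduct E X F S inc" and p: "\<And>j. j < n \<Longrightarrow> p j \<in> hom E Z S"
    and g: "g \<in> hom E Z Q" and h: "h \<in> hom E Z Q"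
    and agree: "\<And>P q x a. q \<in> hom E P Z \<Longrightarrow>
      (\<And>j. j < n \<Longrightarrow> x j \<in> X \<and> a j \<in> hom E P (F (x j)) \<and> p j \<cdot>\<^bsub>E\<^esub> q = inc (x j) \<cdot>\<^bsub>E\<^esub> a j) \<Longrightarrow>
      g \<cdot>\<^bsub>E\<^esub> q = h \<cdot>\<^bsub>E\<^esub> q"
  shows "g = h"
  using p agree
proof (induction n)
  case 0
  have "g \<cdot>\<^bsub>E\<^esub> Id E Z = h \<cdot>\<^bsub>E\<^esub> Id E Z"
    by (rule 0(2)[OF Id_hom[OF hom_Ob(1)[OF g]]]) simp
  then show ?case
    by (simp add: comp_Id[OF g] comp_Id[OF h])
next
  case (Suc n)
  show ?case
  proof (rule Suc.IH)
    show "p j \<in> hom E Z S" if "j < n" for j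
      using Suc.prems(1) that by simp
    fix P q x a assume q: "q \<in> hom E P Z"
      and xa: "\<And>j. j < n \<Longrightarrow> x j \<in> X \<and> a j \<in> hom E P (F (x j)) \<and> p j \<cdot>\<^bsub>E\<^esub> q = inc (x j) \<cdot>\<^bsub>E\<^esub> a j"
    have pn: "p n \<in> hom E Z S"
      using Suc.prems(1) by simp
    show "g \<cdot>\<^bsub>E\<^esub> q = h \<cdot>\<^bsub>E\<^esub> q"
    proof (rule coproduct_universal[OF cop comp_hom[OF pn q] comp_hom[OF g q] comp_hom[OF h q]])
      fix P' q' y b assume q': "q' \<in> hom E P' P" and y: "y \<in> X" and b: "b \<in> hom E P' (F y)"
        and eq: "(p n \<cdot>\<^bsub>E\<^esub> q) \<cdot>\<^bsub>E\<^esub> q' = inc y \<cdot>\<^bsub>E\<^esub> b"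
      have "g \<cdot>\<^bsub>E\<^esub> (q \<cdot>\<^bsub>E\<^esub> q') = h \<cdot>\<^bsub>E\<^esub> (q \<cdot>\<^bsub>E\<^esub> q')"
      proof (rule Suc.prems(2)[OF comp_hom[OF q q']])
        fix j assume "j < Suc n"
        then consider "j = n" | "j < n" "j \<noteq> n"
          by linarith
        then show "(if j = n then y else x j) \<in> X \<and>
            (if j = n then b else a j \<cdot>\<^bsub>E\<^esub> q') \<in> hom E P' (F (if j = n then y else x j)) \<and>
            p j \<cdot>\<^bsub>E\<^esub> (q \<cdot>\<^bsub>E\<^esub> q') =
              inc (if j = n then y else x j) \<cdot>\<^bsub>E\<^esub> (if j = n then b else a j \<cdot>\<^bsub>E\<^esub> q')"
        proof cases
          case 1
          then show ?thesis
            using y b eq comp_assoc[OF pn q q'] by simp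
        next
          case 2
          note xj = xa[OF 2(1), THEN conjunct1]
            and aj = xa[OF 2(1), THEN conjunct2, THEN conjunct1]
            and pj = xa[OF 2(1), THEN conjunct2, THEN conjunct2]
          have pjZ: "p j \<in> hom E Z S"
            using Suc.prems(1) 2 by simp
          show ?thesis
            using 2(2) xj comp_hom[OF aj q'] comp_assoc[OF pjZ q q'] pj
              comp_assoc[OF coproduct_hom[OF cop xj] aj q'] by simp
        qed
      qed
      then show "(g \<cdot>\<^bsub>E\<^esub> q) \<cdot>\<^bsub>E\<^esub> q' = (h \<cdot>\<^bsub>E\<^esub> q) \<cdot>\<^bsub>E\<^esub> q'"
        by (simp add: comp_assoc[OF g q q'] comp_assoc[OF h q q'])
    qed
  qed
qed

end


section \<open>Simplicial objects of spans\<close>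

text \<open>A simplicial object \<open>H\<close> that is in each degree \<open>n\<close> the coproduct of the top vertices of a set \<open>S n\<close> of
  spans, with faces given by those of spans.  Degeneracies play no role.\<close>

locale span_simplicial = topos_presentation E D J \<Phi> \<phi>
  for E :: "('o, 'a) category" and D :: "('u, 'u) category" and J
    and \<Phi> :: "'o \<Rightarrow> 'u presheaf" and \<phi> :: "'a \<Rightarrow> 'u presheaf \<times> ('u \<Rightarrow> 'u \<Rightarrow> 'u) \<times> 'u presheaf" +
  fixes U :: "'i \<Rightarrow> 'o" and S :: "nat \<Rightarrow> ('i, 'o, 'a) span set"
    and H :: "('o, 'a) simplicial" and inH :: "nat \<Rightarrow> ('i, 'o, 'a) span \<Rightarrow> 'a"
  assumes cop: "is_coproduct E (S n) (top_vertex U) (sob H n) (inH n)"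
    and sface_hom: "i \<le> Suc n \<Longrightarrow> sface H (Suc n) i \<in> hom E (sob H (Suc n)) (sob H n)"
    and sface_inH: "i \<le> Suc n \<Longrightarrow> w \<in> S (Suc n) \<Longrightarrow>
      sface H (Suc n) i \<cdot>\<^bsub>E\<^esub> inH (Suc n) w = inH n (face i w) \<cdot>\<^bsub>E\<^esub> face_arr i w"
    and face_S: "w \<in> S (Suc n) \<Longrightarrow> i \<le> Suc n \<Longrightarrow> face i w \<in> S n"
    and face_arr_hom: "w \<in> S (Suc n) \<Longrightarrow> i \<le> Suc n \<Longrightarrow>
      face_arr i w \<in> hom E (top_vertex U w) (top_vertex U (face i w))"
    and face_face: "w \<in> S (Suc (Suc n)) \<Longrightarrow> i < j \<Longrightarrow> j \<le> Suc (Suc n) \<Longrightarrow>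
      face i (face j w) = face (j - 1) (face i w)"
    and face_arr_face: "w \<in> S (Suc (Suc n)) \<Longrightarrow> i < j \<Longrightarrow> j \<le> Suc (Suc n) \<Longrightarrow>
      face_arr i (face j w) \<cdot>\<^bsub>E\<^esub> face_arr j w = face_arr (j - 1) (face i w) \<cdot>\<^bsub>E\<^esub> face_arr i w"
begin

lemma inH_hom: "w \<in> S n \<Longrightarrow> inH n w \<in> hom E (top_vertex U w) (sob H n)"
  by (rule coproduct_hom[OF cop])

lemma sface_sface:
  assumes ij: "i < j" "j \<le> Suc (Suc n)"
  shows "sface H (Suc n) i \<cdot>\<^bsub>E\<^esub> sface H (Suc (Suc n)) j =
    sface H (Suc n) (j - 1) \<cdot>\<^bsub>E\<^esub> sface H (Suc (Suc n)) i"
proof -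
  have le: "i \<le> Suc n" "j - 1 \<le> Suc n" "i \<le> Suc (Suc n)"
    using ij by auto
  note d = sface_hom[OF le(1)] sface_hom[OF le(2)] sface_hom[OF ij(2)] sface_hom[OF le(3)]
  have *: "(sface H (Suc n) a \<cdot>\<^bsub>E\<^esub> sface H (Suc (Suc n)) b) \<cdot>\<^bsub>E\<^esub> inH (Suc (Suc n)) w =
      inH n (face a (face b w)) \<cdot>\<^bsub>E\<^esub> (face_arr a (face b w) \<cdot>\<^bsub>E\<^esub> face_arr b w)"
    if w: "w \<in> S (Suc (Suc n))" and a: "a \<le> Suc n" and b: "b \<le> Suc (Suc n)" for a b w
  proof -
    note fw = face_S[OF w b]
    have "(sface H (Suc n) a \<cdot>\<^bsub>E\<^esub> sface H (Suc (Suc n)) b) \<cdot>\<^bsub>E\<^esub> inH (Suc (Suc n)) w =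
        (sface H (Suc n) a \<cdot>\<^bsub>E\<^esub> inH (Suc n) (face b w)) \<cdot>\<^bsub>E\<^esub> face_arr b w"
      using comp_assoc[OF sface_hom[OF a] sface_hom[OF b] inH_hom[OF w]] sface_inH[OF b w]
        comp_assoc[OF sface_hom[OF a] inH_hom[OF fw] face_arr_hom[OF w b]] by simp
    then show ?thesis
      using sface_inH[OF a fw]
        comp_assoc[OF inH_hom[OF face_S[OF fw a]] face_arr_hom[OF fw a] face_arr_hom[OF w b]] by simp
  qed
  show ?thesis
  proof (rule coproduct_eqI[OF cop comp_hom[OF d(1,3)] comp_hom[OF d(2,4)]])
    fix w assume w: "w \<in> S (Suc (Suc n))"
    show "(sface H (Suc n) i \<cdot>\<^bsub>E\<^esub> sface H (Suc (Suc n)) j) \<cdot>\<^bsub>E\<^esub> inH (Suc (Suc n)) w =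
        (sface H (Suc n) (j - 1) \<cdot>\<^bsub>E\<^esub> sface H (Suc (Suc n)) i) \<cdot>\<^bsub>E\<^esub> inH (Suc (Suc n)) w"
      using *[OF w le(1) ij(2)] *[OF w le(2,3)] face_face[OF w ij] face_arr_face[OF w ij] by simp
  qed
qed

lemma cosk_relE:
  assumes "(x, a, y, b) \<in> cosk_rel H (Suc n)"
  obtains m where "n = Suc m" and "y < x" and "x \<le> Suc (Suc m)"
    and "a = sface H (Suc m) y" and "b = sface H (Suc m) (x - 1)"
proof -
  have "2 \<le> Suc n" "y < x" "x \<le> Suc n" "a = sface H n y" "b = sface H n (x - 1)"
    using assms by (auto simp: cosk_rel_def)
  then show ?thesis
    using that[of "n - 1"] by (cases n) auto
qed

lemma cosk_diagram: "is_diagram E {..Suc n} (\<lambda>_. sob H n) (cosk_rel H (Suc n))"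
  unfolding is_diagram_def
proof (intro conjI ballI)
  show "sob H n \<in> Ob E"
    by (rule hom_Ob(2)[OF sface_hom[of 0 n]]) simp
  fix r assume r: "r \<in> cosk_rel H (Suc n)"
  obtain x a y b where r': "r = (x, a, y, b)"
    by (cases r)
  obtain m where m: "n = Suc m" "y < x" "x \<le> Suc (Suc m)" "a = sface H (Suc m) y"
      "b = sface H (Suc m) (x - 1)"
    by (rule cosk_relE[OF r[unfolded r']])
  then show "case r of (x, a, y, b) \<Rightarrow> x \<in> {..Suc n} \<and> y \<in> {..Suc n} \<and>
      (\<exists>B. a \<in> hom E (sob H n) B \<and> b \<in> hom E (sob H n) B)"
    using sface_hom[of y m] sface_hom[of "x - 1" m] unfolding r' prod.case by auto
qed

lemma boundary_relE:
  assumes "(x, a, y, b) \<in> boundary_rel (Suc n) ws"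
  obtains m where "n = Suc m" and "y < x" and "x \<le> Suc (Suc m)"
    and "a = face_arr y (ws ! x)" and "b = face_arr (x - 1) (ws ! y)"
proof -
  have "2 \<le> Suc n" "y < x" "x \<le> Suc n" "a = face_arr y (ws ! x)" "b = face_arr (x - 1) (ws ! y)"
    using assms by (auto simp: boundary_rel_def)
  then show ?thesis
    using that[of "n - 1"] by (cases n) auto
qed

lemma boundaryD:
  assumes "is_boundary (S n) (Suc n) ws"
  shows "j \<le> Suc n \<Longrightarrow> ws ! j \<in> S n"
    and "1 \<le> n \<Longrightarrow> i < j \<Longrightarrow> j \<le> Suc n \<Longrightarrow> face i (ws ! j) = face (j - 1) (ws ! i)"
  using assms unfolding is_boundary_def by (auto dest!: nth_mem)

lemma boundary_diagram:
  assumes ws: "is_boundary (S n) (Suc n) ws"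
  shows "is_diagram E {..Suc n} (\<lambda>a. top_vertex U (ws ! a)) (boundary_rel (Suc n) ws)"
  unfolding is_diagram_def
proof (intro conjI ballI)
  show "top_vertex U (ws ! j) \<in> Ob E" if "j \<in> {..Suc n}" for j
    using hom_Ob(1)[OF inH_hom[OF boundaryD(1)[OF ws]]] that by simp
  fix r assume r: "r \<in> boundary_rel (Suc n) ws"
  obtain x a y b where r': "r = (x, a, y, b)"
    by (cases r)
  obtain m where m: "n = Suc m" "y < x" "x \<le> Suc (Suc m)" "a = face_arr y (ws ! x)"
      "b = face_arr (x - 1) (ws ! y)"
    by (rule boundary_relE[OF r[unfolded r']])
  have "ws ! x \<in> S (Suc m)" "ws ! y \<in> S (Suc m)"
    using boundaryD(1)[OF ws] m by simp_all
  then have "a \<in> hom E (top_vertex U (ws ! x)) (top_vertex U (face y (ws ! x)))"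
      "b \<in> hom E (top_vertex U (ws ! y)) (top_vertex U (face (x - 1) (ws ! y)))"
    using face_arr_hom[of "ws ! x" m y] face_arr_hom[of "ws ! y" m "x - 1"] m by auto
  moreover have "face y (ws ! x) = face (x - 1) (ws ! y)"
    using boundaryD(2)[OF ws, of y x] m by simp
  ultimately show "case r of (x, a, y, b) \<Rightarrow> x \<in> {..Suc n} \<and> y \<in> {..Suc n} \<and>
      (\<exists>B. a \<in> hom E (top_vertex U (ws ! x)) B \<and> b \<in> hom E (top_vertex U (ws ! y)) B)"
    using m unfolding r' prod.case by auto
qed

text \<open>The maps to the limit \<open>L\<close> of the boundary \<open>ws\<close>, with projections \<open>l\<close>, which are given by the
  \<open>k\<close>-spans in \<open>S k\<close> with this boundary.\<close>

definition boundary_maps :: "nat \<Rightarrow> ('i, 'o, 'a) span list \<Rightarrow> 'o \<Rightarrow> (nat \<Rightarrow> 'a) \<Rightarrow> 'a set" where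
  "boundary_maps k ws L l = {f. \<exists>w\<in>S k. f \<in> hom E (top_vertex U w) L \<and>
     (\<forall>j\<le>k. face j w = ws ! j \<and> face_arr j w = l j \<cdot>\<^bsub>E\<^esub> f)}"

text \<open>The hypercover condition in degree \<open>n + 1\<close> holds if the limit of each boundary is covered by the
  spans with that boundary.\<close>

proposition cosk_epi_Suc:
  assumes cover: "\<And>ws L l. is_boundary (S n) (Suc n) ws \<Longrightarrow>
    is_limit E {..Suc n} (\<lambda>a. top_vertex U (ws ! a)) (boundary_rel (Suc n) ws) L l \<Longrightarrow>
    nonempty_ob E L \<Longrightarrow> epimorphic E L (boundary_maps (Suc n) ws L l)"
  shows "cosk_epi E H (Suc n)"
proof -
  let ?R = "cosk_rel H (Suc n)"
  obtain K p where lim: "is_limit E {..Suc n} (\<lambda>_. sob H n) ?R K p"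
    using ex_limit[OF _ cosk_diagram, of n] by auto
  have p: "p j \<in> hom E K (sob H n)" if "j \<le> Suc n" for j
    using limit_hom[OF lim, of j] that by simp
  have "is_cone E {..Suc n} (\<lambda>_. sob H n) ?R (sob H (Suc n)) (sface H (Suc n))"
  proof (rule is_coneI)
    show "sob H (Suc n) \<in> Ob E"
      by (rule hom_Ob(1)[OF sface_hom[of 0]]) simp
    show "sface H (Suc n) j \<in> hom E (sob H (Suc n)) (sob H n)" if "j \<in> {..Suc n}" for j
      using sface_hom that by simp
    fix x a y b assume "(x, a, y, b) \<in> ?R"
    then obtain m where "n = Suc m" "y < x" "x \<le> Suc (Suc m)" "a = sface H (Suc m) y"
        "b = sface H (Suc m) (x - 1)"
      by (rule cosk_relE)
    then show "a \<cdot>\<^bsub>E\<^esub> sface H (Suc n) x = b \<cdot>\<^bsub>E\<^esub> sface H (Suc n) y"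
      using sface_sface[of y x m] by simp
  qed
  then obtain \<kappa> where \<kappa>: "\<kappa> \<in> hom E (sob H (Suc n)) K"
    and p\<kappa>: "\<And>j. j \<in> {..Suc n} \<Longrightarrow> p j \<cdot>\<^bsub>E\<^esub> \<kappa> = sface H (Suc n) j"
    by (rule limit_lift[OF lim]) (rule that)
  have "epimorphic E K {\<kappa>}"
    unfolding epimorphic_def
  proof (intro allI ballI impI)
    fix Q g h assume g: "g \<in> hom E K Q" and h: "h \<in> hom E K Q"
      and "\<forall>f\<in>{\<kappa>}. g \<cdot>\<^bsub>E\<^esub> f = h \<cdot>\<^bsub>E\<^esub> f"
    then have g\<kappa>: "g \<cdot>\<^bsub>E\<^esub> \<kappa> = h \<cdot>\<^bsub>E\<^esub> \<kappa>"
      by simp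
    have p': "p j \<in> hom E K (sob H n)" if "j < Suc (Suc n)" for j
      using p that by simp
    \<comment> \<open>It suffices to test on maps \<open>q\<close> whose component \<open>j\<close> factors as \<open>a j\<close> followed by the injection
      of a span \<open>w j\<close>.\<close>
    show "g = h"
    proof (rule coproduct_universal_finite[OF cop p' g h])
      fix P q w a assume q: "q \<in> hom E P K" and wa: "\<And>j. j < Suc (Suc n) \<Longrightarrow>
        w j \<in> S n \<and> a j \<in> hom E P (top_vertex U (w j)) \<and> p j \<cdot>\<^bsub>E\<^esub> q = inH n (w j) \<cdot>\<^bsub>E\<^esub> a j"
      have w: "w j \<in> S n" and a: "a j \<in> hom E P (top_vertex U (w j))"
        and pq: "p j \<cdot>\<^bsub>E\<^esub> q = inH n (w j) \<cdot>\<^bsub>E\<^esub> a j" if "j \<le> Suc n" for j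
        using wa[of j] that by simp_all
      show "g \<cdot>\<^bsub>E\<^esub> q = h \<cdot>\<^bsub>E\<^esub> q"
      proof (cases "is_initial E P")
        case True
        then have "\<exists>!f. f \<in> hom E P Q"
          using hom_Ob(2)[OF g] unfolding is_initial_def by blast
        then show ?thesis
          using comp_hom[OF g q] comp_hom[OF h q] by blast
      next
        case False
        \<comment> \<open>Both sides of the relation on \<open>K\<close> land in summands of the coproduct one degree lower.\<close>
        have matching: "face i (w j) = face (j - 1) (w i) \<and>
            face_arr i (w j) \<cdot>\<^bsub>E\<^esub> a j = face_arr (j - 1) (w i) \<cdot>\<^bsub>E\<^esub> a i"
          if n: "n = Suc m" and ij: "i < j" "j \<le> Suc (Suc m)" for m i j
        proof -
          have le: "j \<le> Suc n" "i \<le> Suc n" "i \<le> Suc m" "j - 1 \<le> Suc m"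
            using n ij by auto
          have wm: "w j \<in> S (Suc m)" "w i \<in> S (Suc m)"
            using w[OF le(1)] w[OF le(2)] n by simp_all
          have face_q: "(sface H (Suc m) b \<cdot>\<^bsub>E\<^esub> p x) \<cdot>\<^bsub>E\<^esub> q =
              inH m (face b (w x)) \<cdot>\<^bsub>E\<^esub> (face_arr b (w x) \<cdot>\<^bsub>E\<^esub> a x)"
            if x: "x \<le> Suc n" and b: "b \<le> Suc m" and wx: "w x \<in> S (Suc m)" for b x
          proof -
            note d = sface_hom[OF b]
            have "(sface H (Suc m) b \<cdot>\<^bsub>E\<^esub> p x) \<cdot>\<^bsub>E\<^esub> q = sface H (Suc m) b \<cdot>\<^bsub>E\<^esub> (inH (Suc m) (w x) \<cdot>\<^bsub>E\<^esub> a x)"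
              using comp_assoc[OF d _ q, of "p x"] p[OF x] pq[OF x] n by simp
            also have "\<dots> = (inH m (face b (w x)) \<cdot>\<^bsub>E\<^esub> face_arr b (w x)) \<cdot>\<^bsub>E\<^esub> a x"
              using comp_assoc[OF d inH_hom[OF wx] a[OF x]] sface_inH[OF b wx] by simp
            also have "\<dots> = inH m (face b (w x)) \<cdot>\<^bsub>E\<^esub> (face_arr b (w x) \<cdot>\<^bsub>E\<^esub> a x)"
              by (rule comp_assoc[OF inH_hom[OF face_S[OF wx b]] face_arr_hom[OF wx b] a[OF x]])
            finally show ?thesis .
          qed
          have "(j, sface H (Suc m) i, i, sface H (Suc m) (j - 1)) \<in> ?R"
            unfolding cosk_rel_def mem_Collect_eq using n ij by (intro exI[of _ i] exI[of _ j]) auto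
          then have "sface H (Suc m) i \<cdot>\<^bsub>E\<^esub> p j = sface H (Suc m) (j - 1) \<cdot>\<^bsub>E\<^esub> p i"
            by (rule is_coneD(3)[OF limit_cone[OF lim]])
          then have "inH m (face i (w j)) \<cdot>\<^bsub>E\<^esub> (face_arr i (w j) \<cdot>\<^bsub>E\<^esub> a j) =
              inH m (face (j - 1) (w i)) \<cdot>\<^bsub>E\<^esub> (face_arr (j - 1) (w i) \<cdot>\<^bsub>E\<^esub> a i)"
            using face_q[OF le(1,3) wm(1)] face_q[OF le(2,4) wm(2)] by simp
          then show ?thesis
            using coproduct_disjoint[OF cop face_S[OF wm(1) le(3)] face_S[OF wm(2) le(4)]
              comp_hom[OF face_arr_hom[OF wm(1) le(3)] a[OF le(1)]]
              comp_hom[OF face_arr_hom[OF wm(2) le(4)] a[OF le(2)]]] False by blast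
        qed
        define ws where "ws = map w [0..<Suc (Suc n)]"
        have ws_nth: "ws ! j = w j" if "j \<le> Suc n" for j
          using that by (simp add: ws_def del: upt_Suc)
        have ws: "is_boundary (S n) (Suc n) ws"
          unfolding is_boundary_def
        proof (intro conjI impI allI)
          show "length ws = Suc n + 1"
            by (simp add: ws_def)
          show "set ws \<subseteq> S n"
            using w by (auto simp: ws_def)
          fix j i assume "2 \<le> Suc n" "j \<le> Suc n" "i < j"
          then show "face i (ws ! j) = face (j - 1) (ws ! i)"
            using matching[of "n - 1" i j] ws_nth by simp
        qed
        note diag = boundary_diagram[OF ws]
        obtain L l where L: "is_limit E {..Suc n} (\<lambda>a. top_vertex U (ws ! a)) (boundary_rel (Suc n) ws) L l"
          using ex_limit[OF _ diag] by auto
        have l: "l j \<in> hom E L (top_vertex U (w j))" if "j \<le> Suc n" for j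
          using limit_hom[OF L, of j] ws_nth that by simp
        have "is_cone E {..Suc n} (\<lambda>a. top_vertex U (ws ! a)) (boundary_rel (Suc n) ws) P a"
        proof (rule is_coneI)
          show "P \<in> Ob E"
            by (rule hom_Ob(1)[OF q])
          show "a j \<in> hom E P (top_vertex U (ws ! j))" if "j \<in> {..Suc n}" for j
            using a ws_nth that by simp
          fix x b y d assume "(x, b, y, d) \<in> boundary_rel (Suc n) ws"
          then obtain m where "n = Suc m" "y < x" "x \<le> Suc (Suc m)" "b = face_arr y (ws ! x)"
              "d = face_arr (x - 1) (ws ! y)"
            by (rule boundary_relE)
          then show "b \<cdot>\<^bsub>E\<^esub> a x = d \<cdot>\<^bsub>E\<^esub> a y"
            using matching[of m y x] ws_nth by simp
        qed
        then obtain q1 where q1: "q1 \<in> hom E P L" and lq1: "\<And>j. j \<in> {..Suc n} \<Longrightarrow> l j \<cdot>\<^bsub>E\<^esub> q1 = a j"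
          by (rule limit_lift[OF L]) (rule that)
        have "is_cone E {..Suc n} (\<lambda>_. sob H n) ?R L (\<lambda>j. inH n (w j) \<cdot>\<^bsub>E\<^esub> l j)"
        proof (rule is_coneI)
          show "L \<in> Ob E"
            by (rule hom_Ob(2)[OF q1])
          show "inH n (w j) \<cdot>\<^bsub>E\<^esub> l j \<in> hom E L (sob H n)" if "j \<in> {..Suc n}" for j
            using comp_hom[OF inH_hom[OF w] l] that by simp
          fix x b y d assume "(x, b, y, d) \<in> ?R"
          then obtain m where n: "n = Suc m" and yx: "y < x" "x \<le> Suc (Suc m)"
            and bd: "b = sface H (Suc m) y" "d = sface H (Suc m) (x - 1)"
            by (rule cosk_relE)
          have face_l: "sface H (Suc m) c \<cdot>\<^bsub>E\<^esub> (inH n (w z) \<cdot>\<^bsub>E\<^esub> l z) =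
              inH m (face c (w z)) \<cdot>\<^bsub>E\<^esub> (face_arr c (w z) \<cdot>\<^bsub>E\<^esub> l z)"
            if z: "z \<le> Suc n" and c: "c \<le> Suc m" for c z
          proof -
            have wz: "w z \<in> S (Suc m)"
              using w[OF z] n by simp
            show ?thesis
              using comp_assoc[OF sface_hom[OF c] inH_hom[OF wz] l[OF z]] sface_inH[OF c wz] n
                comp_assoc[OF inH_hom[OF face_S[OF wz c]] face_arr_hom[OF wz c] l[OF z]] by simp
          qed
          have "(x, face_arr y (ws ! x), y, face_arr (x - 1) (ws ! y)) \<in> boundary_rel (Suc n) ws"
            unfolding boundary_rel_def mem_Collect_eq using n yx by (intro exI[of _ y] exI[of _ x]) auto
          then have "face_arr y (w x) \<cdot>\<^bsub>E\<^esub> l x = face_arr (x - 1) (w y) \<cdot>\<^bsub>E\<^esub> l y"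
            using is_coneD(3)[OF limit_cone[OF L]] ws_nth n yx by simp
          then show "b \<cdot>\<^bsub>E\<^esub> (inH n (w x) \<cdot>\<^bsub>E\<^esub> l x) = d \<cdot>\<^bsub>E\<^esub> (inH n (w y) \<cdot>\<^bsub>E\<^esub> l y)"
            using face_l[of x y] face_l[of y "x - 1"] matching[OF n yx] n yx bd by simp
        qed
        then obtain \<iota> where \<iota>: "\<iota> \<in> hom E L K"
          and p\<iota>: "\<And>j. j \<in> {..Suc n} \<Longrightarrow> p j \<cdot>\<^bsub>E\<^esub> \<iota> = inH n (w j) \<cdot>\<^bsub>E\<^esub> l j"
          by (rule limit_lift[OF lim]) (rule that)
        have q_eq: "q = \<iota> \<cdot>\<^bsub>E\<^esub> q1"
        proof (rule limit_eqI[OF cosk_diagram lim q comp_hom[OF \<iota> q1]])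
          fix j assume j: "j \<in> {..Suc n}"
          then have j': "j \<le> Suc n"
            by simp
          show "p j \<cdot>\<^bsub>E\<^esub> q = p j \<cdot>\<^bsub>E\<^esub> (\<iota> \<cdot>\<^bsub>E\<^esub> q1)"
            using comp_assoc[OF p[OF j'] \<iota> q1] comp_assoc[OF inH_hom[OF w[OF j']] l[OF j'] q1]
              p\<iota>[OF j] lq1[OF j] pq[OF j'] by simp
        qed
        \<comment> \<open>The assumption covers only limits that are not initial; maps out of an initial \<open>L\<close> agree
          anyway.\<close>
        have "g \<cdot>\<^bsub>E\<^esub> \<iota> = h \<cdot>\<^bsub>E\<^esub> \<iota>"
        proof (cases "is_initial E L")
          case True
          then have "\<exists>!f. f \<in> hom E L Q"
            using hom_Ob(2)[OF g] unfolding is_initial_def by blast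
          then show ?thesis
            using comp_hom[OF g \<iota>] comp_hom[OF h \<iota>] by blast
        next
          case False
          then have "nonempty_ob E L"
            using hom_Ob(2)[OF q1] by (simp add: nonempty_ob_def)
          then have epi: "epimorphic E L (boundary_maps (Suc n) ws L l)"
            by (rule cover[OF ws L])
          have "(g \<cdot>\<^bsub>E\<^esub> \<iota>) \<cdot>\<^bsub>E\<^esub> f = (h \<cdot>\<^bsub>E\<^esub> \<iota>) \<cdot>\<^bsub>E\<^esub> f" if f_mem: "f \<in> boundary_maps (Suc n) ws L l" for f
          proof -
            obtain v where v: "v \<in> S (Suc n)" and f: "f \<in> hom E (top_vertex U v) L"
              and v_faces: "\<And>j. j \<le> Suc n \<Longrightarrow> face j v = ws ! j \<and> face_arr j v = l j \<cdot>\<^bsub>E\<^esub> f"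
              using f_mem unfolding boundary_maps_def by blast
            have "\<iota> \<cdot>\<^bsub>E\<^esub> f = \<kappa> \<cdot>\<^bsub>E\<^esub> inH (Suc n) v"
            proof (rule limit_eqI[OF cosk_diagram lim comp_hom[OF \<iota> f] comp_hom[OF \<kappa> inH_hom[OF v]]])
              fix j assume j: "j \<in> {..Suc n}"
              then have j': "j \<le> Suc n"
                by simp
              have "p j \<cdot>\<^bsub>E\<^esub> (\<iota> \<cdot>\<^bsub>E\<^esub> f) = inH n (w j) \<cdot>\<^bsub>E\<^esub> (l j \<cdot>\<^bsub>E\<^esub> f)"
                using comp_assoc[OF p[OF j'] \<iota> f] comp_assoc[OF inH_hom[OF w[OF j']] l[OF j'] f] p\<iota>[OF j]
                by simp
              moreover have "p j \<cdot>\<^bsub>E\<^esub> (\<kappa> \<cdot>\<^bsub>E\<^esub> inH (Suc n) v) = inH n (w j) \<cdot>\<^bsub>E\<^esub> (l j \<cdot>\<^bsub>E\<^esub> f)"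
                using comp_assoc[OF p[OF j'] \<kappa> inH_hom[OF v]] p\<kappa>[OF j] sface_inH[OF j' v] v_faces[OF j']
                  ws_nth[OF j'] by simp
              ultimately show "p j \<cdot>\<^bsub>E\<^esub> (\<iota> \<cdot>\<^bsub>E\<^esub> f) = p j \<cdot>\<^bsub>E\<^esub> (\<kappa> \<cdot>\<^bsub>E\<^esub> inH (Suc n) v)"
                by simp
            qed
            then show ?thesis
              using comp_assoc[OF g \<iota> f] comp_assoc[OF h \<iota> f] g\<kappa>
                comp_assoc[OF g \<kappa> inH_hom[OF v]] comp_assoc[OF h \<kappa> inH_hom[OF v]] by simp
          qed
          then show ?thesis
            using epi comp_hom[OF g \<iota>] comp_hom[OF h \<iota>] unfolding epimorphic_def by blast
        qed
        then show ?thesis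
          using q_eq comp_assoc[OF g \<iota> q1] comp_assoc[OF h \<iota> q1] by simp
      qed
    qed
  qed
  then show ?thesis
    unfolding cosk_epi_def using lim \<kappa> p\<kappa> by (intro exI[of _ K] exI[of _ p] exI[of _ \<kappa>]) simp
qed

end

section \<open>Boundaries and their limits\<close>

lemma epimorphic_mono: "epimorphic E P F \<Longrightarrow> F \<subseteq> G \<Longrightarrow> epimorphic E P G"
  unfolding epimorphic_def by blast

text \<open>Renaming the objects of a diagram along a bijection \<open>b\<close> with inverse \<open>c\<close>.\<close>

lemma is_limit_reindex:
  assumes lim: "is_limit E X F R P p" and diag: "is_diagram E X F R"
    and b: "\<And>x. x \<in> X' \<Longrightarrow> b x \<in> X \<and> c (b x) = x" and c: "\<And>x. x \<in> X \<Longrightarrow> c x \<in> X' \<and> b (c x) = x"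
    and F': "\<And>x. x \<in> X' \<Longrightarrow> F' x = F (b x)"
    and R': "\<And>x m y n. (x, m, y, n) \<in> R' \<longleftrightarrow> x \<in> X' \<and> y \<in> X' \<and> (b x, m, b y, n) \<in> R"
  shows "is_limit E X' F' R' P (\<lambda>x. p (b x))"
proof -
  have cone': "is_cone E X' F' R' Q (\<lambda>x. q (b x))" if q: "is_cone E X F R Q q" for Q q
  proof (rule is_coneI)
    show "Q \<in> Ob E"
      by (rule is_coneD(1)[OF q])
    show "q (b x) \<in> hom E Q (F' x)" if "x \<in> X'" for x
      using is_coneD(2)[OF q, of "b x"] b[OF that] F'[OF that] by simp
    show "m \<cdot>\<^bsub>E\<^esub> q (b x) = n \<cdot>\<^bsub>E\<^esub> q (b y)" if "(x, m, y, n) \<in> R'" for x m y n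
      using that unfolding R' by (intro is_coneD(3)[OF q]) simp
  qed
  have cone: "is_cone E X F R Q (\<lambda>x. q (c x))" if q: "is_cone E X' F' R' Q q" for Q q
  proof (rule is_coneI)
    show "Q \<in> Ob E"
      by (rule is_coneD(1)[OF q])
    show "q (c x) \<in> hom E Q (F x)" if "x \<in> X" for x
      using is_coneD(2)[OF q, of "c x"] c[OF that] F'[of "c x"] by simp
    fix x m y n assume R: "(x, m, y, n) \<in> R"
    obtain B where "x \<in> X" "y \<in> X" "m \<in> hom E (F x) B" "n \<in> hom E (F y) B"
      by (rule is_diagramD[OF diag R])
    then have "(c x, m, c y, n) \<in> R'"
      unfolding R' using c R by simp
    then show "m \<cdot>\<^bsub>E\<^esub> q (c x) = n \<cdot>\<^bsub>E\<^esub> q (c y)"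
      by (rule is_coneD(3)[OF q])
  qed
  show ?thesis
    unfolding is_limit_def
  proof (intro conjI allI impI)
    show "is_cone E X' F' R' P (\<lambda>x. p (b x))"
      by (rule cone'[OF limit_cone[OF lim]])
    fix Q q assume "is_cone E X' F' R' Q q"
    then have "is_cone E X F R Q (\<lambda>x. q (c x))"
      by (rule cone)
    then have "\<exists>!f. f \<in> hom E Q P \<and> (\<forall>x\<in>X. p x \<cdot>\<^bsub>E\<^esub> f = q (c x))"
      using lim unfolding is_limit_def by blast
    moreover have "(\<forall>x\<in>X. p x \<cdot>\<^bsub>E\<^esub> f = q (c x)) \<longleftrightarrow> (\<forall>x\<in>X'. p (b x) \<cdot>\<^bsub>E\<^esub> f = q x)" for f
    proof (intro iffI ballI)
      show "p (b x) \<cdot>\<^bsub>E\<^esub> f = q x" if "\<forall>x\<in>X. p x \<cdot>\<^bsub>E\<^esub> f = q (c x)" "x \<in> X'" for x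
        using bspec[OF that(1), of "b x"] b[OF that(2)] by simp
      show "p x \<cdot>\<^bsub>E\<^esub> f = q (c x)" if "\<forall>x\<in>X'. p (b x) \<cdot>\<^bsub>E\<^esub> f = q x" "x \<in> X" for x
        using bspec[OF that(1), of "c x"] c[OF that(2)] by simp
    qed
    ultimately show "\<exists>!f. f \<in> hom E Q P \<and> (\<forall>x\<in>X'. p (b x) \<cdot>\<^bsub>E\<^esub> f = q x)"
      by simp
  qed
qed

text \<open>In the \<open>0\<close>-span construction all maps from an object of \<open>C\<close> to \<open>P\<^sub>i\<^sub>j\<close> are spans in \<open>S\<^sub>1\<close>, so that
  the condition on \<open>P\<^sub>i\<^sub>j\<close> takes the form that it has in the \<open>1\<close>-span construction.\<close>

lemma zero_span1_cover:
  assumes "maps_cover_P2 E I U C" and "i \<in> I" and "j \<in> I" and P: "is_P2 E U i j P p"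
    and "nonempty_ob E P" and E: "is_category E"
  shows "epimorphic E P {f. \<exists>V. f \<in> hom E V P \<and>
    span1 i (p 0 \<cdot>\<^bsub>E\<^esub> f) V (p 1 \<cdot>\<^bsub>E\<^esub> f) j \<in> zero_span1 E I U C}"
proof (rule epimorphic_mono)
  show "epimorphic E P (maps_into E C P)"
    using assms unfolding maps_cover_P2_def by blast
  interpret cat E
    by unfold_locales (rule E)
  have p: "p 0 \<in> hom E P (U i)" "p 1 \<in> hom E P (U j)"
    using limit_hom[OF P[unfolded is_P2_def], of 0] limit_hom[OF P[unfolded is_P2_def], of 1] by simp_all
  show "maps_into E C P \<subseteq> {f. \<exists>V. f \<in> hom E V P \<and>
      span1 i (p 0 \<cdot>\<^bsub>E\<^esub> f) V (p 1 \<cdot>\<^bsub>E\<^esub> f) j \<in> zero_span1 E I U C}"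
  proof
    fix f assume "f \<in> maps_into E C P"
    then obtain V where V: "V \<in> C" and f: "f \<in> hom E V P"
      by (auto simp: maps_into_def)
    have "span1 i (p 0 \<cdot>\<^bsub>E\<^esub> f) V (p 1 \<cdot>\<^bsub>E\<^esub> f) j \<in> all_span1 E I U"
      unfolding all_span1_def using assms(2,3) hom_Ob(1)[OF f] comp_hom[OF p(1) f] comp_hom[OF p(2) f]
      by blast
    then show "f \<in> {f. \<exists>V. f \<in> hom E V P \<and>
        span1 i (p 0 \<cdot>\<^bsub>E\<^esub> f) V (p 1 \<cdot>\<^bsub>E\<^esub> f) j \<in> zero_span1 E I U C}"
      using f V by (auto simp: zero_span1_def span1_def)
  qed
qed

lemma spans_Suc_Suc:
  assumes "w \<in> spans E I U C S1 (Suc (Suc n))"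
  shows "top_vertex U w \<in> C"
    and "is_boundary (spans E I U C S1 (Suc n)) (Suc (Suc n)) (map (\<lambda>i. face i w) [0..<n + 3])"
    and "is_cone E {..Suc (Suc n)} (\<lambda>a. top_vertex U (face a w))
      (boundary_rel (Suc (Suc n)) (map (\<lambda>i. face i w) [0..<n + 3])) (top_vertex U w)
      (\<lambda>a. face_arr a w)"
proof -
  obtain W fs where w: "w = Span W fs" and W: "W \<in> C"
    and bd: "is_boundary (spans E I U C S1 (Suc n)) (n + 2) (map snd fs)"
    and cone: "is_cone E {..n + 2} (\<lambda>a. top_vertex U (snd (fs ! a)))
      (boundary_rel (n + 2) (map snd fs)) W (\<lambda>a. fst (fs ! a))"
    using assms by auto
  have "length fs = n + 3"
    using bd by (simp add: is_boundary_def)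
  then have fs: "map snd fs = map (\<lambda>i. face i w) [0..<n + 3]"
    by (intro nth_equalityI) (simp_all add: w face_def del: upt_Suc)
  show "top_vertex U w \<in> C"
    using W by (simp add: w)
  show "is_boundary (spans E I U C S1 (Suc n)) (Suc (Suc n)) (map (\<lambda>i. face i w) [0..<n + 3])"
    using bd unfolding fs by simp
  show "is_cone E {..Suc (Suc n)} (\<lambda>a. top_vertex U (face a w))
      (boundary_rel (Suc (Suc n)) (map (\<lambda>i. face i w) [0..<n + 3])) (top_vertex U w)
      (\<lambda>a. face_arr a w)"
    using cone unfolding fs by (simp add: w face_def face_arr_def)
qed

lemma span_simplicial_spans:
  assumes topos: "topos_presentation E D J \<Phi> \<phi>" and S1: "S1 \<subseteq> all_span1 E I U"
    and ref: "is_span_refinement E U inU (spans E I U C S1) K pr H inH h"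
  shows "span_simplicial E D J \<Phi> \<phi> U (spans E I U C S1) H inH"
proof -
  let ?S = "spans E I U C S1"
  note ref' = ref[unfolded is_span_refinement_def]
  have faces: "face i w \<in> ?S n \<and> face_arr i w \<in> hom E (top_vertex U w) (top_vertex U (face i w))"
    if w: "w \<in> ?S (Suc n)" and i: "i \<le> Suc n" for w n i
  proof (cases n)
    case 0
    then obtain k u V v l where "w = span1 k u V v l" "k \<in> I" "l \<in> I" "u \<in> hom E V (U k)" "v \<in> hom E V (U l)"
      using w S1 by (auto simp: all_span1_def)
    moreover have "i = 0 \<or> i = 1"
      using i 0 by auto
    ultimately show ?thesis
      using 0 by (auto simp: span1_def face_def face_arr_def)
  next
    case (Suc m)
    have wm: "w \<in> ?S (Suc (Suc m))"
      using w Suc by (simp only:)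
    have "face i w \<in> set (map (\<lambda>i. face i w) [0..<m + 3])"
      using i Suc by (auto simp del: upt_Suc)
    moreover have "set (map (\<lambda>i. face i w) [0..<m + 3]) \<subseteq> ?S (Suc m)"
      using spans_Suc_Suc(2)[OF wm] unfolding is_boundary_def by blast
    ultimately have "face i w \<in> ?S (Suc m)"
      by blast
    then show ?thesis
      using is_coneD(2)[OF spans_Suc_Suc(3)[OF wm], of i] i Suc by simp
  qed
  show ?thesis
  proof (intro span_simplicial.intro span_simplicial_axioms.intro)
    show "topos_presentation E D J \<Phi> \<phi>"
      by (rule topos)
    show "is_coproduct E (?S n) (top_vertex U) (sob H n) (inH n)" for n
      using ref'[THEN conjunct1] by blast
    show "sface H (Suc n) i \<in> hom E (sob H (Suc n)) (sob H n)" if "i \<le> Suc n" for n i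
      using ref'[THEN conjunct2, THEN conjunct1] that by blast
    show "sface H (Suc n) i \<cdot>\<^bsub>E\<^esub> inH (Suc n) w = inH n (face i w) \<cdot>\<^bsub>E\<^esub> face_arr i w"
      if "i \<le> Suc n" "w \<in> ?S (Suc n)" for n i w
      using ref'[THEN conjunct2, THEN conjunct1] that by blast
    show "face i w \<in> ?S n" if "w \<in> ?S (Suc n)" "i \<le> Suc n" for w n i
      using faces[OF that] by blast
    show "face_arr i w \<in> hom E (top_vertex U w) (top_vertex U (face i w))"
      if "w \<in> ?S (Suc n)" "i \<le> Suc n" for w n i
      using faces[OF that] by blast
    fix w n i j assume w: "w \<in> ?S (Suc (Suc n))" and ij: "i < j" "j \<le> Suc (Suc n)"
    have nth: "map (\<lambda>i. face i w) [0..<n + 3] ! a = face a w" if "a \<le> Suc (Suc n)" for a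
      using that by (simp del: upt_Suc)
    show "face i (face j w) = face (j - 1) (face i w)"
      using spans_Suc_Suc(2)[OF w] ij nth[of i] nth[of j] unfolding is_boundary_def by auto
    have "(j, face_arr i (face j w), i, face_arr (j - 1) (face i w)) \<in>
        boundary_rel (Suc (Suc n)) (map (\<lambda>i. face i w) [0..<n + 3])"
      unfolding boundary_rel_def mem_Collect_eq using ij nth[of i] nth[of j]
      by (intro exI[of _ i] exI[of _ j]) auto
    then show "face_arr i (face j w) \<cdot>\<^bsub>E\<^esub> face_arr j w = face_arr (j - 1) (face i w) \<cdot>\<^bsub>E\<^esub> face_arr i w"
      by (rule is_coneD(3)[OF spans_Suc_Suc(3)[OF w]])
  qed
qed

text \<open>Above degree \<open>1\<close>, every map from an object of \<open>C\<close> to the limit of a boundary is a span.\<close>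

lemma maps_into_boundary:
  assumes E: "is_category E" and diag: "is_diagram E {..n + 2} (\<lambda>a. top_vertex U (ws ! a)) (boundary_rel (n + 2) ws)"
    and ws: "is_boundary (spans E I U C S1 (Suc n)) (n + 2) ws"
    and L: "is_limit E {..n + 2} (\<lambda>a. top_vertex U (ws ! a)) (boundary_rel (n + 2) ws) L l"
    and f: "f \<in> maps_into E C L"
  shows "\<exists>w\<in>spans E I U C S1 (Suc (Suc n)). f \<in> hom E (top_vertex U w) L \<and>
     (\<forall>j\<le>n + 2. face j w = ws ! j \<and> face_arr j w = l j \<cdot>\<^bsub>E\<^esub> f)"
proof -
  interpret cat E
    by unfold_locales (rule E)
  obtain W where W: "W \<in> C" and fW: "f \<in> hom E W L"
    using f by (auto simp: maps_into_def)
  define fs where "fs = map (\<lambda>j. (l j \<cdot>\<^bsub>E\<^esub> f, ws ! j)) [0..<n + 3]"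
  have len: "length ws = n + 3"
    using ws by (simp add: is_boundary_def)
  have fs: "map snd fs = ws"
    unfolding fs_def using len by (intro nth_equalityI) (simp_all del: upt_Suc)
  have fs_nth: "fs ! j = (l j \<cdot>\<^bsub>E\<^esub> f, ws ! j)" if "j \<le> n + 2" for j
    using that by (simp add: fs_def del: upt_Suc)
  have cone: "is_cone E {..n + 2} (\<lambda>a. top_vertex U (snd (fs ! a))) (boundary_rel (n + 2) (map snd fs))
      W (\<lambda>a. fst (fs ! a))"
  proof (rule is_coneI)
    note lf = cone_comp[OF diag limit_cone[OF L] fW]
    show "W \<in> Ob E"
      by (rule is_coneD(1)[OF lf])
    show "fst (fs ! a) \<in> hom E W (top_vertex U (snd (fs ! a)))" if "a \<in> {..n + 2}" for a
      using is_coneD(2)[OF lf that] fs_nth that by simp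
    fix x a y b assume R: "(x, a, y, b) \<in> boundary_rel (n + 2) (map snd fs)"
    then have "x \<le> n + 2" "y \<le> n + 2"
      by (auto simp: boundary_rel_def)
    then show "a \<cdot>\<^bsub>E\<^esub> fst (fs ! x) = b \<cdot>\<^bsub>E\<^esub> fst (fs ! y)"
      using is_coneD(3)[OF lf R[unfolded fs]] fs_nth by simp
  qed
  have "Span W fs \<in> spans E I U C S1 (Suc (Suc n))"
    unfolding spans.simps mem_Collect_eq
    using W ws cone by (intro exI[of _ W] exI[of _ fs]) (simp add: fs)
  then show ?thesis
    using fW fs_nth by (intro bexI[of _ "Span W fs"]) (simp_all add: face_def face_arr_def)
qed

text \<open>Boundaries list the faces by increasing index, and face \<open>a\<close> omits vertex \<open>a\<close>; so the orders of the
  factors of \<open>P\<^sub>i\<^sub>j\<close> and \<open>P\<^sub>l\<^sub>t\<^sub>r\<close> are the reverse ones.\<close>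

lemma is_P2_boundary:
  assumes L: "is_limit E {..Suc 0} (\<lambda>a. top_vertex U (ws ! a)) (boundary_rel (Suc 0) ws) L l"
    and diag: "is_diagram E {..Suc 0} (\<lambda>a. top_vertex U (ws ! a)) (boundary_rel (Suc 0) ws)"
    and "ws ! 0 = Vertex j" and "ws ! 1 = Vertex i"
  shows "is_P2 E U i j L (\<lambda>x. l (1 - x))"
  unfolding is_P2_def
proof (rule is_limit_reindex[OF L diag, where b = "\<lambda>x. 1 - x" and c = "\<lambda>x. 1 - x"])
  show "[U i, U j] ! x = top_vertex U (ws ! (1 - x))" if "x \<in> {..<2}" for x
    using that assms(3,4) by (auto simp: less_2_cases_iff)
qed (auto simp: boundary_rel_def)

lemma is_P3_boundary:
  assumes L: "is_limit E {..Suc (Suc 0)} (\<lambda>a. top_vertex U (ws ! a)) (boundary_rel (Suc (Suc 0)) ws) L l"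
    and diag: "is_diagram E {..Suc (Suc 0)} (\<lambda>a. top_vertex U (ws ! a)) (boundary_rel (Suc (Suc 0)) ws)"
    and top: "\<And>a. a \<le> 2 \<Longrightarrow> top_vertex U (ws ! a) = apex (ws ! a)"
  shows "is_P3 E (ws ! 2) (ws ! 1) (ws ! 0) L (\<lambda>x. l (2 - x))"
  unfolding is_P3_def
proof (rule is_limit_reindex[OF L diag, where b = "\<lambda>x. 2 - x" and c = "\<lambda>x. 2 - x"])
  have lt3: "x < 3 \<longleftrightarrow> x = 0 \<or> x = 1 \<or> x = (2 :: nat)" for x
    by auto
  show "[apex (ws ! 2), apex (ws ! 1), apex (ws ! 0)] ! x = top_vertex U (ws ! (2 - x))"
    if "x \<in> {..<3}" for x
    using that top by (auto simp: lt3 numeral_2_eq_2)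
  have rel: "(x, m, y, n) \<in> boundary_rel (Suc (Suc 0)) ws \<longleftrightarrow>
      x = 1 \<and> y = 0 \<and> m = face_arr 0 (ws ! 1) \<and> n = face_arr 0 (ws ! 0) \<or>
      x = 2 \<and> y = 0 \<and> m = face_arr 0 (ws ! 2) \<and> n = face_arr 1 (ws ! 0) \<or>
      x = 2 \<and> y = 1 \<and> m = face_arr 1 (ws ! 2) \<and> n = face_arr 1 (ws ! 1)" for x m y n
  proof -
    have "y < x \<and> x \<le> Suc (Suc 0) \<longleftrightarrow> x = 1 \<and> y = 0 \<or> x = 2 \<and> y = 0 \<or> x = 2 \<and> y = 1"
      by auto
    then show ?thesis
      unfolding boundary_rel_def by auto
  qed
  show "(x, m, y, n) \<in> {(0, face_arr 1 (ws ! 2), 1, face_arr 1 (ws ! 1)),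
        (0, face_arr 0 (ws ! 2), 2, face_arr 1 (ws ! 0)), (1, face_arr 0 (ws ! 1), 2, face_arr 0 (ws ! 0))} \<longleftrightarrow>
      x \<in> {..<3} \<and> y \<in> {..<3} \<and> (2 - x, m, 2 - y, n) \<in> boundary_rel (Suc (Suc 0)) ws" for x m y n
    unfolding rel by (auto simp: lt3)
qed auto

theorem proposition4p5:
  fixes E :: "('o, 'a) category"
    and I :: "'i set" and U :: "'i \<Rightarrow> 'o" and \<Sigma>U :: 'o and inU :: "'i \<Rightarrow> 'a"
    and C :: "'o set" and S1 :: "('i, 'o, 'a) span set"
    and K H :: "('o, 'a) simplicial" and pr :: "nat \<Rightarrow> nat \<Rightarrow> 'a"
    and inH :: "nat \<Rightarrow> ('i, 'o, 'a) span \<Rightarrow> 'a" and h :: "nat \<Rightarrow> 'a"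
  assumes "universe TYPE('u)" and "grothendieck_topos TYPE('u) E"
    and "is_cover TYPE('u) E I U \<Sigma>U inU"
    and "zero_span_set E I U C \<and> S1 = zero_span1 E I U C \<and> maps_cover_P2 E I U C \<or>
         one_span_set E I U S1 \<and> C = apex ` S1 \<and> spans_cover_P2 E I U S1"
    and "maps_cover_P3 E C S1"
    and "is_cech E \<Sigma>U K pr"
    and "is_span_refinement E U inU (spans E I U C S1) K pr H inH h"
  shows "cosk_epi E H 1 \<and> cosk_epi E H 2 \<and>
         ((\<forall>k\<ge>3. maps_cover_boundaries E U C (spans E I U C S1) k) \<longrightarrow> is_hypercover E H)"
proof -
  let ?S = "spans E I U C S1"
  note topos = assms(2)[unfolded grothendieck_topos_def]
  have E: "is_category E"
    using topos by blast
  obtain D :: "('u, 'u) category" and J \<Phi> \<phi> where "is_category D" "small TYPE('u) (Ob D)"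
    "small TYPE('u) (Ar D)" "is_topology D J" "is_equivalence E (Sh D J) \<Phi> \<phi>"
    using topos by blast
  then have presentation: "topos_presentation E D J \<Phi> \<phi>"
    using E assms(1)
    by (intro topos_presentation.intro cat.intro site.intro site_axioms.intro
        topos_presentation_axioms.intro)
  have S1: "S1 \<subseteq> all_span1 E I U"
    using assms(4) by (auto simp: zero_span1_def one_span_set_def)
  interpret span_simplicial E D J \<Phi> \<phi> U ?S H inH
    by (rule span_simplicial_spans[OF presentation S1 assms(7)])
  have P2: "epimorphic E P {f. \<exists>V. f \<in> hom E V P \<and> span1 i (p 0 \<cdot>\<^bsub>E\<^esub> f) V (p 1 \<cdot>\<^bsub>E\<^esub> f) j \<in> S1}"
    if "i \<in> I" "j \<in> I" "is_P2 E U i j P p" "nonempty_ob E P" for i j P p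
    using assms(4)
  proof
    assume "zero_span_set E I U C \<and> S1 = zero_span1 E I U C \<and> maps_cover_P2 E I U C"
    then show ?thesis
      using zero_span1_cover[OF _ that E, of C] by simp
  next
    assume "one_span_set E I U S1 \<and> C = apex ` S1 \<and> spans_cover_P2 E I U S1"
    then show ?thesis
      using that unfolding spans_cover_P2_def by blast
  qed
  have epi1: "cosk_epi E H (Suc 0)"
  proof (rule cosk_epi_Suc)
    fix ws L l assume ws: "is_boundary (?S 0) (Suc 0) ws"
      and L: "is_limit E {..Suc 0} (\<lambda>a. top_vertex U (ws ! a)) (boundary_rel (Suc 0) ws) L l"
      and ne: "nonempty_ob E L"
    obtain i j where ij: "i \<in> I" "j \<in> I" "ws ! 0 = Vertex j" "ws ! 1 = Vertex i"
      using boundaryD(1)[OF ws, of 0] boundaryD(1)[OF ws, of 1] by auto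
    show "epimorphic E L (boundary_maps (Suc 0) ws L l)"
    proof (rule epimorphic_mono[OF P2[OF ij(1,2) is_P2_boundary[OF L boundary_diagram[OF ws] ij(3,4)] ne]])
      show "{f. \<exists>V. f \<in> hom E V L \<and> span1 i (l (1 - 0) \<cdot>\<^bsub>E\<^esub> f) V (l (1 - 1) \<cdot>\<^bsub>E\<^esub> f) j \<in> S1}
          \<subseteq> boundary_maps (Suc 0) ws L l"
      proof clarify
        fix f V assume f: "f \<in> hom E V L" and w: "span1 i (l (1 - 0) \<cdot>\<^bsub>E\<^esub> f) V (l (1 - 1) \<cdot>\<^bsub>E\<^esub> f) j \<in> S1"
        show "f \<in> boundary_maps (Suc 0) ws L l"
          unfolding boundary_maps_def mem_Collect_eq
        proof (rule bexI)
          show "span1 i (l 1 \<cdot>\<^bsub>E\<^esub> f) V (l 0 \<cdot>\<^bsub>E\<^esub> f) j \<in> ?S (Suc 0)"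
            using w by simp
        qed (use f ij in \<open>auto simp: span1_def face_def face_arr_def le_Suc_eq\<close>)
      qed
    qed
  qed
  have maps: "maps_into E C L \<subseteq> boundary_maps (Suc (Suc n)) ws L l"
    if ws: "is_boundary (?S (Suc n)) (Suc (Suc n)) ws"
      and L: "is_limit E {..Suc (Suc n)} (\<lambda>a. top_vertex U (ws ! a)) (boundary_rel (Suc (Suc n)) ws) L l"
    for n ws L l
    using maps_into_boundary[of E n U ws, unfolded add_2_eq_Suc', OF E boundary_diagram[OF ws] ws L]
    unfolding boundary_maps_def by blast
  have epi2: "cosk_epi E H (Suc (Suc 0))"
  proof (rule cosk_epi_Suc)
    fix ws L l assume ws: "is_boundary (?S (Suc 0)) (Suc (Suc 0)) ws"
      and L: "is_limit E {..Suc (Suc 0)} (\<lambda>a. top_vertex U (ws ! a)) (boundary_rel (Suc (Suc 0)) ws) L l"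
      and ne: "nonempty_ob E L"
    have mem: "ws ! a \<in> S1" if "a \<le> 2" for a
      using boundaryD(1)[OF ws, of a] that by simp
    have "top_vertex U w = apex w" if "w \<in> S1" for w
      using S1 that by (auto simp: all_span1_def span1_def)
    then have P3: "is_P3 E (ws ! 2) (ws ! 1) (ws ! 0) L (\<lambda>x. l (2 - x))"
      by (rule is_P3_boundary[OF L boundary_diagram[OF ws]]) (simp add: mem)
    have faces: "face 1 (ws ! 1) = face 1 (ws ! 2)" "face 0 (ws ! 2) = face 1 (ws ! 0)"
      "face 0 (ws ! 1) = face 0 (ws ! 0)"
      using boundaryD(2)[OF ws, of 1 2] boundaryD(2)[OF ws, of 0 2] boundaryD(2)[OF ws, of 0 1] by simp_all
    have "epimorphic E L (maps_into E C L)"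
      by (rule assms(5)[unfolded maps_cover_P3_def, rule_format, OF mem mem mem faces P3 ne]) simp_all
    then show "epimorphic E L (boundary_maps (Suc (Suc 0)) ws L l)"
      by (rule epimorphic_mono[OF _ maps[OF ws L]])
  qed
  have "is_hypercover E H" if covers: "\<forall>k\<ge>3. maps_cover_boundaries E U C ?S k"
    unfolding is_hypercover_def
  proof (intro allI impI)
    fix k :: nat assume "1 \<le> k"
    then consider "k = Suc 0" | "k = Suc (Suc 0)" | "3 \<le> k"
      by linarith
    then show "cosk_epi E H k"
    proof cases
      case 3
      define n where "n = k - 2"
      have k: "k = Suc (Suc n)"
        using 3 by (simp add: n_def)
      have "cosk_epi E H (Suc (Suc n))"
      proof (rule cosk_epi_Suc)
        fix ws L l assume ws: "is_boundary (?S (Suc n)) (Suc (Suc n)) ws"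
          and L: "is_limit E {..Suc (Suc n)} (\<lambda>a. top_vertex U (ws ! a)) (boundary_rel (Suc (Suc n)) ws) L l"
          and ne: "nonempty_ob E L"
        have "maps_cover_boundaries E U C ?S (Suc (Suc n))"
          using covers 3 k by simp
        then have "epimorphic E L (maps_into E C L)"
          using ws L ne unfolding maps_cover_boundaries_def diff_Suc_1 by blast
        then show "epimorphic E L (boundary_maps (Suc (Suc n)) ws L l)"
          by (rule epimorphic_mono[OF _ maps[OF ws L]])
      qed
      then show ?thesis
        by (simp only: k)
    qed (use epi1 epi2 in simp_all)
  qed
  then show ?thesis
    using epi1 epi2 by (simp add: numeral_2_eq_2)
qed

end
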